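(* Any uniquely eliminating modality determines a $\Sigma$-closed reflective subuniverse with the same modal types.
   Context: Setting: Martin-Löf dependent type theory with the usual type formers and a univalent universe $\mathcal{U}$ (function extensionality holds). A uniquely eliminating modality consists of a function $\bigcirc:\mathcal{U}\to\mathcal{U}$ and a family of functions $\eta_A:A\to\bigcirc A$ ($A:\mathcal{U}$) such that for every $A:\mathcal{U}$ and $P:\bigcirc A\to\mathcal{U}$ the function $\big(\prod_{x:\bigcirc A}\bigcirc(P(x))\big)\to\big(\prod_{a:A}\bigcirc(P(\eta_A(a)))\big)$, $f\mapsto f\circ\eta_A$, is an equivalence. A type $X:\mathcal{U}$ is modal if $\eta_X$ is an equivalence. A reflective subuniverse $L$ is a predicate $\mathcal{U}\to\mathsf{Prop}$ (the types satisfying it are called $L$-local, or modal) together with, for every $X:\mathcal{U}$, a map $\eta_X:X\to LX$ into an $L$-local type $LX$ such that for every $L$-local $Z$ the map $-\circ\eta_X:(LX\to Z)\to(X\to Z)$ is an equivalence. It is $\Sigma$-closed if $\sum_{x:X}P(x)$ is $L$-local for every $L$-local type $X$ and every family $P$ of $L$-local types over $X$. *)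

theory Defs
  imports Main
begin

section \<open>Raw syntax\<close>

text \<open>
  Martin-Loef type theory with a cumulative hierarchy of Russell universes, formulated as in
  Appendix A.2 of the HoTT Book, except that identity types have the based path induction rule.
  Variables are de Bruijn indices. The number of variables bound in each argument can be read off
  from the function \<open>ren\<close> below; the first argument of each eliminator \<open>Ind...\<close> is its motive.
\<close>

datatype tm =
    Var nat
  | Univ nat
  | Pi tm tm | Lam tm tm | App tm tm (infixl "\<cdot>" 200)
  | Sig tm tm | Tup tm tm | IndSig tm tm tm
  | Coprod tm tm | InL tm | InR tm | IndCoprod tm tm tm tm
  | EmptyT | IndEmpty tm tm
  | UnitT | Star | IndUnit tm tm tm
  | NatT | Zero | Succ tm | IndNat tm tm tm tm
  | Eq tm tm tm | Refl tm | IndEq tm tm tm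
  | FunExt tm tm tm tm
  | UA nat tm tm

primrec scons :: "'a \<Rightarrow> (nat \<Rightarrow> 'a) \<Rightarrow> nat \<Rightarrow> 'a" (infixr ".:" 55) where
  "(a .: s) 0 = a"
| "(a .: s) (Suc n) = s n"

definition up_ren :: "(nat \<Rightarrow> nat) \<Rightarrow> nat \<Rightarrow> nat" where
  "up_ren r = 0 .: (\<lambda>n. Suc (r n))"

primrec ren :: "(nat \<Rightarrow> nat) \<Rightarrow> tm \<Rightarrow> tm" where
  "ren r (Var n) = Var (r n)"
| "ren r (Univ i) = Univ i"
| "ren r (Pi A B) = Pi (ren r A) (ren (up_ren r) B)"
| "ren r (Lam A b) = Lam (ren r A) (ren (up_ren r) b)"
| "ren r (f \<cdot> a) = ren r f \<cdot> ren r a"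
| "ren r (Sig A B) = Sig (ren r A) (ren (up_ren r) B)"
| "ren r (Tup a b) = Tup (ren r a) (ren r b)"
| "ren r (IndSig C g p) = IndSig (ren (up_ren r) C) (ren (up_ren (up_ren r)) g) (ren r p)"
| "ren r (Coprod A B) = Coprod (ren r A) (ren r B)"
| "ren r (InL a) = InL (ren r a)"
| "ren r (InR b) = InR (ren r b)"
| "ren r (IndCoprod C c d e) =
     IndCoprod (ren (up_ren r) C) (ren (up_ren r) c) (ren (up_ren r) d) (ren r e)"
| "ren r EmptyT = EmptyT"
| "ren r (IndEmpty C e) = IndEmpty (ren (up_ren r) C) (ren r e)"
| "ren r UnitT = UnitT"
| "ren r Star = Star"
| "ren r (IndUnit C c e) = IndUnit (ren (up_ren r) C) (ren r c) (ren r e)"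
| "ren r NatT = NatT"
| "ren r Zero = Zero"
| "ren r (Succ n) = Succ (ren r n)"
| "ren r (IndNat C z s n) =
     IndNat (ren (up_ren r) C) (ren r z) (ren (up_ren (up_ren r)) s) (ren r n)"
| "ren r (Eq A a b) = Eq (ren r A) (ren r a) (ren r b)"
| "ren r (Refl a) = Refl (ren r a)"
| "ren r (IndEq C c p) = IndEq (ren (up_ren (up_ren r)) C) (ren r c) (ren r p)"
| "ren r (FunExt A B f g) = FunExt (ren r A) (ren (up_ren r) B) (ren r f) (ren r g)"
| "ren r (UA i A B) = UA i (ren r A) (ren r B)"

definition shift :: "tm \<Rightarrow> nat \<Rightarrow> tm" (infixl "\<up>" 300) where
  "t \<up> k = ren (\<lambda>n. n + k) t"

definition up :: "(nat \<Rightarrow> tm) \<Rightarrow> nat \<Rightarrow> tm" where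
  "up s = Var 0 .: (\<lambda>n. s n \<up> 1)"

primrec subst :: "(nat \<Rightarrow> tm) \<Rightarrow> tm \<Rightarrow> tm" where
  "subst s (Var n) = s n"
| "subst s (Univ i) = Univ i"
| "subst s (Pi A B) = Pi (subst s A) (subst (up s) B)"
| "subst s (Lam A b) = Lam (subst s A) (subst (up s) b)"
| "subst s (f \<cdot> a) = subst s f \<cdot> subst s a"
| "subst s (Sig A B) = Sig (subst s A) (subst (up s) B)"
| "subst s (Tup a b) = Tup (subst s a) (subst s b)"
| "subst s (IndSig C g p) = IndSig (subst (up s) C) (subst (up (up s)) g) (subst s p)"
| "subst s (Coprod A B) = Coprod (subst s A) (subst s B)"
| "subst s (InL a) = InL (subst s a)"
| "subst s (InR b) = InR (subst s b)"
| "subst s (IndCoprod C c d e) =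
     IndCoprod (subst (up s) C) (subst (up s) c) (subst (up s) d) (subst s e)"
| "subst s EmptyT = EmptyT"
| "subst s (IndEmpty C e) = IndEmpty (subst (up s) C) (subst s e)"
| "subst s UnitT = UnitT"
| "subst s Star = Star"
| "subst s (IndUnit C c e) = IndUnit (subst (up s) C) (subst s c) (subst s e)"
| "subst s NatT = NatT"
| "subst s Zero = Zero"
| "subst s (Succ n) = Succ (subst s n)"
| "subst s (IndNat C z t n) =
     IndNat (subst (up s) C) (subst s z) (subst (up (up s)) t) (subst s n)"
| "subst s (Eq A a b) = Eq (subst s A) (subst s a) (subst s b)"
| "subst s (Refl a) = Refl (subst s a)"
| "subst s (IndEq C c p) = IndEq (subst (up (up s)) C) (subst s c) (subst s p)"
| "subst s (FunExt A B f g) = FunExt (subst s A) (subst (up s) B) (subst s f) (subst s g)"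
| "subst s (UA i A B) = UA i (subst s A) (subst s B)"

text \<open>
  For \<open>B\<close> over \<open>\<Gamma>, x : A\<close> and \<open>a\<close> over an extension of \<open>\<Gamma>\<close> by \<open>k\<close> variables, \<open>inst k a B\<close> is
  \<open>B[a/x]\<close> over that extension; \<open>inst2\<close> replaces the last two variables.
\<close>

definition inst :: "nat \<Rightarrow> tm \<Rightarrow> tm \<Rightarrow> tm" where
  "inst k a B = subst (a .: (\<lambda>n. Var (n + k))) B"

definition inst2 :: "tm \<Rightarrow> tm \<Rightarrow> tm \<Rightarrow> tm" where
  "inst2 a b C = subst (b .: a .: Var) C"


section \<open>Derived notions used in the axioms\<close>

definition fun_type :: "tm \<Rightarrow> tm \<Rightarrow> tm" (infixr "\<rightarrow>\<^sub>t" 110) where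
  "A \<rightarrow>\<^sub>t B = Pi A (B \<up> 1)"

definition prod_type :: "tm \<Rightarrow> tm \<Rightarrow> tm" (infixr "\<times>\<^sub>t" 120) where
  "A \<times>\<^sub>t B = Sig A (B \<up> 1)"

definition idfun :: "tm \<Rightarrow> tm" where
  "idfun A = Lam A (Var 0)"

text \<open>
  \<open>f : A \<rightarrow> B\<close> is an equivalence if it has a right inverse and a left inverse
  (Definition 2.4.10 of the HoTT Book).
\<close>

definition is_equiv :: "tm \<Rightarrow> tm \<Rightarrow> tm \<Rightarrow> tm" where
  "is_equiv A B f =
     Sig (B \<rightarrow>\<^sub>t A) (Pi (B \<up> 1) (Eq (B \<up> 2) (f \<up> 2 \<cdot> (Var 1 \<cdot> Var 0)) (Var 0)))
     \<times>\<^sub>t Sig (B \<rightarrow>\<^sub>t A) (Pi (A \<up> 1) (Eq (A \<up> 2) (Var 1 \<cdot> (f \<up> 2 \<cdot> Var 0)) (Var 0)))"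

definition equiv_type :: "tm \<Rightarrow> tm \<Rightarrow> tm" (infix "\<simeq>\<^sub>t" 105) where
  "A \<simeq>\<^sub>t B = Sig (A \<rightarrow>\<^sub>t B) (is_equiv (A \<up> 1) (B \<up> 1) (Var 0))"

definition id_equiv :: "tm \<Rightarrow> tm" where
  "id_equiv A = Tup (idfun A)
     (Tup (Tup (idfun A) (Lam A (Refl (Var 0)))) (Tup (idfun A) (Lam A (Refl (Var 0)))))"

text \<open>The canonical maps \<open>f = g \<rightarrow> (\<Prod>x:A. f x = g x)\<close> and \<open>A = B \<rightarrow> A \<simeq> B\<close>, by path induction.\<close>

definition happly :: "tm \<Rightarrow> tm \<Rightarrow> tm \<Rightarrow> tm \<Rightarrow> tm" where
  "happly A B f g = Lam (Eq (Pi A B) f g)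
     (IndEq (Pi (A \<up> 3) (Eq (inst 4 (Var 0) B) (f \<up> 4 \<cdot> Var 0) (Var 2 \<cdot> Var 0)))
            (Lam (A \<up> 1) (Refl (f \<up> 2 \<cdot> Var 0)))
            (Var 0))"

definition id_to_equiv :: "nat \<Rightarrow> tm \<Rightarrow> tm \<Rightarrow> tm" where
  "id_to_equiv i A B = Lam (Eq (Univ i) A B)
     (IndEq (A \<up> 3 \<simeq>\<^sub>t Var 1) (id_equiv (A \<up> 1)) (Var 0))"


section \<open>Judgements\<close>

text \<open>
  Contexts list the type of the most recent variable first. Some rules carry well-formedness
  premises that are redundant in the usual presentation. The last four rules are the function
  extensionality and univalence axioms (with congruence).
\<close>

inductive
  wf_ctx :: "tm list \<Rightarrow> bool" ("\<turnstile> _ ctx" [50] 50) and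
  typing :: "tm list \<Rightarrow> tm \<Rightarrow> tm \<Rightarrow> bool" ("_ \<turnstile> _ \<Ztypecolon> _" [50, 50, 50] 50) and
  conv :: "tm list \<Rightarrow> tm \<Rightarrow> tm \<Rightarrow> tm \<Rightarrow> bool" ("_ \<turnstile> _ \<doteq> _ \<Ztypecolon> _" [50, 50, 50, 50] 50)
where
  ctx_nil: "\<turnstile> [] ctx"
| ctx_cons: "\<lbrakk>\<turnstile> \<Gamma> ctx; \<Gamma> \<turnstile> A \<Ztypecolon> Univ i\<rbrakk> \<Longrightarrow> \<turnstile> A # \<Gamma> ctx"

| ty_var: "\<lbrakk>\<turnstile> \<Gamma> ctx; n < length \<Gamma>\<rbrakk> \<Longrightarrow> \<Gamma> \<turnstile> Var n \<Ztypecolon> (\<Gamma> ! n) \<up> Suc n"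
| ty_conv: "\<lbrakk>\<Gamma> \<turnstile> a \<Ztypecolon> A; \<Gamma> \<turnstile> A \<doteq> B \<Ztypecolon> Univ i\<rbrakk> \<Longrightarrow> \<Gamma> \<turnstile> a \<Ztypecolon> B"

| eq_refl: "\<Gamma> \<turnstile> a \<Ztypecolon> A \<Longrightarrow> \<Gamma> \<turnstile> a \<doteq> a \<Ztypecolon> A"
| eq_sym: "\<Gamma> \<turnstile> a \<doteq> b \<Ztypecolon> A \<Longrightarrow> \<Gamma> \<turnstile> b \<doteq> a \<Ztypecolon> A"
| eq_trans: "\<lbrakk>\<Gamma> \<turnstile> a \<doteq> b \<Ztypecolon> A; \<Gamma> \<turnstile> b \<doteq> c \<Ztypecolon> A\<rbrakk> \<Longrightarrow> \<Gamma> \<turnstile> a \<doteq> c \<Ztypecolon> A"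
| eq_conv: "\<lbrakk>\<Gamma> \<turnstile> a \<doteq> b \<Ztypecolon> A; \<Gamma> \<turnstile> A \<doteq> B \<Ztypecolon> Univ i\<rbrakk> \<Longrightarrow> \<Gamma> \<turnstile> a \<doteq> b \<Ztypecolon> B"

| ty_univ: "\<turnstile> \<Gamma> ctx \<Longrightarrow> \<Gamma> \<turnstile> Univ i \<Ztypecolon> Univ (Suc i)"
| ty_cumul: "\<Gamma> \<turnstile> A \<Ztypecolon> Univ i \<Longrightarrow> \<Gamma> \<turnstile> A \<Ztypecolon> Univ (Suc i)"
| eq_cumul: "\<Gamma> \<turnstile> A \<doteq> B \<Ztypecolon> Univ i \<Longrightarrow> \<Gamma> \<turnstile> A \<doteq> B \<Ztypecolon> Univ (Suc i)"

| ty_pi: "\<lbrakk>\<Gamma> \<turnstile> A \<Ztypecolon> Univ i; A # \<Gamma> \<turnstile> B \<Ztypecolon> Univ i\<rbrakk> \<Longrightarrow> \<Gamma> \<turnstile> Pi A B \<Ztypecolon> Univ i"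
| ty_lam: "\<lbrakk>\<Gamma> \<turnstile> A \<Ztypecolon> Univ i; A # \<Gamma> \<turnstile> B \<Ztypecolon> Univ i; A # \<Gamma> \<turnstile> b \<Ztypecolon> B\<rbrakk>
    \<Longrightarrow> \<Gamma> \<turnstile> Lam A b \<Ztypecolon> Pi A B"
| ty_app: "\<lbrakk>\<Gamma> \<turnstile> A \<Ztypecolon> Univ i; A # \<Gamma> \<turnstile> B \<Ztypecolon> Univ i; \<Gamma> \<turnstile> f \<Ztypecolon> Pi A B; \<Gamma> \<turnstile> a \<Ztypecolon> A\<rbrakk>
    \<Longrightarrow> \<Gamma> \<turnstile> f \<cdot> a \<Ztypecolon> inst 0 a B"
| eq_pi: "\<lbrakk>\<Gamma> \<turnstile> A \<Ztypecolon> Univ i; \<Gamma> \<turnstile> A \<doteq> A' \<Ztypecolon> Univ i; A # \<Gamma> \<turnstile> B \<doteq> B' \<Ztypecolon> Univ i\<rbrakk>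
    \<Longrightarrow> \<Gamma> \<turnstile> Pi A B \<doteq> Pi A' B' \<Ztypecolon> Univ i"
| eq_lam: "\<lbrakk>\<Gamma> \<turnstile> A \<Ztypecolon> Univ i; A # \<Gamma> \<turnstile> B \<Ztypecolon> Univ i; \<Gamma> \<turnstile> A \<doteq> A' \<Ztypecolon> Univ i; A # \<Gamma> \<turnstile> b \<doteq> b' \<Ztypecolon> B\<rbrakk>
    \<Longrightarrow> \<Gamma> \<turnstile> Lam A b \<doteq> Lam A' b' \<Ztypecolon> Pi A B"
| eq_app: "\<lbrakk>\<Gamma> \<turnstile> A \<Ztypecolon> Univ i; A # \<Gamma> \<turnstile> B \<Ztypecolon> Univ i;
      \<Gamma> \<turnstile> f \<doteq> f' \<Ztypecolon> Pi A B; \<Gamma> \<turnstile> a \<doteq> a' \<Ztypecolon> A\<rbrakk>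
    \<Longrightarrow> \<Gamma> \<turnstile> f \<cdot> a \<doteq> f' \<cdot> a' \<Ztypecolon> inst 0 a B"
| pi_beta: "\<lbrakk>\<Gamma> \<turnstile> A \<Ztypecolon> Univ i; A # \<Gamma> \<turnstile> B \<Ztypecolon> Univ i; A # \<Gamma> \<turnstile> b \<Ztypecolon> B; \<Gamma> \<turnstile> a \<Ztypecolon> A\<rbrakk>
    \<Longrightarrow> \<Gamma> \<turnstile> Lam A b \<cdot> a \<doteq> inst 0 a b \<Ztypecolon> inst 0 a B"
| pi_eta: "\<lbrakk>\<Gamma> \<turnstile> A \<Ztypecolon> Univ i; A # \<Gamma> \<turnstile> B \<Ztypecolon> Univ i; \<Gamma> \<turnstile> f \<Ztypecolon> Pi A B\<rbrakk>
    \<Longrightarrow> \<Gamma> \<turnstile> f \<doteq> Lam A (f \<up> 1 \<cdot> Var 0) \<Ztypecolon> Pi A B"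

| ty_sig: "\<lbrakk>\<Gamma> \<turnstile> A \<Ztypecolon> Univ i; A # \<Gamma> \<turnstile> B \<Ztypecolon> Univ i\<rbrakk> \<Longrightarrow> \<Gamma> \<turnstile> Sig A B \<Ztypecolon> Univ i"
| ty_tup: "\<lbrakk>\<Gamma> \<turnstile> A \<Ztypecolon> Univ i; A # \<Gamma> \<turnstile> B \<Ztypecolon> Univ i; \<Gamma> \<turnstile> a \<Ztypecolon> A; \<Gamma> \<turnstile> b \<Ztypecolon> inst 0 a B\<rbrakk>
    \<Longrightarrow> \<Gamma> \<turnstile> Tup a b \<Ztypecolon> Sig A B"
| ty_ind_sig: "\<lbrakk>\<Gamma> \<turnstile> A \<Ztypecolon> Univ i; A # \<Gamma> \<turnstile> B \<Ztypecolon> Univ i; Sig A B # \<Gamma> \<turnstile> C \<Ztypecolon> Univ j;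
      B # A # \<Gamma> \<turnstile> g \<Ztypecolon> inst 2 (Tup (Var 1) (Var 0)) C; \<Gamma> \<turnstile> p \<Ztypecolon> Sig A B\<rbrakk>
    \<Longrightarrow> \<Gamma> \<turnstile> IndSig C g p \<Ztypecolon> inst 0 p C"
| eq_sig: "\<lbrakk>\<Gamma> \<turnstile> A \<Ztypecolon> Univ i; \<Gamma> \<turnstile> A \<doteq> A' \<Ztypecolon> Univ i; A # \<Gamma> \<turnstile> B \<doteq> B' \<Ztypecolon> Univ i\<rbrakk>
    \<Longrightarrow> \<Gamma> \<turnstile> Sig A B \<doteq> Sig A' B' \<Ztypecolon> Univ i"
| eq_tup: "\<lbrakk>\<Gamma> \<turnstile> A \<Ztypecolon> Univ i; A # \<Gamma> \<turnstile> B \<Ztypecolon> Univ i;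
      \<Gamma> \<turnstile> a \<doteq> a' \<Ztypecolon> A; \<Gamma> \<turnstile> b \<doteq> b' \<Ztypecolon> inst 0 a B\<rbrakk>
    \<Longrightarrow> \<Gamma> \<turnstile> Tup a b \<doteq> Tup a' b' \<Ztypecolon> Sig A B"
| eq_ind_sig: "\<lbrakk>\<Gamma> \<turnstile> A \<Ztypecolon> Univ i; A # \<Gamma> \<turnstile> B \<Ztypecolon> Univ i; Sig A B # \<Gamma> \<turnstile> C \<doteq> C' \<Ztypecolon> Univ j;
      B # A # \<Gamma> \<turnstile> g \<doteq> g' \<Ztypecolon> inst 2 (Tup (Var 1) (Var 0)) C; \<Gamma> \<turnstile> p \<doteq> p' \<Ztypecolon> Sig A B\<rbrakk>
    \<Longrightarrow> \<Gamma> \<turnstile> IndSig C g p \<doteq> IndSig C' g' p' \<Ztypecolon> inst 0 p C"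
| sig_beta: "\<lbrakk>\<Gamma> \<turnstile> A \<Ztypecolon> Univ i; A # \<Gamma> \<turnstile> B \<Ztypecolon> Univ i; Sig A B # \<Gamma> \<turnstile> C \<Ztypecolon> Univ j;
      B # A # \<Gamma> \<turnstile> g \<Ztypecolon> inst 2 (Tup (Var 1) (Var 0)) C; \<Gamma> \<turnstile> a \<Ztypecolon> A; \<Gamma> \<turnstile> b \<Ztypecolon> inst 0 a B\<rbrakk>
    \<Longrightarrow> \<Gamma> \<turnstile> IndSig C g (Tup a b) \<doteq> inst2 a b g \<Ztypecolon> inst 0 (Tup a b) C"

| ty_coprod: "\<lbrakk>\<Gamma> \<turnstile> A \<Ztypecolon> Univ i; \<Gamma> \<turnstile> B \<Ztypecolon> Univ i\<rbrakk> \<Longrightarrow> \<Gamma> \<turnstile> Coprod A B \<Ztypecolon> Univ i"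
| ty_inl: "\<lbrakk>\<Gamma> \<turnstile> A \<Ztypecolon> Univ i; \<Gamma> \<turnstile> B \<Ztypecolon> Univ i; \<Gamma> \<turnstile> a \<Ztypecolon> A\<rbrakk> \<Longrightarrow> \<Gamma> \<turnstile> InL a \<Ztypecolon> Coprod A B"
| ty_inr: "\<lbrakk>\<Gamma> \<turnstile> A \<Ztypecolon> Univ i; \<Gamma> \<turnstile> B \<Ztypecolon> Univ i; \<Gamma> \<turnstile> b \<Ztypecolon> B\<rbrakk> \<Longrightarrow> \<Gamma> \<turnstile> InR b \<Ztypecolon> Coprod A B"
| ty_ind_coprod: "\<lbrakk>\<Gamma> \<turnstile> A \<Ztypecolon> Univ i; \<Gamma> \<turnstile> B \<Ztypecolon> Univ i; Coprod A B # \<Gamma> \<turnstile> C \<Ztypecolon> Univ j;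
      A # \<Gamma> \<turnstile> c \<Ztypecolon> inst 1 (InL (Var 0)) C; B # \<Gamma> \<turnstile> d \<Ztypecolon> inst 1 (InR (Var 0)) C;
      \<Gamma> \<turnstile> e \<Ztypecolon> Coprod A B\<rbrakk>
    \<Longrightarrow> \<Gamma> \<turnstile> IndCoprod C c d e \<Ztypecolon> inst 0 e C"
| eq_coprod: "\<lbrakk>\<Gamma> \<turnstile> A \<doteq> A' \<Ztypecolon> Univ i; \<Gamma> \<turnstile> B \<doteq> B' \<Ztypecolon> Univ i\<rbrakk>
    \<Longrightarrow> \<Gamma> \<turnstile> Coprod A B \<doteq> Coprod A' B' \<Ztypecolon> Univ i"
| eq_inl: "\<lbrakk>\<Gamma> \<turnstile> A \<Ztypecolon> Univ i; \<Gamma> \<turnstile> B \<Ztypecolon> Univ i; \<Gamma> \<turnstile> a \<doteq> a' \<Ztypecolon> A\<rbrakk>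
    \<Longrightarrow> \<Gamma> \<turnstile> InL a \<doteq> InL a' \<Ztypecolon> Coprod A B"
| eq_inr: "\<lbrakk>\<Gamma> \<turnstile> A \<Ztypecolon> Univ i; \<Gamma> \<turnstile> B \<Ztypecolon> Univ i; \<Gamma> \<turnstile> b \<doteq> b' \<Ztypecolon> B\<rbrakk>
    \<Longrightarrow> \<Gamma> \<turnstile> InR b \<doteq> InR b' \<Ztypecolon> Coprod A B"
| eq_ind_coprod: "\<lbrakk>\<Gamma> \<turnstile> A \<Ztypecolon> Univ i; \<Gamma> \<turnstile> B \<Ztypecolon> Univ i; Coprod A B # \<Gamma> \<turnstile> C \<doteq> C' \<Ztypecolon> Univ j;
      A # \<Gamma> \<turnstile> c \<doteq> c' \<Ztypecolon> inst 1 (InL (Var 0)) C; B # \<Gamma> \<turnstile> d \<doteq> d' \<Ztypecolon> inst 1 (InR (Var 0)) C;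
      \<Gamma> \<turnstile> e \<doteq> e' \<Ztypecolon> Coprod A B\<rbrakk>
    \<Longrightarrow> \<Gamma> \<turnstile> IndCoprod C c d e \<doteq> IndCoprod C' c' d' e' \<Ztypecolon> inst 0 e C"
| coprod_beta_l: "\<lbrakk>\<Gamma> \<turnstile> A \<Ztypecolon> Univ i; \<Gamma> \<turnstile> B \<Ztypecolon> Univ i; Coprod A B # \<Gamma> \<turnstile> C \<Ztypecolon> Univ j;
      A # \<Gamma> \<turnstile> c \<Ztypecolon> inst 1 (InL (Var 0)) C; B # \<Gamma> \<turnstile> d \<Ztypecolon> inst 1 (InR (Var 0)) C; \<Gamma> \<turnstile> a \<Ztypecolon> A\<rbrakk>
    \<Longrightarrow> \<Gamma> \<turnstile> IndCoprod C c d (InL a) \<doteq> inst 0 a c \<Ztypecolon> inst 0 (InL a) C"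
| coprod_beta_r: "\<lbrakk>\<Gamma> \<turnstile> A \<Ztypecolon> Univ i; \<Gamma> \<turnstile> B \<Ztypecolon> Univ i; Coprod A B # \<Gamma> \<turnstile> C \<Ztypecolon> Univ j;
      A # \<Gamma> \<turnstile> c \<Ztypecolon> inst 1 (InL (Var 0)) C; B # \<Gamma> \<turnstile> d \<Ztypecolon> inst 1 (InR (Var 0)) C; \<Gamma> \<turnstile> b \<Ztypecolon> B\<rbrakk>
    \<Longrightarrow> \<Gamma> \<turnstile> IndCoprod C c d (InR b) \<doteq> inst 0 b d \<Ztypecolon> inst 0 (InR b) C"

| ty_empty: "\<turnstile> \<Gamma> ctx \<Longrightarrow> \<Gamma> \<turnstile> EmptyT \<Ztypecolon> Univ i"
| ty_ind_empty: "\<lbrakk>EmptyT # \<Gamma> \<turnstile> C \<Ztypecolon> Univ j; \<Gamma> \<turnstile> e \<Ztypecolon> EmptyT\<rbrakk> \<Longrightarrow> \<Gamma> \<turnstile> IndEmpty C e \<Ztypecolon> inst 0 e C"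
| eq_ind_empty: "\<lbrakk>EmptyT # \<Gamma> \<turnstile> C \<doteq> C' \<Ztypecolon> Univ j; \<Gamma> \<turnstile> e \<doteq> e' \<Ztypecolon> EmptyT\<rbrakk>
    \<Longrightarrow> \<Gamma> \<turnstile> IndEmpty C e \<doteq> IndEmpty C' e' \<Ztypecolon> inst 0 e C"

| ty_unit: "\<turnstile> \<Gamma> ctx \<Longrightarrow> \<Gamma> \<turnstile> UnitT \<Ztypecolon> Univ i"
| ty_star: "\<turnstile> \<Gamma> ctx \<Longrightarrow> \<Gamma> \<turnstile> Star \<Ztypecolon> UnitT"
| ty_ind_unit: "\<lbrakk>UnitT # \<Gamma> \<turnstile> C \<Ztypecolon> Univ j; \<Gamma> \<turnstile> c \<Ztypecolon> inst 0 Star C; \<Gamma> \<turnstile> e \<Ztypecolon> UnitT\<rbrakk>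
    \<Longrightarrow> \<Gamma> \<turnstile> IndUnit C c e \<Ztypecolon> inst 0 e C"
| eq_ind_unit: "\<lbrakk>UnitT # \<Gamma> \<turnstile> C \<doteq> C' \<Ztypecolon> Univ j; \<Gamma> \<turnstile> c \<doteq> c' \<Ztypecolon> inst 0 Star C;
      \<Gamma> \<turnstile> e \<doteq> e' \<Ztypecolon> UnitT\<rbrakk>
    \<Longrightarrow> \<Gamma> \<turnstile> IndUnit C c e \<doteq> IndUnit C' c' e' \<Ztypecolon> inst 0 e C"
| unit_beta: "\<lbrakk>UnitT # \<Gamma> \<turnstile> C \<Ztypecolon> Univ j; \<Gamma> \<turnstile> c \<Ztypecolon> inst 0 Star C\<rbrakk>
    \<Longrightarrow> \<Gamma> \<turnstile> IndUnit C c Star \<doteq> c \<Ztypecolon> inst 0 Star C"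

| ty_nat: "\<turnstile> \<Gamma> ctx \<Longrightarrow> \<Gamma> \<turnstile> NatT \<Ztypecolon> Univ i"
| ty_zero: "\<turnstile> \<Gamma> ctx \<Longrightarrow> \<Gamma> \<turnstile> Zero \<Ztypecolon> NatT"
| ty_succ: "\<Gamma> \<turnstile> n \<Ztypecolon> NatT \<Longrightarrow> \<Gamma> \<turnstile> Succ n \<Ztypecolon> NatT"
| ty_ind_nat: "\<lbrakk>NatT # \<Gamma> \<turnstile> C \<Ztypecolon> Univ j; \<Gamma> \<turnstile> z \<Ztypecolon> inst 0 Zero C;
      C # NatT # \<Gamma> \<turnstile> s \<Ztypecolon> inst 2 (Succ (Var 1)) C; \<Gamma> \<turnstile> n \<Ztypecolon> NatT\<rbrakk>
    \<Longrightarrow> \<Gamma> \<turnstile> IndNat C z s n \<Ztypecolon> inst 0 n C"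
| eq_succ: "\<Gamma> \<turnstile> n \<doteq> n' \<Ztypecolon> NatT \<Longrightarrow> \<Gamma> \<turnstile> Succ n \<doteq> Succ n' \<Ztypecolon> NatT"
| eq_ind_nat: "\<lbrakk>NatT # \<Gamma> \<turnstile> C \<Ztypecolon> Univ j; NatT # \<Gamma> \<turnstile> C \<doteq> C' \<Ztypecolon> Univ j; \<Gamma> \<turnstile> z \<doteq> z' \<Ztypecolon> inst 0 Zero C;
      C # NatT # \<Gamma> \<turnstile> s \<doteq> s' \<Ztypecolon> inst 2 (Succ (Var 1)) C; \<Gamma> \<turnstile> n \<doteq> n' \<Ztypecolon> NatT\<rbrakk>
    \<Longrightarrow> \<Gamma> \<turnstile> IndNat C z s n \<doteq> IndNat C' z' s' n' \<Ztypecolon> inst 0 n C"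
| nat_beta_zero: "\<lbrakk>NatT # \<Gamma> \<turnstile> C \<Ztypecolon> Univ j; \<Gamma> \<turnstile> z \<Ztypecolon> inst 0 Zero C;
      C # NatT # \<Gamma> \<turnstile> s \<Ztypecolon> inst 2 (Succ (Var 1)) C\<rbrakk>
    \<Longrightarrow> \<Gamma> \<turnstile> IndNat C z s Zero \<doteq> z \<Ztypecolon> inst 0 Zero C"
| nat_beta_succ: "\<lbrakk>NatT # \<Gamma> \<turnstile> C \<Ztypecolon> Univ j; \<Gamma> \<turnstile> z \<Ztypecolon> inst 0 Zero C;
      C # NatT # \<Gamma> \<turnstile> s \<Ztypecolon> inst 2 (Succ (Var 1)) C; \<Gamma> \<turnstile> n \<Ztypecolon> NatT\<rbrakk>
    \<Longrightarrow> \<Gamma> \<turnstile> IndNat C z s (Succ n) \<doteq> inst2 n (IndNat C z s n) s \<Ztypecolon> inst 0 (Succ n) C"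

| ty_eq: "\<lbrakk>\<Gamma> \<turnstile> A \<Ztypecolon> Univ i; \<Gamma> \<turnstile> a \<Ztypecolon> A; \<Gamma> \<turnstile> b \<Ztypecolon> A\<rbrakk> \<Longrightarrow> \<Gamma> \<turnstile> Eq A a b \<Ztypecolon> Univ i"
| ty_refl: "\<lbrakk>\<Gamma> \<turnstile> A \<Ztypecolon> Univ i; \<Gamma> \<turnstile> a \<Ztypecolon> A\<rbrakk> \<Longrightarrow> \<Gamma> \<turnstile> Refl a \<Ztypecolon> Eq A a a"
| ty_ind_eq: "\<lbrakk>\<Gamma> \<turnstile> A \<Ztypecolon> Univ i; \<Gamma> \<turnstile> a \<Ztypecolon> A;
      Eq (A \<up> 1) (a \<up> 1) (Var 0) # A # \<Gamma> \<turnstile> C \<Ztypecolon> Univ j;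
      \<Gamma> \<turnstile> c \<Ztypecolon> inst2 a (Refl a) C; \<Gamma> \<turnstile> b \<Ztypecolon> A; \<Gamma> \<turnstile> p \<Ztypecolon> Eq A a b\<rbrakk>
    \<Longrightarrow> \<Gamma> \<turnstile> IndEq C c p \<Ztypecolon> inst2 b p C"
| eq_eq: "\<lbrakk>\<Gamma> \<turnstile> A \<doteq> A' \<Ztypecolon> Univ i; \<Gamma> \<turnstile> a \<doteq> a' \<Ztypecolon> A; \<Gamma> \<turnstile> b \<doteq> b' \<Ztypecolon> A\<rbrakk>
    \<Longrightarrow> \<Gamma> \<turnstile> Eq A a b \<doteq> Eq A' a' b' \<Ztypecolon> Univ i"
| eq_refl_tm: "\<lbrakk>\<Gamma> \<turnstile> A \<Ztypecolon> Univ i; \<Gamma> \<turnstile> a \<doteq> a' \<Ztypecolon> A\<rbrakk> \<Longrightarrow> \<Gamma> \<turnstile> Refl a \<doteq> Refl a' \<Ztypecolon> Eq A a a"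
| eq_ind_eq: "\<lbrakk>\<Gamma> \<turnstile> A \<Ztypecolon> Univ i; \<Gamma> \<turnstile> a \<Ztypecolon> A;
      Eq (A \<up> 1) (a \<up> 1) (Var 0) # A # \<Gamma> \<turnstile> C \<doteq> C' \<Ztypecolon> Univ j;
      \<Gamma> \<turnstile> c \<doteq> c' \<Ztypecolon> inst2 a (Refl a) C; \<Gamma> \<turnstile> b \<Ztypecolon> A; \<Gamma> \<turnstile> p \<doteq> p' \<Ztypecolon> Eq A a b\<rbrakk>
    \<Longrightarrow> \<Gamma> \<turnstile> IndEq C c p \<doteq> IndEq C' c' p' \<Ztypecolon> inst2 b p C"
| eq_beta: "\<lbrakk>\<Gamma> \<turnstile> A \<Ztypecolon> Univ i; \<Gamma> \<turnstile> a \<Ztypecolon> A;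
      Eq (A \<up> 1) (a \<up> 1) (Var 0) # A # \<Gamma> \<turnstile> C \<Ztypecolon> Univ j; \<Gamma> \<turnstile> c \<Ztypecolon> inst2 a (Refl a) C\<rbrakk>
    \<Longrightarrow> \<Gamma> \<turnstile> IndEq C c (Refl a) \<doteq> c \<Ztypecolon> inst2 a (Refl a) C"

| ty_funext: "\<lbrakk>\<Gamma> \<turnstile> A \<Ztypecolon> Univ i; A # \<Gamma> \<turnstile> B \<Ztypecolon> Univ i; \<Gamma> \<turnstile> f \<Ztypecolon> Pi A B; \<Gamma> \<turnstile> g \<Ztypecolon> Pi A B\<rbrakk>
    \<Longrightarrow> \<Gamma> \<turnstile> FunExt A B f g \<Ztypecolon>
          is_equiv (Eq (Pi A B) f g) (Pi A (Eq B (f \<up> 1 \<cdot> Var 0) (g \<up> 1 \<cdot> Var 0))) (happly A B f g)"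
| eq_funext: "\<lbrakk>\<Gamma> \<turnstile> A \<Ztypecolon> Univ i; A # \<Gamma> \<turnstile> B \<Ztypecolon> Univ i; \<Gamma> \<turnstile> A \<doteq> A' \<Ztypecolon> Univ i; A # \<Gamma> \<turnstile> B \<doteq> B' \<Ztypecolon> Univ i;
      \<Gamma> \<turnstile> f \<doteq> f' \<Ztypecolon> Pi A B; \<Gamma> \<turnstile> g \<doteq> g' \<Ztypecolon> Pi A B\<rbrakk>
    \<Longrightarrow> \<Gamma> \<turnstile> FunExt A B f g \<doteq> FunExt A' B' f' g' \<Ztypecolon>
          is_equiv (Eq (Pi A B) f g) (Pi A (Eq B (f \<up> 1 \<cdot> Var 0) (g \<up> 1 \<cdot> Var 0))) (happly A B f g)"

| ty_ua: "\<lbrakk>\<Gamma> \<turnstile> A \<Ztypecolon> Univ i; \<Gamma> \<turnstile> B \<Ztypecolon> Univ i\<rbrakk>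
    \<Longrightarrow> \<Gamma> \<turnstile> UA i A B \<Ztypecolon> is_equiv (Eq (Univ i) A B) (A \<simeq>\<^sub>t B) (id_to_equiv i A B)"
| eq_ua: "\<lbrakk>\<Gamma> \<turnstile> A \<doteq> A' \<Ztypecolon> Univ i; \<Gamma> \<turnstile> B \<doteq> B' \<Ztypecolon> Univ i\<rbrakk>
    \<Longrightarrow> \<Gamma> \<turnstile> UA i A B \<doteq> UA i A' B' \<Ztypecolon> is_equiv (Eq (Univ i) A B) (A \<simeq>\<^sub>t B) (id_to_equiv i A B)"


section \<open>Modalities and reflective subuniverses\<close>

text \<open>All notions below are types of the object theory, relative to the universe \<open>Univ i\<close>.\<close>

text \<open>For \<open>e : A \<rightarrow> B\<close> and a type \<open>F\<close> of functions on \<open>B\<close>, the map \<open>F \<ni> f \<mapsto> f \<circ> e\<close>.\<close>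

definition precomp :: "tm \<Rightarrow> tm \<Rightarrow> tm \<Rightarrow> tm" where
  "precomp F A e = Lam F (Lam (A \<up> 1) (Var 1 \<cdot> (e \<up> 2 \<cdot> Var 0)))"

definition unit_type :: "nat \<Rightarrow> tm \<Rightarrow> tm" where
  "unit_type i Om = Pi (Univ i) (Var 0 \<rightarrow>\<^sub>t Om \<up> 1 \<cdot> Var 0)"

text \<open>\<open>\<Prod>A:U. \<Prod>P:Om A \<rightarrow> U. is_equiv (\<lambda>f:(\<Prod>x:Om A. Om (P x)). f \<circ> eta A)\<close>,
  with codomain \<open>G = (\<Prod>a:A. Om (P (eta A a)))\<close>.\<close>

definition unique_elim :: "nat \<Rightarrow> tm \<Rightarrow> tm \<Rightarrow> tm" where
  "unique_elim i Om eta =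
     Pi (Univ i) (Pi (Om \<up> 1 \<cdot> Var 0 \<rightarrow>\<^sub>t Univ i)
       (let F = Pi (Om \<up> 2 \<cdot> Var 1) (Om \<up> 3 \<cdot> (Var 1 \<cdot> Var 0));
            G = Pi (Var 1) (Om \<up> 3 \<cdot> (Var 1 \<cdot> (eta \<up> 3 \<cdot> Var 2 \<cdot> Var 0)))
        in is_equiv F G (precomp F (Var 1) (eta \<up> 2 \<cdot> Var 1))))"

definition modal :: "tm \<Rightarrow> tm \<Rightarrow> tm \<Rightarrow> tm" where
  "modal Om eta X = is_equiv X (Om \<cdot> X) (eta \<cdot> X)"

definition is_prop :: "tm \<Rightarrow> tm" where
  "is_prop A = Pi A (Pi (A \<up> 1) (Eq (A \<up> 2) (Var 1) (Var 0)))"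

definition hprop :: "nat \<Rightarrow> tm" where
  "hprop i = Sig (Univ i) (is_prop (Var 0))"

text \<open>For \<open>Q : Univ i \<rightarrow> hprop i\<close>, the first component of \<open>Q X\<close>.\<close>

definition local_type :: "nat \<Rightarrow> tm \<Rightarrow> tm \<Rightarrow> tm" where
  "local_type i Q X = IndSig (Univ i) (Var 1) (Q \<cdot> X)"

text \<open>\<open>\<Prod>X:U. \<Sum>LX:U. local LX \<times> (\<Sum>e:X \<rightarrow> LX. \<Prod>Z:U. local Z \<rightarrow> is_equiv (\<lambda>f:LX \<rightarrow> Z. f \<circ> e))\<close>\<close>

definition reflections :: "nat \<Rightarrow> tm \<Rightarrow> tm" where
  "reflections i Q =
     Pi (Univ i) (Sig (Univ i) (local_type i (Q \<up> 2) (Var 0) \<times>\<^sub>t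
       Sig (Var 1 \<rightarrow>\<^sub>t Var 0)
         (Pi (Univ i) (local_type i (Q \<up> 4) (Var 0) \<rightarrow>\<^sub>t
           is_equiv (Var 2 \<rightarrow>\<^sub>t Var 0) (Var 3 \<rightarrow>\<^sub>t Var 0)
             (precomp (Var 2 \<rightarrow>\<^sub>t Var 0) (Var 3) (Var 1))))))"

text \<open>\<open>\<Prod>X:U. local X \<rightarrow> (\<Prod>P:X \<rightarrow> U. (\<Prod>x:X. local (P x)) \<rightarrow> local (\<Sum>x:X. P x))\<close>\<close>

definition sigma_closed :: "nat \<Rightarrow> tm \<Rightarrow> tm" where
  "sigma_closed i Q =
     Pi (Univ i) (local_type i (Q \<up> 1) (Var 0) \<rightarrow>\<^sub>t
       Pi (Var 0 \<rightarrow>\<^sub>t Univ i)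
         (Pi (Var 1) (local_type i (Q \<up> 3) (Var 1 \<cdot> Var 0)) \<rightarrow>\<^sub>t
          local_type i (Q \<up> 2) (Sig (Var 1) (Var 1 \<cdot> Var 0))))"

definition same_modal_types :: "nat \<Rightarrow> tm \<Rightarrow> tm \<Rightarrow> tm \<Rightarrow> tm" where
  "same_modal_types i Om eta Q =
     Pi (Univ i) (modal (Om \<up> 1) (eta \<up> 1) (Var 0) \<simeq>\<^sub>t local_type i (Q \<up> 1) (Var 0))"

end

theory Submission
  imports Defs
begin

text \<open>
  The object theory is handled from outside. No closed proof term is written down; instead
  \<open>inhab \<Gamma> T\<close> is derived for each type \<open>T\<close> in question, over an arbitrary context \<open>\<Gamma>\<close>. Two facts
  make this workable. All judgements are stable under substitution, so a lemma about an arbitrary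
  context can be used under any binder. And inhabitedness of an identity type, written
  \<open>peq \<Gamma> A a b\<close>, is an equivalence relation that contains conversion and is respected by every
  type (\<open>transport\<close>), so that equational reasoning inside the theory becomes equational reasoning
  about \<open>peq\<close>.

  The predicate of the subuniverse sends \<open>X\<close> to the type stating that the unit of \<open>X\<close> is an
  equivalence. This is a proposition (\<open>is_prop_is_equiv\<close>): by univalence it is enough to treat an
  identity function, and there the type of right inverses and the type of left inverses are both
  the type of functions equipped with a homotopy to the identity, which is contractible by
  function extensionality.

  Unique elimination says that a section over \<open>Om A\<close> of a family of types \<open>Om (B z)\<close> can be
  prescribed on units (\<open>unique_elim_ex\<close>) and is determined by its values there
  (\<open>unique_elim_unique\<close>). If the unit of \<open>Y\<close> has a retraction \<open>r\<close>, then \<open>eta \<circ> r\<close> and the identity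
  of \<open>Om Y\<close> agree on units, so they are equal and \<open>Y\<close> is modal (\<open>modal_of_retraction\<close>). The identity
  of \<open>Om X\<close> extends along its own unit to such a retraction, so \<open>Om X\<close> is modal (\<open>modal_Om\<close>).
  Composing with inverses of units, one can prescribe on units the sections of an arbitrary family
  of modal types, and they are determined by these values (\<open>modal_elim\<close>, \<open>modal_unique\<close>); for
  constant families this is the universal property of the reflection (\<open>precomp_unit_is_equiv\<close>).
  Finally let \<open>S\<close> be the sum of a modal family over a modal type. The first projection extends to
  \<open>f : Om S \<rightarrow> X\<close>; the second projection, transported along \<open>f (eta s) = fst s\<close>, extends to a section
  \<open>g\<close> of the family \<open>B (f z)\<close>; and \<open>z \<mapsto> (f z, g z)\<close> is a retraction of the unit of \<open>S\<close>
  (\<open>sigma_modal\<close>).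
\<close>

section \<open>Substitution calculus\<close>

lemma nat_fun_eqI: "f 0 = g 0 \<Longrightarrow> (\<And>n. f (Suc n) = g (Suc n)) \<Longrightarrow> f = g"
  by (rule ext) (metis not0_implies_Suc)

lemma up_Var_comp: "up (\<lambda>n. Var (r n)) = (\<lambda>n. Var (up_ren r n))"
  by (rule nat_fun_eqI) (auto simp: up_def up_ren_def shift_def)

text \<open>
  Everything is reduced to \<open>subst\<close>: with renamings gone, the rewrite rules \<open>subst_nf\<close>
  bring composed, lifted and extended substitutions into a normal form, which proves the equations
  between instantiated types that arise later.
\<close>

lemma ren_as_subst: "ren r t = subst (\<lambda>n. Var (r n)) t"
  by (induction t arbitrary: r) (simp_all add: up_Var_comp)

lemma up_Var: "up Var = Var"
  by (rule nat_fun_eqI) (auto simp: up_def shift_def)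

lemma subst_Var: "subst Var t = t"
  by (induction t) (simp_all add: up_Var)

lemma up_comp_ren: "up (\<lambda>n. s (r n)) = (\<lambda>n. up s (up_ren r n))"
  by (rule nat_fun_eqI) (auto simp: up_def up_ren_def)

lemma subst_ren: "subst s (ren r t) = subst (\<lambda>n. s (r n)) t"
  by (induction t arbitrary: s r) (simp_all add: up_comp_ren)

lemma ren_up_comp: "up (\<lambda>n. ren r (s n)) = (\<lambda>n. ren (up_ren r) (up s n))"
  by (rule nat_fun_eqI)
    (auto simp: up_def up_ren_def shift_def ren_as_subst subst_ren[unfolded ren_as_subst])

lemma ren_subst: "ren r (subst s t) = subst (\<lambda>n. ren r (s n)) t"
  by (induction t arbitrary: s r) (simp_all add: ren_up_comp)

lemma up_comp: "up (\<lambda>n. subst s (u n)) = (\<lambda>n. subst (up s) (up u n))"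
  by (rule nat_fun_eqI) (auto simp: up_def shift_def subst_ren ren_subst)

lemma subst_subst: "subst s (subst u t) = subst (\<lambda>n. subst s (u n)) t"
  by (induction t arbitrary: s u) (simp_all add: up_comp)

lemma scons_comp: "(\<lambda>n. subst s ((a .: u) n)) = subst s a .: (\<lambda>n. subst s (u n))"
  by (rule nat_fun_eqI) auto

lemma up_unfold: "up s = Var 0 .: (\<lambda>n. subst (\<lambda>m. Var (Suc m)) (s n))"
  by (simp add: up_def shift_def ren_as_subst)

lemma scons_eta: "s 0 .: (\<lambda>n. s (Suc n)) = s"
  by (rule nat_fun_eqI) auto

lemmas scons_Var =
  scons_eta[of Var] scons_eta[of "\<lambda>n. Var (Suc n)"] scons_eta[of "\<lambda>n. Var (Suc (Suc n))"]
  scons_eta[of "\<lambda>n. Var (Suc (Suc (Suc n)))"] scons_eta[of "\<lambda>n. Var (Suc (Suc (Suc (Suc n))))"]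

lemmas subst_nf = subst_Var subst_subst scons_comp up_unfold scons_Var inst_def inst2_def shift_def
  ren_as_subst numeral_eq_Suc fun_type_def prod_type_def idfun_def

text \<open>
  Stability of the typing rules needs the notions in their premises and conclusions to commute with
  substitution. An instance formed over an extended context meets a substitution lifted as often as
  that context is extended.
\<close>

lemma subst_inst: "subst s (inst 0 a B) = inst 0 (subst s a) (subst (up s) B)"
  "subst (up s) (inst 1 a B) = inst 1 (subst (up s) a) (subst (up s) B)"
  "subst (up (up s)) (inst 2 a B) = inst 2 (subst (up (up s)) a) (subst (up s) B)"
  "subst s (inst2 a b C) = inst2 (subst s a) (subst s b) (subst (up (up s)) C)"
  by (simp_all add: subst_nf)

lemma subst_shift: "subst (up s) (t \<up> 1) = subst s t \<up> 1"
  by (simp add: subst_nf)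

lemma subst_notions:
  "subst s (A \<rightarrow>\<^sub>t B) = subst s A \<rightarrow>\<^sub>t subst s B"
  "subst s (A \<times>\<^sub>t B) = subst s A \<times>\<^sub>t subst s B"
  "subst s (idfun A) = idfun (subst s A)"
  "subst s (is_equiv A B f) = is_equiv (subst s A) (subst s B) (subst s f)"
  "subst s (A \<simeq>\<^sub>t B) = subst s A \<simeq>\<^sub>t subst s B"
  "subst s (id_equiv A) = id_equiv (subst s A)"
  "subst s (happly A C f g) = happly (subst s A) (subst (up s) C) (subst s f) (subst s g)"
  "subst s (id_to_equiv i A B) = id_to_equiv i (subst s A) (subst s B)"
  by (simp_all add: subst_nf is_equiv_def equiv_type_def id_equiv_def happly_def id_to_equiv_def)

lemma subst_precomp: "subst s (precomp F A e) = precomp (subst s F) (subst s A) (subst s e)"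
  by (simp add: subst_nf precomp_def)

lemma up_Var0: "up s 0 = Var 0" "up s (Suc n) = s n \<up> 1" "(up (up s)) 1 = Var 1"
  by (simp_all add: up_def shift_def)

section \<open>Stability of judgements\<close>

lemma ctx_of:
  shows "\<turnstile> \<Gamma> ctx \<Longrightarrow> \<turnstile> tl \<Gamma> ctx"
    and "\<Gamma> \<turnstile> t \<Ztypecolon> A \<Longrightarrow> \<turnstile> \<Gamma> ctx"
    and "\<Gamma> \<turnstile> t \<doteq> u \<Ztypecolon> A \<Longrightarrow> \<turnstile> \<Gamma> ctx"
proof -
  have tl: "\<turnstile> A # \<Gamma> ctx \<Longrightarrow> \<turnstile> \<Gamma> ctx" for A \<Gamma>
    by (auto elim: wf_ctx.cases)
  show "\<turnstile> \<Gamma> ctx \<Longrightarrow> \<turnstile> tl \<Gamma> ctx" "\<Gamma> \<turnstile> t \<Ztypecolon> A \<Longrightarrow> \<turnstile> \<Gamma> ctx" "\<Gamma> \<turnstile> t \<doteq> u \<Ztypecolon> A \<Longrightarrow> \<turnstile> \<Gamma> ctx"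
    by (induction rule: wf_ctx_typing_conv.inducts) (auto dest: tl intro: ctx_nil ctx_cons)
qed

text \<open>
  Weakening has to be known before a substitution can be pushed under a binder, yet both are
  proved by the same induction over all rules. The induction is therefore done once for an
  abstract class \<open>R\<close> of maps of contexts closed under lifting, and instantiated first with
  renamings and then with substitutions.
\<close>

locale stability =
  fixes R :: "tm list \<Rightarrow> (nat \<Rightarrow> tm) \<Rightarrow> tm list \<Rightarrow> bool"
  assumes R_var: "R \<Delta> s \<Gamma> \<Longrightarrow> n < length \<Gamma> \<Longrightarrow> \<Delta> \<turnstile> s n \<Ztypecolon> subst s ((\<Gamma> ! n) \<up> Suc n)"
    and R_ctx: "R \<Delta> s \<Gamma> \<Longrightarrow> \<turnstile> \<Delta> ctx"
    and R_up: "R \<Delta> s \<Gamma> \<Longrightarrow> \<Delta> \<turnstile> subst s A \<Ztypecolon> Univ i \<Longrightarrow> R (subst s A # \<Delta>) (up s) (A # \<Gamma>)"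
begin

text \<open>
  The eliminator for identity types extends the context by a type for which the rule has no typing
  premise. That the image of this type is well-formed is recovered from the context itself, and
  so the induction hypothesis for a judgement also speaks of the context of the judgement.
\<close>

primrec stable_ctx :: "tm list \<Rightarrow> bool" where
  "stable_ctx [] = True"
| "stable_ctx (A # \<Gamma>) = (stable_ctx \<Gamma> \<and> (\<forall>\<Delta> s. R \<Delta> s \<Gamma> \<longrightarrow> (\<exists>i. \<Delta> \<turnstile> subst s A \<Ztypecolon> Univ i)))"

definition stable_ty :: "tm list \<Rightarrow> tm \<Rightarrow> tm \<Rightarrow> bool" where
  "stable_ty \<Gamma> t A = (stable_ctx \<Gamma> \<and> (\<forall>\<Delta> s. R \<Delta> s \<Gamma> \<longrightarrow> \<Delta> \<turnstile> subst s t \<Ztypecolon> subst s A))"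

definition stable_conv :: "tm list \<Rightarrow> tm \<Rightarrow> tm \<Rightarrow> tm \<Rightarrow> bool" where
  "stable_conv \<Gamma> t u A = (stable_ctx \<Gamma> \<and> (\<forall>\<Delta> s. R \<Delta> s \<Gamma> \<longrightarrow> \<Delta> \<turnstile> subst s t \<doteq> subst s u \<Ztypecolon> subst s A))"

lemma R_up': "stable_ctx (A # \<Gamma>) \<Longrightarrow> R \<Delta> s \<Gamma> \<Longrightarrow> R (subst s A # \<Delta>) (up s) (A # \<Gamma>)"
  by (auto intro: R_up)

lemma stable_ty0: "stable_ty \<Gamma> t A \<Longrightarrow> R \<Delta> s \<Gamma> \<Longrightarrow> \<Delta> \<turnstile> subst s t \<Ztypecolon> subst s A"
  and stable_ty1: "stable_ty (X # \<Gamma>) t A \<Longrightarrow> R \<Delta> s \<Gamma> \<Longrightarrow>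
    subst s X # \<Delta> \<turnstile> subst (up s) t \<Ztypecolon> subst (up s) A"
  and stable_ty2: "stable_ty (Y # X # \<Gamma>) t A \<Longrightarrow> R \<Delta> s \<Gamma> \<Longrightarrow>
    subst (up s) Y # subst s X # \<Delta> \<turnstile> subst (up (up s)) t \<Ztypecolon> subst (up (up s)) A"
  and stable_conv0: "stable_conv \<Gamma> t u A \<Longrightarrow> R \<Delta> s \<Gamma> \<Longrightarrow> \<Delta> \<turnstile> subst s t \<doteq> subst s u \<Ztypecolon> subst s A"
  and stable_conv1: "stable_conv (X # \<Gamma>) t u A \<Longrightarrow> R \<Delta> s \<Gamma> \<Longrightarrow>
    subst s X # \<Delta> \<turnstile> subst (up s) t \<doteq> subst (up s) u \<Ztypecolon> subst (up s) A"
  and stable_conv2: "stable_conv (Y # X # \<Gamma>) t u A \<Longrightarrow> R \<Delta> s \<Gamma> \<Longrightarrow>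
    subst (up s) Y # subst s X # \<Delta> \<turnstile> subst (up (up s)) t \<doteq> subst (up (up s)) u \<Ztypecolon> subst (up (up s)) A"
  unfolding stable_ty_def stable_conv_def by (metis R_up' stable_ctx.simps(2))+

lemma stable_ctxD: "stable_ty \<Gamma> t A \<Longrightarrow> stable_ctx \<Gamma>" "stable_conv \<Gamma> t u A \<Longrightarrow> stable_ctx \<Gamma>"
  "stable_ctx (X # \<Gamma>) \<Longrightarrow> stable_ctx \<Gamma>"
  by (auto simp: stable_ty_def stable_conv_def)

lemma stableI:
  "stable_ctx \<Gamma> \<Longrightarrow> (\<And>\<Delta> s. R \<Delta> s \<Gamma> \<Longrightarrow> \<Delta> \<turnstile> subst s t \<Ztypecolon> subst s A) \<Longrightarrow> stable_ty \<Gamma> t A"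
  "stable_ctx \<Gamma> \<Longrightarrow> (\<And>\<Delta> s. R \<Delta> s \<Gamma> \<Longrightarrow> \<Delta> \<turnstile> subst s t \<doteq> subst s u \<Ztypecolon> subst s A) \<Longrightarrow> stable_conv \<Gamma> t u A"
  by (auto simp: stable_ty_def stable_conv_def)

lemmas stable_dests = stable_ty0 stable_ty1 stable_ty2 stable_conv0 stable_conv1 stable_conv2
lemmas stable_simps = subst.simps subst_inst subst_notions subst_shift up_Var0

text \<open>
  Every rule but those for contexts and variables is closed under the maps by the same argument:
  apply the maps to the premises, lifted as often as variables are bound, commute the
  substitutions with the notions in the conclusion, and apply the rule again.
\<close>

lemma stable:
  shows "\<turnstile> \<Gamma> ctx \<Longrightarrow> stable_ctx \<Gamma>"
    and "\<Gamma> \<turnstile> t \<Ztypecolon> A \<Longrightarrow> stable_ty \<Gamma> t A"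
    and "\<Gamma> \<turnstile> t \<doteq> u \<Ztypecolon> A \<Longrightarrow> stable_conv \<Gamma> t u A"
proof (induction rule: wf_ctx_typing_conv.inducts)
  case ctx_nil
  then show ?case
    by (fastforce dest: stable_ty0)
next
  case ctx_cons
  then show ?case
    by (fastforce dest: stable_ty0)
next
  case ty_var
  then show ?case
    by (auto intro!: stableI R_var)
qed (rule stableI, blast dest: stable_ctxD, frule R_ctx, ((drule (1) stable_dests)+)?, (simp only: stable_simps)?,
    (rule wf_ctx_typing_conv.intros; assumption))+

end

definition wf_subst :: "tm list \<Rightarrow> (nat \<Rightarrow> tm) \<Rightarrow> tm list \<Rightarrow> bool" where
  "wf_subst \<Delta> s \<Gamma> \<longleftrightarrow> \<turnstile> \<Delta> ctx \<and> (\<forall>n < length \<Gamma>. \<Delta> \<turnstile> s n \<Ztypecolon> subst s ((\<Gamma> ! n) \<up> Suc n))"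

definition wf_ren :: "tm list \<Rightarrow> (nat \<Rightarrow> tm) \<Rightarrow> tm list \<Rightarrow> bool" where
  "wf_ren \<Delta> s \<Gamma> \<longleftrightarrow> wf_subst \<Delta> s \<Gamma> \<and> (\<exists>r. s = (\<lambda>n. Var (r n)) \<and> (\<forall>n < length \<Gamma>. r n < length \<Delta>
     \<and> subst s ((\<Gamma> ! n) \<up> Suc n) = (\<Delta> ! r n) \<up> Suc (r n)))"

text \<open>
  Well-typedness of the lifted renaming would call for weakening, were it not that renamings send
  declared variables to variables declared with the renamed type; this property survives lifting
  and yields well-typedness by the variable rule.
\<close>

lemma wf_ren_up:
  assumes "wf_ren \<Delta> s \<Gamma>" and A: "\<Delta> \<turnstile> subst s A \<Ztypecolon> Univ i"
  shows "wf_ren (subst s A # \<Delta>) (up s) (A # \<Gamma>)"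
proof -
  obtain r where s: "s = (\<lambda>n. Var (r n))" and d: "\<turnstile> \<Delta> ctx"
    and r: "\<And>n. n < length \<Gamma> \<Longrightarrow> r n < length \<Delta>"
      "\<And>n. n < length \<Gamma> \<Longrightarrow> subst s ((\<Gamma> ! n) \<up> Suc n) = (\<Delta> ! r n) \<up> Suc (r n)"
    using assms by (auto simp: wf_ren_def wf_subst_def)
  have d': "\<turnstile> subst s A # \<Delta> ctx" using d A by (rule ctx_cons)
  have *: "up_ren r n < length (subst s A # \<Delta>) \<and> subst (up s) (((A # \<Gamma>) ! n) \<up> Suc n)
      = ((subst s A # \<Delta>) ! up_ren r n) \<up> Suc (up_ren r n)" if "n < length (A # \<Gamma>)" for n
  proof (cases n)
    case 0
    then show ?thesis by (simp add: up_ren_def subst_nf)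
  next
    case (Suc m)
    have "subst (up s) ((\<Gamma> ! m) \<up> Suc (Suc m)) = (subst s ((\<Gamma> ! m) \<up> Suc m)) \<up> 1"
      by (simp add: subst_nf s)
    also have "\<dots> = (\<Delta> ! r m) \<up> Suc (Suc (r m))"
      using r(2)[of m] that Suc by (simp add: subst_nf)
    finally show ?thesis using r(1)[of m] that Suc by (simp add: up_ren_def)
  qed
  have u: "up s = (\<lambda>n. Var (up_ren r n))" by (simp add: s up_Var_comp)
  have "subst s A # \<Delta> \<turnstile> up s n \<Ztypecolon> subst (up s) (((A # \<Gamma>) ! n) \<up> Suc n)" if "n < length (A # \<Gamma>)" for n
    using *[OF that] ty_var[OF d', of "up_ren r n"] by (simp add: u)
  then show ?thesis using d' * u by (auto simp: wf_ren_def wf_subst_def simp del: length_Cons)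
qed

interpretation renaming: stability wf_ren
  by (unfold_locales; (rule wf_ren_up, assumption+)?; auto simp: wf_ren_def wf_subst_def)

lemma wf_ren_wk: "\<turnstile> A # \<Delta> ctx \<Longrightarrow> wf_ren (A # \<Delta>) (\<lambda>n. Var (Suc n)) \<Delta>"
  using ty_var[of "A # \<Delta>" "Suc n" for n] by (auto simp: wf_ren_def wf_subst_def subst_nf)

lemma wf_subst_up:
  assumes s: "wf_subst \<Delta> s \<Gamma>" and A: "\<Delta> \<turnstile> subst s A \<Ztypecolon> Univ i"
  shows "wf_subst (subst s A # \<Delta>) (up s) (A # \<Gamma>)"
proof -
  have d': "\<turnstile> subst s A # \<Delta> ctx" using s A by (auto simp: wf_subst_def intro: ctx_cons)
  have "subst s A # \<Delta> \<turnstile> up s n \<Ztypecolon> subst (up s) (((A # \<Gamma>) ! n) \<up> Suc n)" if "n < length (A # \<Gamma>)" for n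
  proof (cases n)
    case 0
    then show ?thesis using ty_var[OF d', of 0] by (simp add: subst_nf)
  next
    case (Suc m)
    then have "\<Delta> \<turnstile> s m \<Ztypecolon> subst s ((\<Gamma> ! m) \<up> Suc m)" using s that by (simp add: wf_subst_def)
    from renaming.stable_ty0[OF renaming.stable(2)[OF this] wf_ren_wk[OF d']]
    show ?thesis using Suc by (simp add: subst_nf)
  qed
  then show ?thesis using d' by (simp add: wf_subst_def del: length_Cons)
qed

interpretation substitution: stability wf_subst
  by (unfold_locales; (rule wf_subst_up, assumption+)?; auto simp: wf_subst_def)

lemmas typing_subst = substitution.stable_ty0[OF substitution.stable(2)]
lemmas conv_subst = substitution.stable_conv0[OF substitution.stable(3)]

lemma wf_subst_cons: "wf_subst \<Delta> s \<Gamma> \<Longrightarrow> \<Delta> \<turnstile> a \<Ztypecolon> subst s A \<Longrightarrow> wf_subst \<Delta> (a .: s) (A # \<Gamma>)"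
  by (auto simp: wf_subst_def subst_nf nth_Cons split: nat.split)

lemma wf_subst_comp_wk: "wf_subst \<Delta> s \<Gamma> \<Longrightarrow> \<turnstile> A # \<Delta> ctx \<Longrightarrow> wf_subst (A # \<Delta>) (\<lambda>n. s n \<up> 1) \<Gamma>"
  using typing_subst[OF _ wf_ren_wk[unfolded wf_ren_def, THEN conjunct1]]
  by (fastforce simp: wf_subst_def subst_nf)

lemma wf_subst_0: "\<turnstile> \<Gamma> ctx \<Longrightarrow> wf_subst \<Gamma> Var \<Gamma>"
  using ty_var[of \<Gamma>] by (simp add: wf_subst_def subst_nf)

lemma ctx_tl: "\<turnstile> A # \<Gamma> ctx \<Longrightarrow> \<turnstile> \<Gamma> ctx"
  using ctx_of(1) by fastforce

lemma wf_subst_k: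
  "\<turnstile> A # \<Gamma> ctx \<Longrightarrow> wf_subst (A # \<Gamma>) (\<lambda>n. Var (Suc n)) \<Gamma>"
  "\<turnstile> A # B # \<Gamma> ctx \<Longrightarrow> wf_subst (A # B # \<Gamma>) (\<lambda>n. Var (Suc (Suc n))) \<Gamma>"
  "\<turnstile> A # B # C # \<Gamma> ctx \<Longrightarrow> wf_subst (A # B # C # \<Gamma>) (\<lambda>n. Var (Suc (Suc (Suc n)))) \<Gamma>"
  "\<turnstile> A # B # C # D # \<Gamma> ctx \<Longrightarrow> wf_subst (A # B # C # D # \<Gamma>) (\<lambda>n. Var (Suc (Suc (Suc (Suc n))))) \<Gamma>"
proof -
  have *: "wf_subst (A # \<Delta>) (\<lambda>n. Var (Suc (r n))) \<Gamma>" if "wf_subst \<Delta> (\<lambda>n. Var (r n)) \<Gamma>" "\<turnstile> A # \<Delta> ctx" for A \<Delta> r \<Gamma>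
    using wf_subst_comp_wk[OF that] by (simp add: subst_nf)
  show "\<turnstile> A # \<Gamma> ctx \<Longrightarrow> wf_subst (A # \<Gamma>) (\<lambda>n. Var (Suc n)) \<Gamma>"
    "\<turnstile> A # B # \<Gamma> ctx \<Longrightarrow> wf_subst (A # B # \<Gamma>) (\<lambda>n. Var (Suc (Suc n))) \<Gamma>"
    "\<turnstile> A # B # C # \<Gamma> ctx \<Longrightarrow> wf_subst (A # B # C # \<Gamma>) (\<lambda>n. Var (Suc (Suc (Suc n)))) \<Gamma>"
    "\<turnstile> A # B # C # D # \<Gamma> ctx \<Longrightarrow> wf_subst (A # B # C # D # \<Gamma>) (\<lambda>n. Var (Suc (Suc (Suc (Suc n))))) \<Gamma>"
    by (intro *; (rule wf_subst_0)?; blast dest: ctx_tl)+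
qed

section \<open>Bundled judgements\<close>

text \<open>
  The judgements are bundled with the well-formedness of their types. Together with the inversion
  lemmas below this replaces the metatheorem that the type of a typable term is well-formed:
  from a bundled judgement all typing information about the parts of its type can be read off.
\<close>

definition isT :: "tm list \<Rightarrow> tm \<Rightarrow> bool" where
  "isT \<Gamma> A \<longleftrightarrow> (\<exists>i. \<Gamma> \<turnstile> A \<Ztypecolon> Univ i)"

definition has :: "tm list \<Rightarrow> tm \<Rightarrow> tm \<Rightarrow> bool" where
  "has \<Gamma> a A \<longleftrightarrow> isT \<Gamma> A \<and> \<Gamma> \<turnstile> a \<Ztypecolon> A"

definition ceq :: "tm list \<Rightarrow> tm \<Rightarrow> tm \<Rightarrow> tm \<Rightarrow> bool" where
  "ceq \<Gamma> a b A \<longleftrightarrow> has \<Gamma> a A \<and> has \<Gamma> b A \<and> \<Gamma> \<turnstile> a \<doteq> b \<Ztypecolon> A"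

definition inhab :: "tm list \<Rightarrow> tm \<Rightarrow> bool" where
  "inhab \<Gamma> A \<longleftrightarrow> (\<exists>a. has \<Gamma> a A)"

lemma isT_ctx: "isT \<Gamma> A \<Longrightarrow> \<turnstile> A # \<Gamma> ctx" "isT \<Gamma> A \<Longrightarrow> \<turnstile> \<Gamma> ctx"
  by (auto simp: isT_def intro: ctx_cons ctx_of)

lemma ctx_isT: "\<turnstile> A # \<Gamma> ctx \<Longrightarrow> isT \<Gamma> A"
  by (auto simp: isT_def elim: wf_ctx.cases)

lemma has_isT: "has \<Gamma> a A \<Longrightarrow> isT \<Gamma> A" by (simp add: has_def)
lemma has_ctx: "has \<Gamma> a A \<Longrightarrow> \<turnstile> \<Gamma> ctx" by (auto simp: has_def intro: isT_ctx)
lemma inhab_isT: "inhab \<Gamma> A \<Longrightarrow> isT \<Gamma> A" by (auto simp: inhab_def has_def)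
lemma inhabI: "has \<Gamma> a A \<Longrightarrow> inhab \<Gamma> A" by (auto simp: inhab_def)

lemma has_Univ: "has \<Gamma> A (Univ i) \<longleftrightarrow> \<Gamma> \<turnstile> A \<Ztypecolon> Univ i"
  by (auto simp: has_def isT_def intro: ty_univ ctx_of)

lemma isT_has: "has \<Gamma> A (Univ i) \<Longrightarrow> isT \<Gamma> A"
  by (auto simp: has_Univ isT_def)

lemma isT_level: "isT \<Gamma> A \<Longrightarrow> (\<And>i. has \<Gamma> A (Univ i) \<Longrightarrow> thesis) \<Longrightarrow> thesis"
  by (auto simp: has_Univ isT_def)

lemma cumul: "i \<le> j \<Longrightarrow> \<Gamma> \<turnstile> A \<Ztypecolon> Univ i \<Longrightarrow> \<Gamma> \<turnstile> A \<Ztypecolon> Univ j"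
  by (induction rule: dec_induct) (auto intro: ty_cumul)

lemma common_level:
  assumes "\<Gamma> \<turnstile> A \<Ztypecolon> Univ i" "\<Delta> \<turnstile> B \<Ztypecolon> Univ j"
  shows "\<exists>k. \<Gamma> \<turnstile> A \<Ztypecolon> Univ k \<and> \<Delta> \<turnstile> B \<Ztypecolon> Univ k"
  using cumul[OF _ assms(1), of "max i j"] cumul[OF _ assms(2), of "max i j"] by auto

lemma common_universe:
  assumes "isT \<Gamma> A" "isT \<Delta> B"
  obtains k where "\<Gamma> \<turnstile> A \<Ztypecolon> Univ k" "\<Delta> \<turnstile> B \<Ztypecolon> Univ k"
  using assms common_level by (auto simp: isT_def) metis

lemma isT_subst: "isT \<Gamma> A \<Longrightarrow> wf_subst \<Delta> s \<Gamma> \<Longrightarrow> A' = subst s A \<Longrightarrow> isT \<Delta> A'"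
  using typing_subst by (fastforce simp: isT_def)

lemma has_subst: "has \<Gamma> a A \<Longrightarrow> wf_subst \<Delta> s \<Gamma> \<Longrightarrow> a' = subst s a \<Longrightarrow> A' = subst s A \<Longrightarrow> has \<Delta> a' A'"
  using typing_subst isT_subst by (auto simp: has_def)

lemma inhab_subst: "inhab \<Gamma> A \<Longrightarrow> wf_subst \<Delta> s \<Gamma> \<Longrightarrow> A' = subst s A \<Longrightarrow> inhab \<Delta> A'"
  unfolding inhab_def using has_subst by blast

lemma ceq_subst: "ceq \<Gamma> a b A \<Longrightarrow> wf_subst \<Delta> s \<Gamma> \<Longrightarrow> a' = subst s a \<Longrightarrow> b' = subst s b \<Longrightarrow> A' = subst s A
    \<Longrightarrow> ceq \<Delta> a' b' A'"
  using conv_subst has_subst by (auto simp: ceq_def)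

lemma wf_subst_Cons: "wf_subst \<Delta> s \<Gamma> \<Longrightarrow> has \<Delta> a A' \<Longrightarrow> A' = subst s A \<Longrightarrow> wf_subst \<Delta> (a .: s) (A # \<Gamma>)"
  by (auto simp: has_def intro: wf_subst_cons)

lemma wf_subst_inst: "has \<Gamma> a A \<Longrightarrow> wf_subst \<Gamma> (a .: Var) (A # \<Gamma>)"
  by (auto intro!: wf_subst_Cons wf_subst_0 has_ctx simp: subst_nf)

lemma wf_subst_inst2: "has \<Gamma> a A \<Longrightarrow> has \<Gamma> b B' \<Longrightarrow> B' = subst (a .: Var) B \<Longrightarrow> wf_subst \<Gamma> (b .: a .: Var) (B # A # \<Gamma>)"
  by (auto intro!: wf_subst_Cons wf_subst_0 has_ctx simp: subst_nf)

text \<open>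
  Conversion and cumulativity change only the type of a term. So the premises of the
  formation rules can be recovered without injectivity of type formers.
\<close>

lemma inversion_aux:
  "\<Gamma> \<turnstile> t \<Ztypecolon> T \<Longrightarrow>
    (\<forall>A B. t = Pi A B \<longrightarrow> isT (A # \<Gamma>) B) \<and>
    (\<forall>A B. t = Sig A B \<longrightarrow> isT (A # \<Gamma>) B) \<and>
    (\<forall>A a b. t = Eq A a b \<longrightarrow> has \<Gamma> a A \<and> has \<Gamma> b A)"
  by (induction rule: wf_ctx_typing_conv.inducts(2)[where ?P1.0="\<lambda>_. True" and ?P3.0="\<lambda>_ _ _ _. True"])
    (auto simp: isT_def has_def)

lemma isT_PiD: "isT \<Gamma> (Pi A B) \<Longrightarrow> isT (A # \<Gamma>) B"
  and isT_SigD: "isT \<Gamma> (Sig A B) \<Longrightarrow> isT (A # \<Gamma>) B"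
  and isT_EqD: "isT \<Gamma> (Eq A a b) \<Longrightarrow> has \<Gamma> a A" "isT \<Gamma> (Eq A a b) \<Longrightarrow> has \<Gamma> b A"
  using inversion_aux by (auto simp: isT_def[of \<Gamma>])

lemma isT_ctx_head: "isT (A # \<Gamma>) B \<Longrightarrow> isT \<Gamma> A"
  using ctx_isT isT_ctx(2) by blast

text \<open>
  Weakening and function types are written in the normal form of the substitution calculus, so that
  facts keep matching after rewriting.
\<close>

abbreviation wk :: "tm \<Rightarrow> tm" where "wk t \<equiv> subst (\<lambda>n. Var (Suc n)) t"
abbreviation wk2 :: "tm \<Rightarrow> tm" where "wk2 t \<equiv> subst (\<lambda>n. Var (Suc (Suc n))) t"
abbreviation arrow :: "tm \<Rightarrow> tm \<Rightarrow> tm" (infixr "\<rightharpoonup>" 110) where "A \<rightharpoonup> B \<equiv> Pi A (wk B)"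
abbreviation peq :: "tm list \<Rightarrow> tm \<Rightarrow> tm \<Rightarrow> tm \<Rightarrow> bool" where "peq \<Gamma> A a b \<equiv> inhab \<Gamma> (Eq A a b)"

section \<open>Typing rules\<close>

lemma has_ty: "has \<Gamma> a A \<Longrightarrow> \<Gamma> \<turnstile> a \<Ztypecolon> A" by (simp add: has_def)

lemma has_v0: "isT \<Gamma> A \<Longrightarrow> T = wk A \<Longrightarrow> has (A # \<Gamma>) (Var 0) T"
  using ty_var[of "A # \<Gamma>" 0] isT_subst[OF _ wf_subst_k(1)] by (auto simp: has_def subst_nf isT_ctx)

lemma has_wk: "has \<Gamma> a A \<Longrightarrow> isT \<Gamma> B \<Longrightarrow> a' = wk a \<Longrightarrow> A' = wk A \<Longrightarrow> has (B # \<Gamma>) a' A'"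
  using has_subst[OF _ wf_subst_k(1)] by (auto simp: isT_ctx)

lemma isT_wk: "isT \<Gamma> A \<Longrightarrow> isT \<Gamma> B \<Longrightarrow> A' = wk A \<Longrightarrow> isT (B # \<Gamma>) A'"
  using isT_subst[OF _ wf_subst_k(1)] by (auto simp: isT_ctx)

lemma inhab_wk: "inhab \<Gamma> A \<Longrightarrow> isT \<Gamma> B \<Longrightarrow> A' = wk A \<Longrightarrow> inhab (B # \<Gamma>) A'"
  using inhab_subst[OF _ wf_subst_k(1)] by (auto simp: isT_ctx)

lemma has_v1: "isT (A # \<Gamma>) B \<Longrightarrow> T = wk2 A \<Longrightarrow> has (B # A # \<Gamma>) (Var (Suc 0)) T"
  by (rule has_wk[OF has_v0[OF isT_ctx_head refl]]) (auto simp: subst_nf)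

lemma has_v2: "isT (B # A # \<Gamma>) C \<Longrightarrow> T = subst (\<lambda>n. Var (Suc (Suc (Suc n)))) A
    \<Longrightarrow> has (C # B # A # \<Gamma>) (Var (Suc (Suc 0))) T"
  by (rule has_wk[OF has_v1[OF isT_ctx_head refl]]) (auto simp: subst_nf)

lemma has_v3: "isT (C # B # A # \<Gamma>) D \<Longrightarrow> T = subst (\<lambda>n. Var (Suc (Suc (Suc (Suc n))))) A
    \<Longrightarrow> has (D # C # B # A # \<Gamma>) (Var (Suc (Suc (Suc 0)))) T"
  by (rule has_wk[OF has_v2[OF isT_ctx_head refl]]) (auto simp: subst_nf)

lemma isT_Univ: "\<turnstile> \<Gamma> ctx \<Longrightarrow> isT \<Gamma> (Univ i)"
  by (auto simp: isT_def intro: ty_univ)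

lemma has_Pi_U: "has \<Gamma> A (Univ i) \<Longrightarrow> has (A # \<Gamma>) B (Univ i) \<Longrightarrow> has \<Gamma> (Pi A B) (Univ i)"
  by (auto simp: has_Univ intro: ty_pi)

lemma has_Sig_U: "has \<Gamma> A (Univ i) \<Longrightarrow> has (A # \<Gamma>) B (Univ i) \<Longrightarrow> has \<Gamma> (Sig A B) (Univ i)"
  by (auto simp: has_Univ intro: ty_sig)

lemma has_Eq_U: "has \<Gamma> A (Univ i) \<Longrightarrow> has \<Gamma> a A \<Longrightarrow> has \<Gamma> b A \<Longrightarrow> has \<Gamma> (Eq A a b) (Univ i)"
  by (auto simp: has_Univ has_ty intro: ty_eq)

lemma isT_Pi: "isT (A # \<Gamma>) B \<Longrightarrow> isT \<Gamma> (Pi A B)"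
  by (rule common_universe[OF isT_ctx_head, of A \<Gamma> B "A # \<Gamma>" B]) (auto simp: isT_def intro: ty_pi)

lemma isT_Sig: "isT (A # \<Gamma>) B \<Longrightarrow> isT \<Gamma> (Sig A B)"
  by (rule common_universe[OF isT_ctx_head, of A \<Gamma> B "A # \<Gamma>" B]) (auto simp: isT_def intro: ty_sig)

lemma isT_Eq: "has \<Gamma> a A \<Longrightarrow> has \<Gamma> b A \<Longrightarrow> isT \<Gamma> (Eq A a b)"
  by (auto simp: has_def isT_def intro: ty_eq)

lemma isT_fn: "isT \<Gamma> A \<Longrightarrow> isT \<Gamma> B \<Longrightarrow> isT \<Gamma> (A \<rightharpoonup> B)"
  by (rule isT_Pi) (rule isT_wk, auto)

lemma has_Lam: "has (A # \<Gamma>) b B \<Longrightarrow> has \<Gamma> (Lam A b) (Pi A B)"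
  by (rule common_universe[OF isT_ctx_head, of A \<Gamma> B "A # \<Gamma>" B])
    (auto simp: has_def intro: ty_lam isT_Pi)

text \<open>
  Here and below a substituted type in a conclusion is abstracted into a variable with an equational
  premise, since unification cannot invert substitution.
\<close>

lemma has_App: "has \<Gamma> f (Pi A B) \<Longrightarrow> has \<Gamma> a A \<Longrightarrow> T = subst (a .: Var) B \<Longrightarrow> has \<Gamma> (f \<cdot> a) T"
proof -
  assume f: "has \<Gamma> f (Pi A B)" and a: "has \<Gamma> a A" and T: "T = subst (a .: Var) B"
  have B: "isT (A # \<Gamma>) B" using f by (auto dest: has_isT isT_PiD)
  obtain i where "\<Gamma> \<turnstile> A \<Ztypecolon> Univ i" "A # \<Gamma> \<turnstile> B \<Ztypecolon> Univ i"
    using common_universe[OF isT_ctx_head[OF B] B] .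
  then have "\<Gamma> \<turnstile> f \<cdot> a \<Ztypecolon> inst 0 a B" using f a by (auto simp: has_def intro: ty_app)
  then show ?thesis using isT_subst[OF B wf_subst_inst[OF a] T] by (simp add: has_def T subst_nf)
qed

lemma has_App_fn: "has \<Gamma> f (A \<rightharpoonup> B) \<Longrightarrow> has \<Gamma> a A \<Longrightarrow> has \<Gamma> (f \<cdot> a) B"
  by (erule has_App) (auto simp: subst_nf)

lemma has_Tup:
  assumes a: "has \<Gamma> a A" and b: "has \<Gamma> b B'" and B': "B' = subst (a .: Var) B" and B: "isT (A # \<Gamma>) B"
  shows "has \<Gamma> (Tup a b) (Sig A B)"
  by (rule common_universe[OF isT_ctx_head[OF B] B])
    (use a b B' in \<open>auto simp: has_def inst_def subst_nf intro!: isT_Sig B intro: ty_tup\<close>)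

lemma has_Refl: "has \<Gamma> a A \<Longrightarrow> has \<Gamma> (Refl a) (Eq A a a)"
  using isT_Eq[of \<Gamma> a A a] by (auto simp: has_def isT_def intro: ty_refl)

text \<open>
  Proving a product is proving its body over the extended context; all binders of the final
  statement are introduced by this equivalence.
\<close>

lemma inhab_Pi: "inhab \<Gamma> (Pi A B) \<longleftrightarrow> inhab (A # \<Gamma>) B"
proof
  assume "inhab \<Gamma> (Pi A B)"
  then obtain f where f: "has \<Gamma> f (Pi A B)" by (auto simp: inhab_def)
  have A: "isT \<Gamma> A" using f by (auto dest: has_isT isT_PiD isT_ctx_head)
  have "has (A # \<Gamma>) (wk f \<cdot> Var 0) B"
    by (rule has_App[OF has_wk[OF f A refl refl, simplified] has_v0[OF A refl]]) (simp add: subst_nf)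
  then show "inhab (A # \<Gamma>) B" by (rule inhabI)
qed (auto simp: inhab_def intro: has_Lam)

lemma inhab_inst: "inhab (A # \<Gamma>) B \<Longrightarrow> has \<Gamma> a A \<Longrightarrow> T = subst (a .: Var) B \<Longrightarrow> inhab \<Gamma> T"
  by (rule inhab_subst[OF _ wf_subst_inst])

lemma inhab_Sig:
  assumes a: "has \<Gamma> a A" and b: "inhab \<Gamma> B'" and B': "B' = subst (a .: Var) B" and B: "isT (A # \<Gamma>) B"
  shows "inhab \<Gamma> (Sig A B)"
  using b by (auto simp: inhab_def intro: has_Tup[OF a _ B' B])

section \<open>Conversion\<close>

lemma ceq_refl: "has \<Gamma> a A \<Longrightarrow> ceq \<Gamma> a a A"
  by (auto simp: ceq_def has_ty intro: eq_refl)
lemma ceq_sym: "ceq \<Gamma> a b A \<Longrightarrow> ceq \<Gamma> b a A"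
  by (auto simp: ceq_def intro: eq_sym)
lemma ceq_trans: "ceq \<Gamma> a b A \<Longrightarrow> ceq \<Gamma> b c A \<Longrightarrow> ceq \<Gamma> a c A"
  by (auto simp: ceq_def intro: eq_trans)

lemma has_conv: "has \<Gamma> a A \<Longrightarrow> ceq \<Gamma> A B (Univ i) \<Longrightarrow> has \<Gamma> a B"
  by (auto simp: ceq_def has_Univ has_def isT_def intro: ty_conv)

lemma inhab_conv: "inhab \<Gamma> A \<Longrightarrow> ceq \<Gamma> A B (Univ i) \<Longrightarrow> inhab \<Gamma> B"
  by (auto simp: inhab_def intro: has_conv)

lemma ceq_conv: "ceq \<Gamma> a b A \<Longrightarrow> ceq \<Gamma> A B (Univ i) \<Longrightarrow> ceq \<Gamma> a b B"
  by (auto simp: ceq_def intro: eq_conv has_conv[unfolded ceq_def])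

lemma ceq_Eq:
  assumes "ceq \<Gamma> A A' (Univ i)" "ceq \<Gamma> a a' A" "ceq \<Gamma> b b' A"
  shows "ceq \<Gamma> (Eq A a b) (Eq A' a' b') (Univ i)"
  using assms ceq_conv[OF assms(2,1)] ceq_conv[OF assms(3,1)]
  by (auto simp: ceq_def has_ty intro: eq_eq has_Eq_U)

text \<open>
  Through this lemma the computation rules become paths and take part in equational reasoning.
\<close>

lemma ceq_peq: "ceq \<Gamma> a b A \<Longrightarrow> peq \<Gamma> A a b"
proof -
  assume ab: "ceq \<Gamma> a b A"
  then have a: "has \<Gamma> a A" by (simp add: ceq_def)
  obtain i where "has \<Gamma> A (Univ i)" using isT_level[OF has_isT[OF a]] .
  from ceq_Eq[OF ceq_refl[OF this] ceq_refl[OF a] ab] has_Refl[OF a] show ?thesis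
    by (auto intro: inhabI has_conv)
qed

lemma ceq_beta:
  assumes b: "has (A # \<Gamma>) b B" and a: "has \<Gamma> a A" and eq: "b' = subst (a .: Var) b" "B' = subst (a .: Var) B"
  shows "ceq \<Gamma> (Lam A b \<cdot> a) b' B'"
proof -
  obtain i where "\<Gamma> \<turnstile> A \<Ztypecolon> Univ i" "A # \<Gamma> \<turnstile> B \<Ztypecolon> Univ i"
    using common_universe[OF has_isT[OF a] has_isT[OF b]] .
  then show ?thesis
    using pi_beta[of \<Gamma> A i B b a] has_App[OF has_Lam[OF b] a eq(2)] has_subst[OF b wf_subst_inst[OF a] eq]
      a b eq by (simp add: ceq_def has_ty inst_def)
qed

lemma peq_beta: "has (A # \<Gamma>) b B \<Longrightarrow> has \<Gamma> a A \<Longrightarrow> b' = subst (a .: Var) b \<Longrightarrow> B' = subst (a .: Var) B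
    \<Longrightarrow> peq \<Gamma> B' (Lam A b \<cdot> a) b'"
  by (rule ceq_peq[OF ceq_beta])

section \<open>Identity types\<close>

lemma path_rec:
  assumes p: "has \<Gamma> p (Eq A a b)"
    and C: "isT (Eq (wk A) (wk a) (Var 0) # A # \<Gamma>) C"
    and c: "has \<Gamma> c C0" and C0: "C0 = subst (Refl a .: a .: Var) C"
    and C1: "C1 = subst (p .: b .: Var) C"
  shows "has \<Gamma> (IndEq C c p) C1"
proof -
  have ab: "has \<Gamma> a A" "has \<Gamma> b A" using p by (auto dest: has_isT isT_EqD)
  obtain i j where ij: "\<Gamma> \<turnstile> A \<Ztypecolon> Univ i" "Eq (wk A) (wk a) (Var 0) # A # \<Gamma> \<turnstile> C \<Ztypecolon> Univ j"
    using has_isT[OF ab(1)] C by (auto simp: isT_def)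
  have "\<Gamma> \<turnstile> IndEq C c p \<Ztypecolon> C1"
    using ty_ind_eq[of \<Gamma> A i a C j c b p] ij p ab c by (simp add: has_ty C0 C1 subst_nf)
  moreover have "isT \<Gamma> C1"
    by (rule isT_subst[OF C wf_subst_inst2[OF ab(2) p] C1]) (simp add: subst_nf)
  ultimately show ?thesis by (simp add: has_def)
qed

lemma path_induction:
  assumes p: "has \<Gamma> p (Eq A a b)"
    and C: "isT (Eq (wk A) (wk a) (Var 0) # A # \<Gamma>) C"
    and c: "inhab \<Gamma> C0" and C0: "C0 = subst (Refl a .: a .: Var) C"
    and C1: "C1 = subst (p .: b .: Var) C"
  shows "inhab \<Gamma> C1"
  using c path_rec[OF p C _ C0 C1] by (auto simp: inhab_def)

text \<open>
  The motive of path induction is the weakening of \<open>P\<close>, which does not depend on the path.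
\<close>

lemma transport:
  assumes p: "peq \<Gamma> A a b" and P: "isT (A # \<Gamma>) P"
    and c: "inhab \<Gamma> P0" and P0: "P0 = subst (a .: Var) P" and P1: "P1 = subst (b .: Var) P"
  shows "inhab \<Gamma> P1"
proof -
  obtain q where q: "has \<Gamma> q (Eq A a b)" using p by (auto simp: inhab_def)
  have a: "has \<Gamma> a A" using q by (auto dest: has_isT isT_EqD)
  have "isT (A # \<Gamma>) (Eq (wk A) (wk a) (Var 0))"
    by (rule isT_Eq[OF has_wk[OF a has_isT[OF a] refl refl] has_v0[OF has_isT[OF a] refl]])
  from isT_wk[OF P this refl] show ?thesis
    by (rule path_induction[OF q _ c]) (simp_all add: subst_nf P0 P1)
qed

lemma peqD: "peq \<Gamma> A a b \<Longrightarrow> has \<Gamma> a A" "peq \<Gamma> A a b \<Longrightarrow> has \<Gamma> b A"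
  by (auto dest: inhab_isT isT_EqD)

lemma peq_refl: "has \<Gamma> a A \<Longrightarrow> peq \<Gamma> A a a"
  by (rule inhabI[OF has_Refl])

lemma peq_cong:
  assumes p: "peq \<Gamma> A a b" and t: "has (A # \<Gamma>) t (wk B)"
    and eq: "ta = subst (a .: Var) t" "tb = subst (b .: Var) t"
  shows "peq \<Gamma> B ta tb"
proof -
  have A: "isT \<Gamma> A" using p by (auto dest: peqD has_isT)
  have ta: "has \<Gamma> ta B" using has_subst[OF t wf_subst_inst[OF peqD(1)[OF p]] eq(1)] by (simp add: subst_nf)
  show ?thesis
    by (rule transport[OF p isT_Eq[OF has_wk[OF ta A refl refl] t] peq_refl[OF ta]])
      (simp_all add: subst_nf eq)
qed

lemma peq_sym: assumes p: "peq \<Gamma> A a b" shows "peq \<Gamma> A b a"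
proof -
  have A: "isT \<Gamma> A" and a: "has \<Gamma> a A" using p by (auto dest: peqD has_isT)
  show ?thesis
    by (rule transport[OF p isT_Eq[OF has_v0[OF A refl] has_wk[OF a A refl refl]] peq_refl[OF a]])
      (simp_all add: subst_nf)
qed

lemma peq_trans: assumes p: "peq \<Gamma> A a b" and q: "peq \<Gamma> A b c" shows "peq \<Gamma> A a c"
proof -
  have A: "isT \<Gamma> A" and a: "has \<Gamma> a A" using p by (auto dest: peqD has_isT)
  show ?thesis
    by (rule transport[OF q isT_Eq[OF has_wk[OF a A refl refl] has_v0[OF A refl]] p])
      (simp_all add: subst_nf)
qed

lemma peq_App: 
  assumes f: "peq \<Gamma> (Pi A B) f g" and a: "has \<Gamma> a A" and T: "T = subst (a .: Var) B"
  shows "peq \<Gamma> T (f \<cdot> a) (g \<cdot> a)"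
proof -
  have P: "isT \<Gamma> (Pi A B)" using f by (auto dest: peqD has_isT)
  show ?thesis
    by (rule peq_cong[OF f has_App[OF has_v0[OF P, simplified, OF refl] has_wk[OF a P refl refl]]])
      (simp_all add: subst_nf T)
qed

lemma peq_App_fn: "peq \<Gamma> (A \<rightharpoonup> B) f g \<Longrightarrow> has \<Gamma> a A \<Longrightarrow> peq \<Gamma> B (f \<cdot> a) (g \<cdot> a)"
  by (erule peq_App) (auto simp: subst_nf)

lemma peq_ap: assumes f: "has \<Gamma> f (A \<rightharpoonup> B)" and a: "peq \<Gamma> A a b" shows "peq \<Gamma> B (f \<cdot> a) (f \<cdot> b)"
proof -
  have A: "isT \<Gamma> A" using a by (auto dest: peqD has_isT)
  show ?thesis
    by (rule peq_cong[OF a has_App[OF has_wk[OF f A refl refl, simplified] has_v0[OF A refl]]])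
      (simp_all add: subst_nf)
qed

lemma peq_inst: "peq (A # \<Gamma>) B f g \<Longrightarrow> has \<Gamma> a A \<Longrightarrow> f' = subst (a .: Var) f \<Longrightarrow> g' = subst (a .: Var) g
    \<Longrightarrow> B' = subst (a .: Var) B \<Longrightarrow> peq \<Gamma> B' f' g'"
  by (erule inhab_inst) auto

text \<open>
  Transport in the tautological family over the universe. It replaces conversion of types, which
  would not apply to types that are only propositionally equal.
\<close>

lemma inhab_peq: assumes "inhab \<Gamma> A" "peq \<Gamma> (Univ i) A B" shows "inhab \<Gamma> B"
proof -
  have c: "isT \<Gamma> (Univ i)" using assms(2) by (auto dest: peqD has_isT)
  have "has (Univ i # \<Gamma>) (Var 0) (Univ i)" by (rule has_v0[OF c]) simp
  from transport[OF assms(2) isT_has[OF this] assms(1)] show ?thesis by simp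
qed

section \<open>Dependent pairs\<close>

text \<open>
  The first projection, in the form in which it occurs in \<open>local_type\<close>.
\<close>

abbreviation Fst :: "tm \<Rightarrow> tm \<Rightarrow> tm" where "Fst A p \<equiv> IndSig (wk A) (Var (Suc 0)) p"

lemma sig_ind:
  assumes p: "has \<Gamma> p (Sig A B)" and C: "isT (Sig A B # \<Gamma>) C"
    and c: "inhab (B # A # \<Gamma>) C0" and C0: "C0 = subst (Tup (Var (Suc 0)) (Var 0) .: (\<lambda>n. Var (Suc (Suc n)))) C"
    and C1: "C1 = subst (p .: Var) C"
  shows "inhab \<Gamma> C1"
proof -
  have B: "isT (A # \<Gamma>) B" using p by (auto dest: has_isT isT_SigD)
  obtain i where i: "\<Gamma> \<turnstile> A \<Ztypecolon> Univ i" "A # \<Gamma> \<turnstile> B \<Ztypecolon> Univ i"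
    using common_universe[OF isT_ctx_head[OF B] B] .
  obtain j where j: "Sig A B # \<Gamma> \<turnstile> C \<Ztypecolon> Univ j" using C by (auto simp: isT_def)
  obtain g where "has (B # A # \<Gamma>) g C0" using c by (auto simp: inhab_def)
  then have "\<Gamma> \<turnstile> IndSig C g p \<Ztypecolon> C1"
    using ty_ind_sig[OF i j, of g p] p by (simp add: has_ty C0 C1 subst_nf)
  then show ?thesis using isT_subst[OF C wf_subst_inst[OF p] C1] by (auto simp: has_def intro: inhabI)
qed

lemma sig_elim:
  assumes C: "isT (Sig A B # \<Gamma>) C"
    and c: "inhab (B # A # \<Gamma>) C0" and C0: "C0 = subst (Tup (Var (Suc 0)) (Var 0) .: (\<lambda>n. Var (Suc (Suc n)))) C"
  shows "inhab (Sig A B # \<Gamma>) C"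
proof -
  have S: "isT \<Gamma> (Sig A B)" using isT_ctx_head[OF C] .
  have B: "isT (A # \<Gamma>) B" by (rule isT_SigD[OF S])
  have w: "wf_subst (Sig A B # \<Gamma>) (\<lambda>n. Var (Suc n)) \<Gamma>" by (rule wf_subst_k(1)[OF isT_ctx(1)[OF S]])
  obtain i where i: "\<Gamma> \<turnstile> A \<Ztypecolon> Univ i" "A # \<Gamma> \<turnstile> B \<Ztypecolon> Univ i"
    using common_universe[OF isT_ctx_head[OF B] B] .
  obtain j where j: "\<Gamma> \<turnstile> Sig A B \<Ztypecolon> Univ j" using S by (auto simp: isT_def)
  note w1 = wf_subst_up[OF w typing_subst[OF i(1) w, unfolded subst.simps(2)]]
  note w2 = wf_subst_up[OF w1 typing_subst[OF i(2) w1, unfolded subst.simps(2)]]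
  note w3 = wf_subst_up[OF w typing_subst[OF j w, unfolded subst.simps(2)]]
  show ?thesis
    by (rule sig_ind[OF has_v0[OF S, unfolded subst.simps, OF refl] isT_subst[OF C w3[unfolded subst.simps] refl]
          inhab_subst[OF c w2 refl]]) (simp_all add: C0 subst_nf)
qed

lemma has_Fst:
  assumes p: "has \<Gamma> p (Sig A B)" shows "has \<Gamma> (Fst A p) A"
proof -
  have S: "isT \<Gamma> (Sig A B)" by (rule has_isT[OF p])
  have B: "isT (A # \<Gamma>) B" by (rule isT_SigD[OF S])
  obtain i where i: "\<Gamma> \<turnstile> A \<Ztypecolon> Univ i" "A # \<Gamma> \<turnstile> B \<Ztypecolon> Univ i"
    using common_universe[OF isT_ctx_head[OF B] B] .
  obtain j where j: "Sig A B # \<Gamma> \<turnstile> wk A \<Ztypecolon> Univ j" using isT_wk[OF isT_ctx_head[OF B] S refl]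
    by (auto simp: isT_def)
  show ?thesis
    using ty_ind_sig[OF i j, of "Var (Suc 0)" p] p isT_ctx_head[OF B] has_v1[OF B refl]
    by (simp add: has_def subst_nf)
qed

lemma ceq_Fst:
  assumes a: "has \<Gamma> a A" and b: "has \<Gamma> b B'" and B': "B' = subst (a .: Var) B" and B: "isT (A # \<Gamma>) B"
  shows "ceq \<Gamma> (Fst A (Tup a b)) a A"
proof -
  note p = has_Tup[OF a b B' B]
  have S: "isT \<Gamma> (Sig A B)" by (rule has_isT[OF p])
  obtain i where i: "\<Gamma> \<turnstile> A \<Ztypecolon> Univ i" "A # \<Gamma> \<turnstile> B \<Ztypecolon> Univ i"
    using common_universe[OF isT_ctx_head[OF B] B] .
  obtain j where j: "Sig A B # \<Gamma> \<turnstile> wk A \<Ztypecolon> Univ j" using isT_wk[OF isT_ctx_head[OF B] S refl]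
    by (auto simp: isT_def)
  show ?thesis
    using sig_beta[OF i j, of "Var (Suc 0)" a b] a b has_Fst[OF p] has_v1[OF B refl]
    by (simp add: ceq_def has_ty subst_nf B')
qed

text \<open>
  The second projection has type \<open>B\<close> at the first projection of the pair, whereas its defining
  clause provides an element of \<open>B\<close> at the first component. The two types are related by
  transport, so no conversion between instances of \<open>B\<close> is needed.
\<close>

lemma sigE:
  assumes p: "has \<Gamma> p (Sig A B)"
  shows "\<exists>a. has \<Gamma> a A \<and> inhab \<Gamma> (subst (a .: Var) B)"
proof -
  have S: "isT \<Gamma> (Sig A B)" by (rule has_isT[OF p])
  have B: "isT (A # \<Gamma>) B" by (rule isT_SigD[OF S])
  have A: "isT \<Gamma> A" by (rule isT_ctx_head[OF B])
  let ?C = "subst (Fst (wk A) (Var 0) .: (\<lambda>n. Var (Suc n))) B"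
  have C: "isT (Sig A B # \<Gamma>) ?C"
  proof (rule isT_subst[OF B wf_subst_Cons[OF wf_subst_k(1) _ refl] refl])
    show "has (Sig A B # \<Gamma>) (Fst (wk A) (Var 0)) (wk A)"
      by (rule has_Fst) (rule has_v0[OF S, unfolded subst.simps, OF refl])
  qed (rule isT_ctx(1)[OF S])
  have w2: "wf_subst (B # A # \<Gamma>) (\<lambda>n. Var (Suc (Suc n))) \<Gamma>" using B by (intro wf_subst_k isT_ctx)
  have ww: "wf_subst (B # A # \<Gamma>) (Var (Suc 0) .: (\<lambda>n. Var (Suc (Suc n)))) (A # \<Gamma>)"
    by (rule wf_subst_Cons[OF w2 has_v1[OF B refl] refl])
  have wA: "isT (B # A # \<Gamma>) (wk2 A)" by (rule isT_subst[OF A w2 refl])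
  have B2: "isT (wk2 A # B # A # \<Gamma>) (subst (Var 0 .: (\<lambda>n. Var (Suc (Suc (Suc n))))) B)"
    by (rule isT_subst[OF B wf_subst_Cons[OF wf_subst_k(3)[OF isT_ctx(1)[OF wA]] has_v0[OF wA refl]]])
      (simp_all add: subst_nf)
  have base: "inhab (B # A # \<Gamma>) (subst (Fst (wk2 A) (Tup (Var (Suc 0)) (Var 0)) .: (\<lambda>n. Var (Suc (Suc n)))) B)"
  proof (rule transport[OF peq_sym[OF ceq_peq[OF ceq_Fst[where B="subst (Var 0 .: (\<lambda>n. Var (Suc (Suc (Suc n))))) B"]]] B2])
    show "has (B # A # \<Gamma>) (Var (Suc 0)) (wk2 A)" by (rule has_v1[OF B refl])
    show "has (B # A # \<Gamma>) (Var 0) (wk B)" by (rule has_v0[OF B refl])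
    then show "inhab (B # A # \<Gamma>) (wk B)" by (rule inhabI)
  qed (use B2 in \<open>simp_all add: subst_nf\<close>)
  have "inhab \<Gamma> (subst (Fst A p .: Var) B)"
    by (rule sig_ind[OF p C base]) (simp_all add: subst_nf)
  with has_Fst[OF p] show ?thesis by blast
qed

section \<open>Equivalences\<close>

abbreviation (input) "rinvT A B f \<equiv> Sig (B \<rightharpoonup> A) (Pi (wk B) (Eq (wk2 B) (wk2 f \<cdot> (Var (Suc 0) \<cdot> Var 0)) (Var 0)))"
abbreviation (input) "linvT A B f \<equiv> Sig (B \<rightharpoonup> A) (Pi (wk A) (Eq (wk2 A) (Var (Suc 0) \<cdot> (wk2 f \<cdot> Var 0)) (Var 0)))"

lemma is_equiv_nf: "is_equiv A B f = Sig (rinvT A B f) (wk (linvT A B f))"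
  by (simp add: is_equiv_def subst_nf)

lemma has_fn_U: "has \<Gamma> A (Univ i) \<Longrightarrow> has \<Gamma> B (Univ i) \<Longrightarrow> has \<Gamma> (A \<rightharpoonup> B) (Univ i)"
  by (rule has_Pi_U, assumption, erule has_wk) (auto intro: isT_has)

lemma has_rinvT:
  assumes A: "has \<Gamma> A (Univ i)" and B: "has \<Gamma> B (Univ i)" and f: "has \<Gamma> f (A \<rightharpoonup> B)"
  shows "has \<Gamma> (rinvT A B f) (Univ i)"
proof -
  have g: "has \<Gamma> (B \<rightharpoonup> A) (Univ i)" by (rule has_fn_U[OF B A])
  have g': "isT \<Gamma> (B \<rightharpoonup> A)" by (rule isT_has[OF g])
  have B1: "has ((B \<rightharpoonup> A) # \<Gamma>) (wk B) (Univ i)" by (rule has_wk[OF B g']) auto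
  note c = isT_ctx(1)[OF isT_has[OF B1]]
  show ?thesis
  proof (intro has_Sig_U[OF g] has_Pi_U[OF B1] has_Eq_U)
    show "has (wk B # (B \<rightharpoonup> A) # \<Gamma>) (wk2 B) (Univ i)"
      by (rule has_subst[OF B wf_subst_k(2)[OF c]]) auto
    show v0: "has (wk B # (B \<rightharpoonup> A) # \<Gamma>) (Var 0) (wk2 B)"
      by (rule has_v0[OF isT_has[OF B1]]) (simp add: subst_nf)
    have v1: "has (wk B # (B \<rightharpoonup> A) # \<Gamma>) (Var (Suc 0)) (wk2 B \<rightharpoonup> wk2 A)"
      by (rule has_v1[OF isT_has[OF B1]]) (simp add: subst_nf)
    have f2: "has (wk B # (B \<rightharpoonup> A) # \<Gamma>) (wk2 f) (wk2 A \<rightharpoonup> wk2 B)"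
      by (rule has_subst[OF f wf_subst_k(2)[OF c]]) (simp_all add: subst_nf)
    show "has (wk B # (B \<rightharpoonup> A) # \<Gamma>) (wk2 f \<cdot> (Var (Suc 0) \<cdot> Var 0)) (wk2 B)"
      by (rule has_App_fn[OF f2 has_App_fn[OF v1 v0]])
  qed
qed

lemma has_linvT:
  assumes A: "has \<Gamma> A (Univ i)" and B: "has \<Gamma> B (Univ i)" and f: "has \<Gamma> f (A \<rightharpoonup> B)"
  shows "has \<Gamma> (linvT A B f) (Univ i)"
proof -
  have g: "has \<Gamma> (B \<rightharpoonup> A) (Univ i)" by (rule has_fn_U[OF B A])
  have g': "isT \<Gamma> (B \<rightharpoonup> A)" by (rule isT_has[OF g])
  have A1: "has ((B \<rightharpoonup> A) # \<Gamma>) (wk A) (Univ i)" by (rule has_wk[OF A g']) auto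
  note c = isT_ctx(1)[OF isT_has[OF A1]]
  show ?thesis
  proof (intro has_Sig_U[OF g] has_Pi_U[OF A1] has_Eq_U)
    show "has (wk A # (B \<rightharpoonup> A) # \<Gamma>) (wk2 A) (Univ i)"
      by (rule has_subst[OF A wf_subst_k(2)[OF c]]) auto
    show v0: "has (wk A # (B \<rightharpoonup> A) # \<Gamma>) (Var 0) (wk2 A)"
      by (rule has_v0[OF isT_has[OF A1]]) (simp add: subst_nf)
    have v1: "has (wk A # (B \<rightharpoonup> A) # \<Gamma>) (Var (Suc 0)) (wk2 B \<rightharpoonup> wk2 A)"
      by (rule has_v1[OF isT_has[OF A1]]) (simp add: subst_nf)
    have f2: "has (wk A # (B \<rightharpoonup> A) # \<Gamma>) (wk2 f) (wk2 A \<rightharpoonup> wk2 B)"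
      by (rule has_subst[OF f wf_subst_k(2)[OF c]]) (simp_all add: subst_nf)
    show "has (wk A # (B \<rightharpoonup> A) # \<Gamma>) (Var (Suc 0) \<cdot> (wk2 f \<cdot> Var 0)) (wk2 A)"
      by (rule has_App_fn[OF v1 has_App_fn[OF f2 v0]])
  qed
qed

lemma has_is_equiv:
  assumes A: "has \<Gamma> A (Univ i)" and B: "has \<Gamma> B (Univ i)" and f: "has \<Gamma> f (A \<rightharpoonup> B)"
  shows "has \<Gamma> (is_equiv A B f) (Univ i)"
  unfolding is_equiv_nf
  by (rule has_Sig_U[OF has_rinvT[OF assms] has_wk[OF has_linvT[OF assms] isT_has[OF has_rinvT[OF assms]] refl]])
    simp

lemma isT_is_equiv:
  assumes f: "has \<Gamma> f (A \<rightharpoonup> B)" and B: "isT \<Gamma> B" shows "isT \<Gamma> (is_equiv A B f)"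
proof -
  have A: "isT \<Gamma> A" using f by (auto dest: has_isT isT_PiD isT_ctx_head)
  obtain k where "\<Gamma> \<turnstile> A \<Ztypecolon> Univ k" "\<Gamma> \<turnstile> B \<Ztypecolon> Univ k" using common_universe[OF A B] .
  then show ?thesis using has_is_equiv[OF _ _ f] by (auto simp: has_Univ isT_def)
qed

lemma equivE:
  assumes "inhab \<Gamma> (is_equiv A B f)"
  obtains g h where "has \<Gamma> g (B \<rightharpoonup> A)" "peq (B # \<Gamma>) (wk B) (wk f \<cdot> (wk g \<cdot> Var 0)) (Var 0)"
    "has \<Gamma> h (B \<rightharpoonup> A)" "peq (A # \<Gamma>) (wk A) (wk h \<cdot> (wk f \<cdot> Var 0)) (Var 0)"
proof -
  obtain e where "has \<Gamma> e (Sig (rinvT A B f) (wk (linvT A B f)))"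
    using assms by (auto simp: inhab_def is_equiv_nf)
  from sigE[OF this] obtain r l where "has \<Gamma> r (rinvT A B f)" and "has \<Gamma> l (linvT A B f)"
    by (auto simp: inhab_def subst_nf)
  from sigE[OF this(1)] sigE[OF this(2)] that show ?thesis by (auto simp: subst_nf inhab_Pi)
qed

lemma equivI:
  assumes f: "has \<Gamma> f (A \<rightharpoonup> B)"
    and g: "has \<Gamma> g (B \<rightharpoonup> A)" "peq (B # \<Gamma>) (wk B) (wk f \<cdot> (wk g \<cdot> Var 0)) (Var 0)"
    and h: "has \<Gamma> h (B \<rightharpoonup> A)" "peq (A # \<Gamma>) (wk A) (wk h \<cdot> (wk f \<cdot> Var 0)) (Var 0)"
  shows "inhab \<Gamma> (is_equiv A B f)"
proof -
  have A: "isT \<Gamma> A" using f by (auto dest: has_isT isT_PiD isT_ctx_head)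
  have B: "isT \<Gamma> B" using g by (auto dest: has_isT isT_PiD isT_ctx_head)
  obtain k where "\<Gamma> \<turnstile> A \<Ztypecolon> Univ k" "\<Gamma> \<turnstile> B \<Ztypecolon> Univ k" using common_universe[OF A B] .
  then have AB: "has \<Gamma> A (Univ k)" "has \<Gamma> B (Univ k)" by (auto simp: has_Univ)
  have R: "isT \<Gamma> (rinvT A B f)" "isT \<Gamma> (linvT A B f)"
    using has_rinvT[OF AB f] has_linvT[OF AB f] by (auto intro: isT_has)
  have r: "inhab \<Gamma> (rinvT A B f)"
    by (rule inhab_Sig[OF g(1) _ refl isT_SigD[OF R(1)]]) (use g(2) in \<open>simp add: subst_nf inhab_Pi\<close>)
  have l: "inhab \<Gamma> (linvT A B f)"
    by (rule inhab_Sig[OF h(1) _ refl isT_SigD[OF R(2)]]) (use h(2) in \<open>simp add: subst_nf inhab_Pi\<close>)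
  from r obtain x where "has \<Gamma> x (rinvT A B f)" by (auto simp: inhab_def)
  from inhab_Sig[OF this l _ isT_wk[OF R(2,1) refl]] show ?thesis by (simp add: is_equiv_nf subst_nf)
qed

section \<open>Identity systems and function extensionality\<close>

text \<open>
  If \<open>m : Eq A a x \<rightarrow> R x\<close> is a family of equivalences, then \<open>R\<close> inherits path induction, with
  \<open>r0\<close>, the image of reflexivity, as the base point: every \<open>r\<close> in \<open>R b\<close> is \<open>m\<close> of the path \<open>g r\<close>, where
  \<open>g\<close> is a right inverse of \<open>m\<close>, and paths are handled by path induction. Function extensionality
  and univalence both enter through this principle.
\<close>

lemma identity_system_induction:
  assumes a: "has \<Gamma> a A"
    and m: "has (A # \<Gamma>) m (Eq (wk A) (wk a) (Var 0) \<rightharpoonup> R)"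
    and e: "inhab (A # \<Gamma>) (is_equiv (Eq (wk A) (wk a) (Var 0)) R m)"
    and r0: "peq \<Gamma> R0 (subst (a .: Var) m \<cdot> Refl a) r0" and R0: "R0 = subst (a .: Var) R"
    and C: "isT (R # A # \<Gamma>) C"
    and c: "inhab \<Gamma> C0" and C0: "C0 = subst (r0 .: a .: Var) C"
    and b: "has \<Gamma> b A" and r: "has \<Gamma> r R1" and R1: "R1 = subst (b .: Var) R"
    and C1: "C1 = subst (r .: b .: Var) C"
  shows "inhab \<Gamma> C1"
proof -
  have A: "isT \<Gamma> A" by (rule has_isT[OF a])
  have E: "isT (A # \<Gamma>) (Eq (wk A) (wk a) (Var 0))"
    by (rule isT_Eq[OF has_wk[OF a A refl refl] has_v0[OF A refl]])
  have R: "isT (A # \<Gamma>) R" by (rule isT_ctx_head[OF C])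
  have tr: "inhab \<Gamma> (subst (y .: x .: Var) C)"
    if x: "has \<Gamma> x A" and p: "peq \<Gamma> (subst (x .: Var) R) y' y" and q: "inhab \<Gamma> (subst (y' .: x .: Var) C)" for x y y'
  proof (rule transport[OF p _ q])
    have Rx: "isT \<Gamma> (subst (x .: Var) R)" by (rule isT_subst[OF R wf_subst_inst[OF x] refl])
    have "wf_subst (subst (x .: Var) R # \<Gamma>) (wk x .: (\<lambda>n. Var (Suc n))) (A # \<Gamma>)"
      by (rule wf_subst_Cons[OF wf_subst_k(1)[OF isT_ctx(1)[OF Rx]] has_wk[OF x Rx refl refl] refl])
    from wf_subst_Cons[OF this has_v0[OF Rx refl]]
    show "isT (subst (x .: Var) R # \<Gamma>) (subst (Var 0 .: wk x .: (\<lambda>n. Var (Suc n))) C)"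
      by (intro isT_subst[OF C _ refl]) (simp add: subst_nf)
  qed (simp_all add: subst_nf)
  have m': "has \<Gamma> (subst (x .: Var) m) (Eq A a x \<rightharpoonup> subst (x .: Var) R)" if "has \<Gamma> x A" for x
    by (rule has_subst[OF m wf_subst_inst[OF that] refl]) (simp add: subst_nf)
  have "inhab \<Gamma> (is_equiv (Eq A a b) (subst (b .: Var) R) (subst (b .: Var) m))"
    by (rule inhab_inst[OF e b]) (simp add: subst_notions subst_nf)
  then obtain g where g: "has \<Gamma> g (subst (b .: Var) R \<rightharpoonup> Eq A a b)"
    and g': "peq (subst (b .: Var) R # \<Gamma>) (wk (subst (b .: Var) R))
        (wk (subst (b .: Var) m) \<cdot> (wk g \<cdot> Var 0)) (Var 0)" by (rule equivE)
  have gr: "peq \<Gamma> (subst (b .: Var) R) (subst (b .: Var) m \<cdot> (g \<cdot> r)) r"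
    by (rule peq_inst[OF g']) (use r in \<open>simp_all add: subst_nf R1\<close>)
  have p: "has \<Gamma> (g \<cdot> r) (Eq A a b)" by (rule has_App_fn[OF g r[unfolded R1]])
  let ?C = "subst (wk m \<cdot> Var 0 .: (\<lambda>n. Var (Suc n))) C"
  have mE: "has (Eq (wk A) (wk a) (Var 0) # A # \<Gamma>) (wk m \<cdot> Var 0) (wk R)"
    by (rule has_App_fn[OF has_wk[OF m E refl] has_v0[OF E refl]]) (simp add: subst_nf)
  have C': "isT (Eq (wk A) (wk a) (Var 0) # A # \<Gamma>) ?C"
    by (rule isT_subst[OF C wf_subst_Cons[OF wf_subst_k(1)[OF isT_ctx(1)[OF E]] mE refl] refl])
  have "inhab \<Gamma> (subst (subst (a .: Var) m \<cdot> Refl a .: a .: Var) C)"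
    by (rule tr[OF a peq_sym[OF r0[unfolded R0]] c[unfolded C0]])
  then have "inhab \<Gamma> (subst (subst (b .: Var) m \<cdot> (g \<cdot> r) .: b .: Var) C)"
    by (rule path_induction[OF p C']) (simp_all add: subst_nf)
  from tr[OF b gr this] show ?thesis by (simp add: C1)
qed

lemma ceq_path_rec:
  assumes a: "has \<Gamma> a A"
    and C: "isT (Eq (wk A) (wk a) (Var 0) # A # \<Gamma>) C"
    and c: "has \<Gamma> c C0" and C0: "C0 = subst (Refl a .: a .: Var) C"
  shows "ceq \<Gamma> (IndEq C c (Refl a)) c C0"
proof -
  obtain i j where ij: "\<Gamma> \<turnstile> A \<Ztypecolon> Univ i" "Eq (wk A) (wk a) (Var 0) # A # \<Gamma> \<turnstile> C \<Ztypecolon> Univ j"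
    using has_isT[OF a] C by (auto simp: isT_def)
  then show ?thesis
    using eq_beta[of \<Gamma> A i a C j c] a c path_rec[OF has_Refl[OF a] C c C0 C0]
    by (simp add: ceq_def has_ty C0 subst_nf)
qed

lemmas has_subst_Pi = has_subst[OF _ _ refl subst.simps(3)[symmetric]]

text \<open>
  Both parts are needed for homotopies to form an identity system: the axiom mentions \<open>happly\<close>, and
  its value at reflexivity identifies the base point.
\<close>

lemma happly_facts:
  assumes f: "has \<Gamma> f (Pi A B)" and g: "has \<Gamma> g (Pi A B)"
  shows has_happly: "has \<Gamma> (happly A B f g) (Eq (Pi A B) f g \<rightharpoonup> Pi A (Eq B (wk f \<cdot> Var 0) (wk g \<cdot> Var 0)))"
    and happly_Refl: "ceq \<Gamma> (happly A B f f \<cdot> Refl f) (Lam A (Refl (wk f \<cdot> Var 0))) (Pi A (Eq B (wk f \<cdot> Var 0) (wk f \<cdot> Var 0)))"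
proof -
  let ?F = "Pi A B"
  have F: "isT \<Gamma> ?F" by (rule has_isT[OF f])
  have B: "isT (A # \<Gamma>) B" by (rule isT_PiD[OF F])
  have A: "isT \<Gamma> A" by (rule isT_ctx_head[OF B])
  let ?k3 = "\<lambda>n. Var (Suc (Suc (Suc n)))" and ?k4 = "\<lambda>n. Var (Suc (Suc (Suc (Suc n))))"
  let ?C = "Pi (subst ?k3 A) (Eq (subst (Var 0 .: ?k4) B) (subst ?k4 f \<cdot> Var 0) (Var (Suc (Suc 0)) \<cdot> Var 0))"
  let ?E1 = "Eq (wk (wk ?F)) (wk (wk f)) (Var 0)"
  have C: "isT (?E1 # wk ?F # X # \<Gamma>) ?C" and c: "has (X # \<Gamma>) (Lam (wk A) (Refl (wk2 f \<cdot> Var 0))) (subst (Refl (wk f) .: wk f .: Var) ?C)"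
    if X: "isT \<Gamma> X" for X
  proof -
    have f1: "has (X # \<Gamma>) (wk f) (wk ?F)" by (rule has_wk[OF f X refl refl])
    have F1: "isT (X # \<Gamma>) (wk ?F)" by (rule has_isT[OF f1])
    have E1: "isT (wk ?F # X # \<Gamma>) ?E1"
      by (rule isT_Eq[OF has_wk[OF f1 F1 refl refl] has_v0[OF F1 refl]])
    let ?D = "?E1 # wk ?F # X # \<Gamma>"
    have A3: "isT ?D (subst ?k3 A)" by (rule isT_subst[OF A wf_subst_k(3)[OF isT_ctx(1)[OF E1]] refl])
    have w4: "wf_subst (subst ?k3 A # ?D) ?k4 \<Gamma>" by (rule wf_subst_k(4)[OF isT_ctx(1)[OF A3]])
    have v2: "has (subst ?k3 A # ?D) (Var (Suc (Suc 0))) (Pi (subst ?k4 A) (subst (up ?k4) B))"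
      by (rule has_v2[OF A3]) (simp add: subst_nf)
    show "isT ?D ?C"
    proof (intro isT_Pi isT_Eq)
      show "has (subst ?k3 A # ?D) (subst ?k4 f \<cdot> Var 0) (subst (Var 0 .: ?k4) B)"
        by (rule has_App[OF has_subst_Pi[OF f w4] has_v0[OF A3]]) (simp_all add: subst_nf)
      show "has (subst ?k3 A # ?D) (Var (Suc (Suc 0)) \<cdot> Var 0) (subst (Var 0 .: ?k4) B)"
        by (rule has_App[OF v2 has_v0[OF A3]]) (simp_all add: subst_nf)
    qed
    have A1: "isT (X # \<Gamma>) (wk A)" by (rule isT_wk[OF A X refl])
    have f2: "has (wk A # X # \<Gamma>) (wk2 f \<cdot> Var 0) (subst (Var 0 .: (\<lambda>n. Var (Suc (Suc n)))) B)"
      by (rule has_App[OF has_subst_Pi[OF f wf_subst_k(2)[OF isT_ctx(1)[OF A1]]] has_v0[OF A1]])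
        (simp_all add: subst_nf)
    show "has (X # \<Gamma>) (Lam (wk A) (Refl (wk2 f \<cdot> Var 0))) (subst (Refl (wk f) .: wk f .: Var) ?C)"
      using has_Lam[OF has_Refl[OF f2]] by (simp add: subst_nf)
  qed
  let ?I = "\<lambda>p. IndEq ?C (Lam (wk A) (Refl (wk2 f \<cdot> Var 0))) p"
  have h: "happly A B f g = Lam (Eq ?F f g) (?I (Var 0))" for g
    by (simp add: happly_def subst_nf)
  have I: "has (Eq ?F f g # \<Gamma>) (?I (Var 0)) (wk (Pi A (Eq B (wk f \<cdot> Var 0) (wk g \<cdot> Var 0))))"
    if g: "has \<Gamma> g ?F" for g
  proof -
    have E: "isT \<Gamma> (Eq ?F f g)" by (rule isT_Eq[OF f g])
    show ?thesis
      by (rule path_rec[OF has_v0[OF E, of "Eq (wk ?F) (wk f) (wk g)"] C[OF E] c[OF E] refl]) (simp_all add: subst_nf)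
  qed
  from has_Lam[OF I[OF g]] show "has \<Gamma> (happly A B f g) (Eq ?F f g \<rightharpoonup> Pi A (Eq B (wk f \<cdot> Var 0) (wk g \<cdot> Var 0)))"
    by (simp add: h)
  have E: "isT \<Gamma> (Eq ?F f f)" by (rule isT_Eq[OF f f])
  show "ceq \<Gamma> (happly A B f f \<cdot> Refl f) (Lam A (Refl (wk f \<cdot> Var 0))) (Pi A (Eq B (wk f \<cdot> Var 0) (wk f \<cdot> Var 0)))"
    unfolding h
  proof (rule ceq_trans[OF ceq_beta[OF I[OF f] has_Refl[OF f] refl]])
    have w: "wf_subst \<Gamma> (Refl f .: Var) (Eq ?F f f # \<Gamma>)" by (rule wf_subst_inst[OF has_Refl[OF f]])
    let ?C' = "subst (up (up (Refl f .: Var))) ?C"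
    have E1: "isT (?F # \<Gamma>) (Eq (wk ?F) (wk f) (Var 0))"
      by (rule isT_Eq[OF has_wk[OF f F refl refl] has_v0[OF F refl]])
    have w2: "wf_subst (Eq (wk ?F) (wk f) (Var 0) # ?F # \<Gamma>) (up (up (Refl f .: Var))) (?E1 # wk ?F # Eq ?F f f # \<Gamma>)"
    proof -
      obtain i where i: "\<Gamma> \<turnstile> subst (Refl f .: Var) (wk ?F) \<Ztypecolon> Univ i" using F by (auto simp: isT_def subst_nf)
      obtain j where j: "?F # \<Gamma> \<turnstile> subst (up (Refl f .: Var)) ?E1 \<Ztypecolon> Univ j" using E1 by (auto simp: isT_def subst_nf)
      from wf_subst_up[OF wf_subst_up[OF w i], of ?E1 j] j show ?thesis by (simp add: subst_nf)
    qed
    have C': "isT (Eq (wk ?F) (wk f) (Var 0) # ?F # \<Gamma>) ?C'"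
      by (rule isT_subst[OF C[OF E] w2 refl])
    have c': "has \<Gamma> (Lam A (Refl (wk f \<cdot> Var 0))) (Pi A (Eq B (wk f \<cdot> Var 0) (wk f \<cdot> Var 0)))"
      by (rule has_subst[OF c[OF E] w]) (simp_all add: subst_nf)
    from ceq_path_rec[OF f C' c']
    show "ceq \<Gamma> (subst (Refl f .: Var) (?I (Var 0))) (Lam A (Refl (wk f \<cdot> Var 0))) (Pi A (Eq B (wk f \<cdot> Var 0) (wk f \<cdot> Var 0)))"
      by (simp add: subst_nf)
  qed (simp add: subst_nf)
qed

lemma has_app0: "has \<Gamma> f (Pi A B) \<Longrightarrow> has (A # \<Gamma>) (wk f \<cdot> Var 0) B"
proof -
  assume f: "has \<Gamma> f (Pi A B)"
  have A: "isT \<Gamma> A" by (rule isT_ctx_head[OF isT_PiD[OF has_isT[OF f]]])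
  show ?thesis
    by (rule has_App[OF has_subst_Pi[OF f wf_subst_k(1)[OF isT_ctx(1)[OF A]]] has_v0[OF A]]) (simp_all add: subst_nf)
qed

lemma inhab_funext_equiv:
  assumes f: "has \<Gamma> f (Pi A B)" and g: "has \<Gamma> g (Pi A B)"
  shows "inhab \<Gamma> (is_equiv (Eq (Pi A B) f g) (Pi A (Eq B (wk f \<cdot> Var 0) (wk g \<cdot> Var 0))) (happly A B f g))"
proof -
  have B: "isT (A # \<Gamma>) B" by (rule isT_PiD[OF has_isT[OF f]])
  have A: "isT \<Gamma> A" by (rule isT_ctx_head[OF B])
  obtain i where i: "\<Gamma> \<turnstile> A \<Ztypecolon> Univ i" "A # \<Gamma> \<turnstile> B \<Ztypecolon> Univ i" using common_universe[OF A B] .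
  note h = has_happly[OF f g]
  have "isT \<Gamma> (Pi A (Eq B (wk f \<cdot> Var 0) (wk g \<cdot> Var 0)))"
    by (intro isT_Pi isT_Eq has_app0 f g)
  from isT_is_equiv[OF h this] ty_funext[OF i has_ty[OF f] has_ty[OF g]]
  show ?thesis by (auto simp: has_def subst_nf intro!: inhabI)
qed

lemma funext:
  assumes f: "has \<Gamma> f (Pi A B)" and g: "has \<Gamma> g (Pi A B)"
    and H: "peq (A # \<Gamma>) B (wk f \<cdot> Var 0) (wk g \<cdot> Var 0)"
  shows "peq \<Gamma> (Pi A B) f g"
proof -
  obtain k where k: "has \<Gamma> k (Pi A (Eq B (wk f \<cdot> Var 0) (wk g \<cdot> Var 0)) \<rightharpoonup> Eq (Pi A B) f g)"
    using inhab_funext_equiv[OF f g] by (rule equivE)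
  obtain h where "has \<Gamma> h (Pi A (Eq B (wk f \<cdot> Var 0) (wk g \<cdot> Var 0)))"
    using H unfolding inhab_Pi[symmetric] by (auto simp: inhab_def)
  from has_App_fn[OF k this] show ?thesis by (rule inhabI)
qed

definition htpy :: "tm \<Rightarrow> tm \<Rightarrow> tm \<Rightarrow> tm \<Rightarrow> tm" where
  "htpy A B f g = Pi A (Eq B (wk f \<cdot> Var 0) (wk g \<cdot> Var 0))"

text \<open>
  The functions equipped with a homotopy into \<open>h\<close>.
\<close>

definition htpy_sing :: "tm \<Rightarrow> tm \<Rightarrow> tm \<Rightarrow> tm" where
  "htpy_sing A B h = Sig (Pi A B) (htpy (wk A) (subst (up (\<lambda>n. Var (Suc n))) B) (Var 0) (wk h))"

lemma subst_htpy: "subst s (htpy A B f g) = htpy (subst s A) (subst (up s) B) (subst s f) (subst s g)"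
  by (simp add: htpy_def subst_nf)

lemma subst_htpy_sing: "subst s (htpy_sing A B h) = htpy_sing (subst s A) (subst (up s) B) (subst s h)"
  by (simp add: htpy_sing_def subst_htpy subst_nf)

lemma isT_htpy: "has \<Gamma> f (Pi A B) \<Longrightarrow> has \<Gamma> g (Pi A B) \<Longrightarrow> isT \<Gamma> (htpy A B f g)"
  unfolding htpy_def by (intro isT_Pi isT_Eq has_app0)

lemma has_wk_Pi: "has \<Gamma> f (Pi A B) \<Longrightarrow> isT \<Gamma> X \<Longrightarrow> has (X # \<Gamma>) (wk f) (Pi (wk A) (subst (up (\<lambda>n. Var (Suc n))) B))"
  by (erule has_wk) auto

lemma isT_htpy_fam:
  assumes f: "has \<Gamma> f (Pi A B)"
  shows "isT (Pi A B # \<Gamma>) (htpy (wk A) (subst (up (\<lambda>n. Var (Suc n))) B) (Var 0) (wk f))"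
    "isT (Pi A B # \<Gamma>) (htpy (wk A) (subst (up (\<lambda>n. Var (Suc n))) B) (wk f) (Var 0))"
  by (intro isT_htpy has_wk_Pi f has_v0 has_isT[OF f]; simp)+

lemma htpy_induction:
  assumes f: "has \<Gamma> f (Pi A B)"
    and C: "isT (htpy (wk A) (subst (up (\<lambda>n. Var (Suc n))) B) (wk f) (Var 0) # Pi A B # \<Gamma>) C"
    and c: "inhab \<Gamma> C0" and C0: "C0 = subst (Lam A (Refl (wk f \<cdot> Var 0)) .: f .: Var) C"
    and g: "has \<Gamma> g (Pi A B)" and h: "has \<Gamma> h (htpy A B f g)"
    and C1: "C1 = subst (h .: g .: Var) C"
  shows "inhab \<Gamma> C1"
proof -
  let ?B = "subst (up (\<lambda>n. Var (Suc n))) B"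
  have F: "isT \<Gamma> (Pi A B)" by (rule has_isT[OF f])
  have f1: "has (Pi A B # \<Gamma>) (wk f) (Pi (wk A) ?B)" by (rule has_wk_Pi[OF f F])
  have v0: "has (Pi A B # \<Gamma>) (Var 0) (Pi (wk A) ?B)" by (rule has_v0[OF F]) simp
  have m: "has (Pi A B # \<Gamma>) (happly (wk A) ?B (wk f) (Var 0))
      (Eq (wk (Pi A B)) (wk f) (Var 0) \<rightharpoonup> htpy (wk A) ?B (wk f) (Var 0))"
    using has_happly[OF f1 v0] by (simp add: htpy_def)
  have e: "inhab (Pi A B # \<Gamma>) (is_equiv (Eq (wk (Pi A B)) (wk f) (Var 0)) (htpy (wk A) ?B (wk f) (Var 0))
      (happly (wk A) ?B (wk f) (Var 0)))"
    using inhab_funext_equiv[OF f1 v0] by (simp add: htpy_def)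
  have r0: "peq \<Gamma> (htpy A B f f) (subst (f .: Var) (happly (wk A) ?B (wk f) (Var 0)) \<cdot> Refl f)
      (Lam A (Refl (wk f \<cdot> Var 0)))"
    using ceq_peq[OF happly_Refl[OF f f]] by (simp add: subst_notions htpy_def subst_nf)
  show ?thesis
    by (rule identity_system_induction[OF f m e r0 _ C c C0 g h _ C1]) (simp_all add: subst_htpy subst_nf)
qed

lemma has_htpy_sing:
  assumes f: "has \<Gamma> f (Pi A B)" and g: "has \<Gamma> g (Pi A B)" and h: "has \<Gamma> h (htpy A B g f)"
  shows "has \<Gamma> (Tup g h) (htpy_sing A B f)"
  unfolding htpy_sing_def
  by (rule has_Tup[OF g h _ isT_htpy_fam(1)[OF f]]) (simp add: subst_htpy subst_nf)

lemma has_htpy_refl: "has \<Gamma> f (Pi A B) \<Longrightarrow> has \<Gamma> (Lam A (Refl (wk f \<cdot> Var 0))) (htpy A B f f)"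
  unfolding htpy_def by (intro has_Lam has_Refl has_app0)

abbreviation (input) "htpy_centre A f \<equiv> Tup f (Lam A (Refl (wk f \<cdot> Var 0)))"

text \<open>
  The homotopy \<open>h : g \<sim> f\<close> is contracted by varying its right end: the induction has base \<open>g\<close> and
  the motive compares the centre at the moving end with \<open>(g, h)\<close>.
\<close>

lemma htpy_sing_contr_pair:
  assumes f: "has \<Gamma> f (Pi A B)" and g: "has \<Gamma> g (Pi A B)" and h: "has \<Gamma> h (htpy A B g f)"
  shows "peq \<Gamma> (htpy_sing A B f) (htpy_centre A f) (Tup g h)"
proof -
  let ?B = "subst (up (\<lambda>n. Var (Suc n))) B" and ?B2 = "subst (up (\<lambda>n. Var (Suc (Suc n)))) B"
  let ?D = "htpy (wk A) ?B (wk g) (Var 0) # Pi A B # \<Gamma>"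
  let ?C = "Eq (htpy_sing (wk2 A) ?B2 (Var (Suc 0))) (htpy_centre (wk2 A) (Var (Suc 0))) (Tup (wk2 g) (Var 0))"
  have R: "isT (Pi A B # \<Gamma>) (htpy (wk A) ?B (wk g) (Var 0))" by (rule isT_htpy_fam[OF g])
  have v1: "has ?D (Var (Suc 0)) (Pi (wk2 A) ?B2)" by (rule has_v1[OF R]) simp
  have g2: "has ?D (wk2 g) (Pi (wk2 A) ?B2)" by (rule has_subst_Pi[OF g wf_subst_k(2)[OF isT_ctx(1)[OF R]]])
  have v0: "has ?D (Var 0) (htpy (wk2 A) ?B2 (wk2 g) (Var (Suc 0)))"
    by (rule has_v0[OF R]) (simp add: subst_htpy subst_nf)
  have C: "isT ?D ?C"
    by (rule isT_Eq[OF has_htpy_sing[OF v1 v1 has_htpy_refl[OF v1]] has_htpy_sing[OF v1 g2 v0]])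
  show ?thesis
    by (rule htpy_induction[OF g C peq_refl[OF has_htpy_sing[OF g g has_htpy_refl[OF g]]] _ f h])
      (simp_all add: subst_htpy_sing subst_nf)
qed

lemma htpy_sing_contr:
  assumes f: "has \<Gamma> f (Pi A B)"
  shows "peq (htpy_sing A B f # \<Gamma>) (wk (htpy_sing A B f)) (wk (htpy_centre A f)) (Var 0)"
proof -
  let ?B = "subst (up (\<lambda>n. Var (Suc n))) B" and ?B2 = "subst (up (\<lambda>n. Var (Suc (Suc n)))) B"
  let ?H = "htpy (wk A) ?B (Var 0) (wk f)"
  have H: "isT (Pi A B # \<Gamma>) ?H" by (rule isT_htpy_fam[OF f])
  note c = has_htpy_sing[OF f f has_htpy_refl[OF f]]
  have S: "isT \<Gamma> (htpy_sing A B f)" by (rule has_isT[OF c])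
  have C: "isT (htpy_sing A B f # \<Gamma>) (Eq (wk (htpy_sing A B f)) (wk (htpy_centre A f)) (Var 0))"
    by (rule isT_Eq[OF has_wk[OF c S refl refl] has_v0[OF S refl]])
  let ?D = "?H # Pi A B # \<Gamma>"
  have f2: "has ?D (wk2 f) (Pi (wk2 A) ?B2)" by (rule has_subst_Pi[OF f wf_subst_k(2)[OF isT_ctx(1)[OF H]]])
  have v1: "has ?D (Var (Suc 0)) (Pi (wk2 A) ?B2)" by (rule has_v1[OF H]) simp
  have v0: "has ?D (Var 0) (htpy (wk2 A) ?B2 (Var (Suc 0)) (wk2 f))"
    by (rule has_v0[OF H]) (simp add: subst_htpy subst_nf)
  from sig_elim[OF C[unfolded htpy_sing_def[of A B f]] htpy_sing_contr_pair[OF f2 v1 v0]]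
  show ?thesis by (simp add: subst_htpy_sing[unfolded htpy_sing_def] htpy_sing_def subst_htpy subst_nf)
qed

section \<open>Congruence rules for conversion\<close>

lemma subst_wk: "subst (a .: Var) (wk t) = t"
  by (simp add: subst_nf)

lemma ceq_App_fn:
  assumes f: "ceq \<Gamma> f f' (A \<rightharpoonup> B)" and a: "ceq \<Gamma> a a' A" and B: "isT \<Gamma> B"
  shows "ceq \<Gamma> (f \<cdot> a) (f' \<cdot> a') B"
proof -
  have A: "isT \<Gamma> A" using a by (auto simp: ceq_def has_def)
  obtain i where i: "\<Gamma> \<turnstile> A \<Ztypecolon> Univ i" "A # \<Gamma> \<turnstile> wk B \<Ztypecolon> Univ i"
    using common_universe[OF A isT_wk[OF B A refl]] .
  have "\<Gamma> \<turnstile> f \<cdot> a \<doteq> f' \<cdot> a' \<Ztypecolon> B"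
    using eq_app[OF i, of f f' a a'] f a by (simp add: ceq_def subst_nf)
  then show ?thesis using f a by (auto simp: ceq_def intro: has_App_fn)
qed

lemma ceq_Pi: "has \<Gamma> A (Univ i) \<Longrightarrow> ceq (A # \<Gamma>) B B' (Univ i) \<Longrightarrow> ceq \<Gamma> (Pi A B) (Pi A B') (Univ i)"
  by (auto simp: ceq_def has_ty intro: has_Pi_U eq_pi[OF _ eq_refl])

lemma ceq_Sig: 
  assumes A: "ceq \<Gamma> A A' (Univ i)" and B: "ceq (A # \<Gamma>) B B' (Univ i)" and B': "has (A' # \<Gamma>) B' (Univ i)"
  shows "ceq \<Gamma> (Sig A B) (Sig A' B') (Univ i)"
  using assms by (auto simp: ceq_def has_ty intro: has_Sig_U eq_sig)

section \<open>Univalence\<close>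

lemma equiv_type_nf: "A \<simeq>\<^sub>t B = Sig (A \<rightharpoonup> B) (is_equiv (wk A) (wk B) (Var 0))"
  by (simp add: equiv_type_def subst_nf)

lemma has_equiv_fam:
  assumes A: "has \<Gamma> A (Univ i)" and B: "has \<Gamma> B (Univ i)"
  shows "has ((A \<rightharpoonup> B) # \<Gamma>) (is_equiv (wk A) (wk B) (Var 0)) (Univ i)"
proof -
  have F: "isT \<Gamma> (A \<rightharpoonup> B)" by (rule isT_has[OF has_fn_U[OF A B]])
  show ?thesis
    by (rule has_is_equiv[OF has_wk[OF A F refl] has_wk[OF B F refl] has_v0[OF F]]) (simp_all add: subst_nf)
qed

lemma has_equiv_type: "has \<Gamma> A (Univ i) \<Longrightarrow> has \<Gamma> B (Univ i) \<Longrightarrow> has \<Gamma> (A \<simeq>\<^sub>t B) (Univ i)"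
  unfolding equiv_type_nf by (intro has_Sig_U has_fn_U has_equiv_fam)

lemma ceq_idfun: "has \<Gamma> a A \<Longrightarrow> ceq \<Gamma> (idfun A \<cdot> a) a A"
  unfolding idfun_def by (rule ceq_beta[OF has_v0[OF has_isT refl]]) (auto simp: subst_nf)

lemma has_idfun: "isT \<Gamma> A \<Longrightarrow> has \<Gamma> (idfun A) (A \<rightharpoonup> A)"
  unfolding idfun_def by (rule has_Lam[OF has_v0[OF _ refl]])

abbreviation (input) "id_inverse A \<equiv> Tup (idfun A) (Lam A (Refl (Var 0)))"

lemma has_id_is_equiv:
  assumes A: "has \<Gamma> A (Univ i)"
  shows "has \<Gamma> (Tup (id_inverse A) (id_inverse A)) (is_equiv A A (idfun A))"
proof -
  have A': "isT \<Gamma> A" by (rule isT_has[OF A])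
  note I = has_idfun[OF A']
  have x: "has (A # \<Gamma>) (Var 0) (wk A)" by (rule has_v0[OF A' refl])
  have I1: "has (A # \<Gamma>) (idfun (wk A)) (wk A \<rightharpoonup> wk A)" by (rule has_idfun[OF has_isT[OF x]])
  have "ceq (A # \<Gamma>) (idfun (wk A) \<cdot> (idfun (wk A) \<cdot> Var 0)) (Var 0) (wk A)"
    by (rule ceq_trans[OF ceq_idfun[OF has_App_fn[OF I1 x]] ceq_idfun[OF x]])
  from ceq_Eq[OF ceq_refl ceq_sym[OF this] ceq_refl[OF x]] has_wk[OF A A' refl]
  have "ceq (A # \<Gamma>) (Eq (wk A) (Var 0) (Var 0)) (Eq (wk A) (idfun (wk A) \<cdot> (idfun (wk A) \<cdot> Var 0)) (Var 0)) (Univ i)"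
    by simp
  from has_Lam[OF has_conv[OF has_Refl[OF x] this]]
  have H: "has \<Gamma> (Lam A (Refl (Var 0))) (Pi A (Eq (wk A) (idfun (wk A) \<cdot> (idfun (wk A) \<cdot> Var 0)) (Var 0)))" .
  have r: "has \<Gamma> (Tup (idfun A) (Lam A (Refl (Var 0)))) (rinvT A A (idfun A))"
    by (rule has_Tup[OF I H _ isT_SigD[OF isT_has[OF has_rinvT[OF A A I]]]]) (simp add: subst_nf)
  have l: "has \<Gamma> (Tup (idfun A) (Lam A (Refl (Var 0)))) (linvT A A (idfun A))"
    by (rule has_Tup[OF I H _ isT_SigD[OF isT_has[OF has_linvT[OF A A I]]]]) (simp add: subst_nf)
  show ?thesis
    unfolding is_equiv_nf
    by (rule has_Tup[OF r l subst_wk[symmetric] isT_wk[OF has_isT[OF l] has_isT[OF r] refl]])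
qed

lemma has_id_equiv:
  assumes A: "has \<Gamma> A (Univ i)" shows "has \<Gamma> (id_equiv A) (A \<simeq>\<^sub>t A)"
  unfolding id_equiv_def equiv_type_nf
  by (rule has_Tup[OF has_idfun[OF isT_has[OF A]] has_id_is_equiv[OF A] _ isT_has[OF has_equiv_fam[OF A A]]])
    (simp add: subst_notions subst_nf)

text \<open>
  As for \<open>happly\<close>: the map in the univalence axiom is well-typed and sends reflexivity to the
  identity equivalence.
\<close>

lemma id_to_equiv_facts:
  assumes X: "has \<Gamma> X (Univ i)" and Y: "has \<Gamma> Y (Univ i)"
  shows has_id_to_equiv: "has \<Gamma> (id_to_equiv i X Y) (Eq (Univ i) X Y \<rightharpoonup> (X \<simeq>\<^sub>t Y))"
    and id_to_equiv_Refl: "ceq \<Gamma> (id_to_equiv i X X \<cdot> Refl X) (id_equiv X) (X \<simeq>\<^sub>t X)"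
proof -
  let ?k3 = "\<lambda>n. Var (Suc (Suc (Suc n)))"
  let ?C = "subst ?k3 X \<simeq>\<^sub>t Var (Suc 0)"
  let ?E = "\<lambda>X. Eq (Univ i) (wk X) (Var 0)"
  have E: "isT (Univ i # \<Gamma>) (?E X)" if X: "has \<Gamma> X (Univ i)" for X \<Gamma>
  proof -
    have U: "isT \<Gamma> (Univ i)" by (rule has_isT[OF X])
    show ?thesis by (rule isT_Eq[OF has_wk[OF X U refl] has_v0[OF U]]) simp_all
  qed
  have C: "isT (?E (wk X) # Univ i # Z # \<Gamma>) ?C" if Z: "isT \<Gamma> Z" for Z
  proof -
    have X1: "has (Z # \<Gamma>) (wk X) (Univ i)" by (rule has_wk[OF X Z refl]) simp
    show ?thesis
      by (rule isT_has[OF has_equiv_type[OF has_subst[OF X wf_subst_k(3)[OF isT_ctx(1)[OF E[OF X1]]] refl] has_v1[OF E[OF X1]]]])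
        simp_all
  qed
  let ?I = "\<lambda>p. IndEq ?C (id_equiv (wk X)) p"
  have h: "id_to_equiv i X Y = Lam (Eq (Univ i) X Y) (?I (Var 0))" for Y
    by (simp add: id_to_equiv_def subst_nf equiv_type_nf)
  have c: "has (Z # \<Gamma>) (id_equiv (wk X)) (wk X \<simeq>\<^sub>t wk X)" if Z: "isT \<Gamma> Z" for Z
    by (rule has_id_equiv[OF has_wk[OF X Z refl]]) simp
  have I: "has (Eq (Univ i) X Y # \<Gamma>) (?I (Var 0)) (wk (X \<simeq>\<^sub>t Y))" if Y: "has \<Gamma> Y (Univ i)" for Y
  proof -
    have P: "isT \<Gamma> (Eq (Univ i) X Y)" by (rule isT_Eq[OF X Y])
    show ?thesis
      by (rule path_rec[OF has_v0[OF P, of "Eq (Univ i) (wk X) (wk Y)"] _ c[OF P]])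
        (use C[OF P] in \<open>simp_all add: subst_notions subst_nf\<close>)
  qed
  from has_Lam[OF I[OF Y]] show "has \<Gamma> (id_to_equiv i X Y) (Eq (Univ i) X Y \<rightharpoonup> (X \<simeq>\<^sub>t Y))"
    by (simp add: h)
  have P: "isT \<Gamma> (Eq (Univ i) X X)" by (rule isT_Eq[OF X X])
  show "ceq \<Gamma> (id_to_equiv i X X \<cdot> Refl X) (id_equiv X) (X \<simeq>\<^sub>t X)"
    unfolding h
  proof (rule ceq_trans[OF ceq_beta[OF I[OF X] has_Refl[OF X] refl]])
    have C': "isT (?E X # Univ i # \<Gamma>) (wk2 X \<simeq>\<^sub>t Var (Suc 0))"
      by (rule isT_has[OF has_equiv_type[OF has_subst[OF X wf_subst_k(2)[OF isT_ctx(1)[OF E[OF X]]] refl] has_v1[OF E[OF X]]]])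
        simp_all
    have "ceq \<Gamma> (IndEq (wk2 X \<simeq>\<^sub>t Var (Suc 0)) (id_equiv X) (Refl X)) (id_equiv X) (X \<simeq>\<^sub>t X)"
      by (rule ceq_path_rec[OF X _ has_id_equiv[OF X]]) (use C' in \<open>simp_all add: subst_notions subst_nf\<close>)
    then show "ceq \<Gamma> (subst (Refl X .: Var) (?I (Var 0))) (id_equiv X) (X \<simeq>\<^sub>t X)"
      by (simp add: subst_notions subst_nf)
  qed (simp add: subst_nf)
qed

text \<open>
  Univalence makes equivalences out of \<open>X\<close> an identity system on the universe.
\<close>

lemma univalence_induction:
  assumes X: "has \<Gamma> X (Univ i)"
    and C: "isT ((wk X \<simeq>\<^sub>t Var 0) # Univ i # \<Gamma>) C"
    and c: "inhab \<Gamma> C0" and C0: "C0 = subst (id_equiv X .: X .: Var) C"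
    and Y: "has \<Gamma> Y (Univ i)" and e: "has \<Gamma> e (X \<simeq>\<^sub>t Y)"
    and C1: "C1 = subst (e .: Y .: Var) C"
  shows "inhab \<Gamma> C1"
proof -
  have U: "isT \<Gamma> (Univ i)" by (rule has_isT[OF X])
  have X1: "has (Univ i # \<Gamma>) (wk X) (Univ i)" by (rule has_wk[OF X U refl]) simp
  have v0: "has (Univ i # \<Gamma>) (Var 0) (Univ i)" by (rule has_v0[OF U]) simp
  note m = has_id_to_equiv[OF X1 v0]
  have u: "inhab (Univ i # \<Gamma>) (is_equiv (Eq (Univ i) (wk X) (Var 0)) (wk X \<simeq>\<^sub>t Var 0) (id_to_equiv i (wk X) (Var 0)))"
    using ty_ua[OF has_ty[OF X1] has_ty[OF v0]] isT_is_equiv[OF m isT_has[OF has_equiv_type[OF X1 v0]]]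
    by (auto simp: has_def intro!: inhabI)
  have r0: "peq \<Gamma> (X \<simeq>\<^sub>t X) (subst (X .: Var) (id_to_equiv i (wk X) (Var 0)) \<cdot> Refl X) (id_equiv X)"
    using ceq_peq[OF id_to_equiv_Refl[OF X X]] by (simp add: subst_notions subst_nf)
  show ?thesis
    by (rule identity_system_induction[OF X _ _ r0 _ C c C0 Y e _ C1])
      (use m u in \<open>simp_all add: subst_notions subst_subst subst_Var\<close>)
qed

section \<open>Being an equivalence is a proposition\<close>

lemma is_prop_nf: "is_prop A = Pi A (Pi (wk A) (Eq (wk2 A) (Var (Suc 0)) (Var 0)))"
  by (simp add: is_prop_def subst_nf)

lemma subst_is_prop: "subst s (is_prop A) = is_prop (subst s A)"
  by (simp add: is_prop_nf subst_nf)

lemma inhab_is_prop: "inhab \<Gamma> (is_prop A) \<longleftrightarrow> peq (wk A # A # \<Gamma>) (wk2 A) (Var (Suc 0)) (Var 0)"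
  by (simp add: is_prop_nf inhab_Pi)

lemma isT_is_prop: assumes A: "isT \<Gamma> A" shows "isT \<Gamma> (is_prop A)"
proof -
  have A1: "isT (A # \<Gamma>) (wk A)" by (rule isT_wk[OF A A refl])
  show ?thesis unfolding is_prop_nf
    by (intro isT_Pi isT_Eq has_v1[OF A1 refl] has_v0[OF A1]) (simp add: subst_nf)
qed

lemma contr_is_prop:
  assumes c: "has \<Gamma> c A" and p: "peq (A # \<Gamma>) (wk A) (wk c) (Var 0)"
  shows "inhab \<Gamma> (is_prop A)"
proof -
  have A: "isT \<Gamma> A" by (rule has_isT[OF c])
  have A1: "isT (A # \<Gamma>) (wk A)" by (rule isT_wk[OF A A refl])
  have "peq (wk A # A # \<Gamma>) (wk2 A) (wk2 c) (Var (Suc 0))"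
    by (rule inhab_wk[OF p A1]) (simp add: subst_nf)
  moreover have "peq (wk A # A # \<Gamma>) (wk2 A) (wk2 c) (Var 0)"
    by (rule inhab_subst[OF p wf_subst_Cons[OF wf_subst_k(2)[OF isT_ctx(1)[OF A1]] has_v0[OF A1 refl]]]) (simp_all add: subst_nf)
  ultimately show ?thesis unfolding inhab_is_prop by (rule peq_trans[OF peq_sym])
qed

lemma peq_pair:
  assumes a: "peq \<Gamma> A a a'" and b: "peq \<Gamma> B b b'"
  shows "peq \<Gamma> (Sig A (wk B)) (Tup a b) (Tup a' b')"
proof -
  have A: "isT \<Gamma> A" and B: "isT \<Gamma> B" using a b by (auto dest: peqD has_isT)
  have w: "wk (Sig A (wk B)) = Sig (wk A) (wk (wk B))" by (simp add: subst_nf)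
  have "has (A # \<Gamma>) (Tup (Var 0) (wk b)) (wk (Sig A (wk B)))" unfolding w
    by (rule has_Tup[OF has_v0[OF A refl] has_wk[OF peqD(1)[OF b] A refl refl] _
          isT_wk[OF isT_wk[OF B A refl] isT_wk[OF A A refl] refl]]) (simp add: subst_nf)
  from peq_cong[OF a this refl refl]
  have 1: "peq \<Gamma> (Sig A (wk B)) (Tup a b) (Tup a' b)" by (simp add: subst_nf)
  have "has (B # \<Gamma>) (Tup (wk a') (Var 0)) (wk (Sig A (wk B)))" unfolding w
    by (rule has_Tup[OF has_wk[OF peqD(2)[OF a] B refl refl] has_v0[OF B refl] _
          isT_wk[OF isT_wk[OF B B refl] isT_wk[OF A B refl] refl]]) (simp add: subst_nf)
  from peq_cong[OF b this refl refl]
  have 2: "peq \<Gamma> (Sig A (wk B)) (Tup a' b) (Tup a' b')" by (simp add: subst_nf)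
  from 1 2 show ?thesis by (rule peq_trans)
qed

lemma contr_times:
  assumes c: "has \<Gamma> c A" and p: "peq (A # \<Gamma>) (wk A) (wk c) (Var 0)"
    and d: "has \<Gamma> d B" and q: "peq (B # \<Gamma>) (wk B) (wk d) (Var 0)"
  shows "inhab \<Gamma> (is_prop (Sig A (wk B)))"
proof -
  let ?S = "Sig A (wk B)"
  have A: "isT \<Gamma> A" and B: "isT \<Gamma> B" using c d by (auto dest: has_isT)
  have B1: "isT (A # \<Gamma>) (wk B)" by (rule isT_wk[OF B A refl])
  have cd: "has \<Gamma> (Tup c d) ?S" by (rule has_Tup[OF c d _ B1]) (simp add: subst_nf)
  have S: "isT \<Gamma> ?S" by (rule has_isT[OF cd])
  have C: "isT (?S # \<Gamma>) (Eq (wk ?S) (wk (Tup c d)) (Var 0))"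
    by (rule isT_Eq[OF has_wk[OF cd S refl refl] has_v0[OF S refl]])
  have p': "peq (wk B # A # \<Gamma>) (wk2 A) (wk2 c) (Var (Suc 0))" by (rule inhab_wk[OF p B1]) (simp add: subst_nf)
  have q': "peq (wk B # A # \<Gamma>) (wk2 B) (wk2 d) (Var 0)"
    by (rule inhab_subst[OF q wf_subst_Cons[OF wf_subst_k(2)[OF isT_ctx(1)[OF B1]] has_v0[OF B1 refl]]]) (simp_all add: subst_nf)
  have "peq (?S # \<Gamma>) (wk ?S) (wk (Tup c d)) (Var 0)"
    by (rule sig_elim[OF C peq_pair[OF p' q']]) (simp add: subst_nf)
  with cd show ?thesis by (rule contr_is_prop)
qed

text \<open>
  After reducing the identity function, a right inverse \<open>g\<close> comes with a homotopy \<open>g x = x\<close>, and so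
  does a left inverse. Expanding \<open>x\<close> on the right-hand side turns both types into the functions
  homotopic to the identity.
\<close>

lemma ceq_is_equiv_idfun:
  assumes X: "has \<Gamma> X (Univ i)"
  shows "ceq \<Gamma> (is_equiv X X (idfun X)) (Sig (htpy_sing X (wk X) (idfun X)) (wk (htpy_sing X (wk X) (idfun X)))) (Univ i)"
proof -
  have X': "isT \<Gamma> X" by (rule isT_has[OF X])
  note I = has_idfun[OF X']
  have F: "has \<Gamma> (X \<rightharpoonup> X) (Univ i)" by (rule has_fn_U[OF X X])
  have F': "isT \<Gamma> (X \<rightharpoonup> X)" by (rule isT_has[OF F])
  have X1: "has ((X \<rightharpoonup> X) # \<Gamma>) (wk X) (Univ i)" by (rule has_wk[OF X F' refl]) simp
  have X1': "isT ((X \<rightharpoonup> X) # \<Gamma>) (wk X)" by (rule isT_has[OF X1])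
  let ?D = "wk X # (X \<rightharpoonup> X) # \<Gamma>"
  have X2: "has ?D (wk2 X) (Univ i)" by (rule has_subst[OF X wf_subst_k(2)[OF isT_ctx(1)[OF X1']] refl]) simp
  have v0: "has ?D (Var 0) (wk2 X)" by (rule has_v0[OF X1']) (simp add: subst_nf)
  have v1: "has ?D (Var (Suc 0)) (wk2 X \<rightharpoonup> wk2 X)" by (rule has_v1[OF X1']) (simp add: subst_nf)
  have v10: "has ?D (Var (Suc 0) \<cdot> Var 0) (wk2 X)" by (rule has_App_fn[OF v1 v0])
  let ?W = "htpy_sing X (wk X) (idfun X)"
  have W: "?W = Sig (X \<rightharpoonup> X) (Pi (wk X) (Eq (wk2 X) (Var (Suc 0) \<cdot> Var 0) (wk2 (idfun X) \<cdot> Var 0)))"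
    by (simp add: htpy_sing_def htpy_def subst_nf)
  have r: "ceq \<Gamma> (rinvT X X (idfun X)) ?W (Univ i)" unfolding W
  proof (intro ceq_Sig ceq_refl[OF F] ceq_Pi X1)
    show "ceq ?D (Eq (wk2 X) (wk2 (idfun X) \<cdot> (Var (Suc 0) \<cdot> Var 0)) (Var 0))
      (Eq (wk2 X) (Var (Suc 0) \<cdot> Var 0) (wk2 (idfun X) \<cdot> Var 0)) (Univ i)"
      unfolding subst_notions
      by (rule ceq_Eq[OF ceq_refl[OF X2] ceq_idfun[OF v10] ceq_sym[OF ceq_idfun[OF v0]]])
    then show "has ((X \<rightharpoonup> X) # \<Gamma>) (Pi (wk X) (Eq (wk2 X) (Var (Suc 0) \<cdot> Var 0) (wk2 (idfun X) \<cdot> Var 0))) (Univ i)"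
      by (intro has_Pi_U X1) (simp add: ceq_def)
  qed
  have l: "ceq \<Gamma> (linvT X X (idfun X)) ?W (Univ i)" unfolding W
  proof (intro ceq_Sig ceq_refl[OF F] ceq_Pi X1)
    show "ceq ?D (Eq (wk2 X) (Var (Suc 0) \<cdot> (wk2 (idfun X) \<cdot> Var 0)) (Var 0))
      (Eq (wk2 X) (Var (Suc 0) \<cdot> Var 0) (wk2 (idfun X) \<cdot> Var 0)) (Univ i)"
      unfolding subst_notions
      by (rule ceq_Eq[OF ceq_refl[OF X2] ceq_App_fn[OF ceq_refl[OF v1] ceq_idfun[OF v0] isT_has[OF X2]]
            ceq_sym[OF ceq_idfun[OF v0]]])
    then show "has ((X \<rightharpoonup> X) # \<Gamma>) (Pi (wk X) (Eq (wk2 X) (Var (Suc 0) \<cdot> Var 0) (wk2 (idfun X) \<cdot> Var 0))) (Univ i)"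
      by (intro has_Pi_U X1) (simp add: ceq_def)
  qed
  have R: "isT \<Gamma> (rinvT X X (idfun X))" and W': "has \<Gamma> ?W (Univ i)" "isT \<Gamma> ?W"
    using r by (auto simp: ceq_def intro: isT_has)
  show ?thesis unfolding is_equiv_nf
    by (rule ceq_Sig[OF r ceq_subst[OF l wf_subst_k(1)[OF isT_ctx(1)[OF R]] refl refl] has_wk[OF W'(1,2) refl]]) simp_all
qed

text \<open>
  A proof that \<open>f\<close> is an equivalence allows induction on it, with the identity function as base
  case. The motive recovers the underlying function by the first projection, so \<open>f\<close> itself is
  reached only up to a propositional equality.
\<close>

lemma is_prop_is_equiv_if_equiv:
  assumes X: "has \<Gamma> X (Univ i)" and Y: "has \<Gamma> Y (Univ i)" and f: "has \<Gamma> f (X \<rightharpoonup> Y)"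
    and e: "inhab \<Gamma> (is_equiv X Y f)"
  shows "inhab \<Gamma> (is_prop (is_equiv X Y f))"
proof -
  have tr: "inhab \<Gamma> (is_prop (is_equiv X Z b))"
    if Z: "has \<Gamma> Z (Univ i)" and p: "peq \<Gamma> (X \<rightharpoonup> Z) a b" and i: "inhab \<Gamma> (is_prop (is_equiv X Z a))" for a b Z
    by (rule transport[OF p isT_is_prop[OF isT_has[OF has_equiv_fam[OF X Z]]] i])
      (simp_all add: subst_is_prop subst_notions subst_subst subst_Var)
  have U: "isT \<Gamma> (Univ i)" by (rule has_isT[OF X])
  have X1: "has (Univ i # \<Gamma>) (wk X) (Univ i)" by (rule has_wk[OF X U refl]) simp
  have v0: "has (Univ i # \<Gamma>) (Var 0) (Univ i)" by (rule has_v0[OF U]) simp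
  have R: "isT (Univ i # \<Gamma>) (wk X \<simeq>\<^sub>t Var 0)" by (rule isT_has[OF has_equiv_type[OF X1 v0]])
  let ?D = "(wk X \<simeq>\<^sub>t Var 0) # Univ i # \<Gamma>"
  have X2: "has ?D (wk2 X) (Univ i)" by (rule has_subst[OF X wf_subst_k(2)[OF isT_ctx(1)[OF R]] refl]) simp
  have Y2: "has ?D (Var (Suc 0)) (Univ i)" by (rule has_v1[OF R]) simp
  have w: "has ?D (Var 0) (wk2 X \<simeq>\<^sub>t Var (Suc 0))" by (rule has_v0[OF R]) (simp add: subst_notions subst_nf)
  let ?C = "is_prop (is_equiv (wk2 X) (Var (Suc 0)) (Fst (wk2 X \<rightharpoonup> Var (Suc 0)) (Var 0)))"
  have C: "isT ?D ?C"
    by (rule isT_is_prop[OF isT_has[OF has_is_equiv[OF X2 Y2 has_Fst[OF w[unfolded equiv_type_nf[of "wk2 X"]]]]]])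
  note I = has_idfun[OF isT_has[OF X]]
  note W = has_htpy_sing[OF I I has_htpy_refl[OF I]] htpy_sing_contr[OF I]
  let ?W = "Sig (htpy_sing X (wk X) (idfun X)) (wk (htpy_sing X (wk X) (idfun X)))"
  have "inhab \<Gamma> (is_prop ?W)" by (rule contr_times[OF W W])
  then have "inhab \<Gamma> (is_prop (is_equiv X X (idfun X)))"
    by (rule transport[OF ceq_peq[OF ceq_sym[OF ceq_is_equiv_idfun[OF X]]] isT_is_prop[OF isT_has[OF v0]]])
      (simp_all add: subst_is_prop)
  moreover have fst: "ceq \<Gamma> (Fst (X \<rightharpoonup> Z) (Tup g d)) g (X \<rightharpoonup> Z)"
    if Z: "has \<Gamma> Z (Univ i)" and g: "has \<Gamma> g (X \<rightharpoonup> Z)" and d: "has \<Gamma> d (is_equiv X Z g)" for Z g d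
    by (rule ceq_Fst[OF g d _ isT_has[OF has_equiv_fam[OF X Z]]])
      (simp add: subst_notions subst_subst subst_Var)
  ultimately have base: "inhab \<Gamma> (is_prop (is_equiv X X (Fst (X \<rightharpoonup> X) (id_equiv X))))"
    unfolding id_equiv_def by (intro tr[OF X peq_sym[OF ceq_peq[OF fst[OF X I has_id_is_equiv[OF X]]]]])
  obtain d where d: "has \<Gamma> d (is_equiv X Y f)" using e by (auto simp: inhab_def)
  have e': "has \<Gamma> (Tup f d) (X \<simeq>\<^sub>t Y)" unfolding equiv_type_nf
    by (rule has_Tup[OF f d _ isT_has[OF has_equiv_fam[OF X Y]]]) (simp add: subst_notions subst_subst subst_Var)
  have "inhab \<Gamma> (is_prop (is_equiv X Y (Fst (X \<rightharpoonup> Y) (Tup f d))))"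
    by (rule univalence_induction[OF X C base _ Y e'])
      (simp_all add: subst_is_prop subst_notions subst_nf)
  then show ?thesis by (rule tr[OF Y ceq_peq[OF fst[OF Y f d]]])
qed

text \<open>
  To compare two elements of a type, an element of it may be assumed.
\<close>

lemma is_prop_is_equiv:
  assumes X: "has \<Gamma> X (Univ i)" and Y: "has \<Gamma> Y (Univ i)" and f: "has \<Gamma> f (X \<rightharpoonup> Y)"
  shows "inhab \<Gamma> (is_prop (is_equiv X Y f))"
proof -
  let ?E = "is_equiv X Y f"
  have E: "isT \<Gamma> ?E" by (rule isT_has[OF has_is_equiv[OF X Y f]])
  have v: "has (?E # \<Gamma>) (Var 0) (wk ?E)" by (rule has_v0[OF E refl])
  have "inhab (?E # \<Gamma>) (is_prop (is_equiv (wk X) (wk Y) (wk f)))"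
    by (rule is_prop_is_equiv_if_equiv[OF has_wk[OF X E refl] has_wk[OF Y E refl] has_wk[OF f E refl]])
      (use inhabI[OF v] in \<open>simp_all add: subst_notions subst_nf\<close>)
  then have "inhab (?E # \<Gamma>) (is_prop (wk ?E))" by (simp add: subst_notions)
  from inhab_inst[OF this[unfolded is_prop_nf inhab_Pi[of _ "wk ?E"]] v refl]
  show ?thesis by (simp add: is_prop_nf inhab_Pi subst_nf)
qed

section \<open>Computing with functions\<close>

lemma peq_conv: "peq \<Gamma> A a b \<Longrightarrow> ceq \<Gamma> A B (Univ i) \<Longrightarrow> peq \<Gamma> B a b"
  using ceq_Eq[OF _ ceq_refl ceq_refl] by (blast intro: inhab_conv dest: peqD)

lemma peq_happly:
  assumes p: "peq \<Gamma> (Pi A B) f g" shows "peq (A # \<Gamma>) B (wk f \<cdot> Var 0) (wk g \<cdot> Var 0)"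
proof -
  have A: "isT \<Gamma> A" using p by (auto dest: peqD has_isT isT_PiD isT_ctx_head)
  have "peq (A # \<Gamma>) (Pi (wk A) (subst (up (\<lambda>n. Var (Suc n))) B)) (wk f) (wk g)"
    by (rule inhab_wk[OF p A]) simp
  from peq_App[OF this has_v0[OF A refl]] show ?thesis by (simp add: subst_nf)
qed

text \<open>
  Beta reduction for an abstraction that has been moved to another context.
\<close>

lemma peq_beta_subst:
  assumes t: "has (A # \<Gamma>) t B" and s: "wf_subst \<Delta> s \<Gamma>" and a: "has \<Delta> a A'" and A': "A' = subst s A"
    and eq: "f = subst s (Lam A t)" "t' = subst (a .: s) t" "B' = subst (a .: s) B"
  shows "peq \<Delta> B' (f \<cdot> a) t'"
proof -
  have A: "isT \<Gamma> A" using t by (auto dest: has_isT isT_ctx_head)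
  obtain i where "\<Gamma> \<turnstile> A \<Ztypecolon> Univ i" using A by (auto simp: isT_def)
  from typing_subst[OF this s] have "\<Delta> \<turnstile> subst s A \<Ztypecolon> Univ i" by simp
  note t' = has_subst[OF t wf_subst_up[OF s this] refl refl]
  show ?thesis unfolding eq(1) subst.simps(4)
    by (rule peq_beta[OF t' a[unfolded A']]) (simp_all add: subst_nf eq)
qed

lemma peq_Lam_wk: "has (A # \<Gamma>) t B \<Longrightarrow> peq (A # \<Gamma>) B (wk (Lam A t) \<cdot> Var 0) t"
  by (rule peq_beta_subst[OF _ wf_subst_k(1)[OF isT_ctx(1)] has_v0])
    (auto dest: has_isT isT_ctx_head simp: subst_nf)

section \<open>Precomposition\<close>

text \<open>
  The codomain is the family pulled back along \<open>e\<close>, as in the definition of unique elimination.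
\<close>

lemma precomp_facts:
  assumes e: "has \<Gamma> e (A \<rightharpoonup> Y)" and C: "isT (Y # \<Gamma>) C"
  defines "G \<equiv> Pi A (subst (wk e \<cdot> Var 0 .: (\<lambda>n. Var (Suc n))) C)"
  shows has_precomp: "has \<Gamma> (precomp (Pi Y C) A e) (Pi Y C \<rightharpoonup> G)"
    and peq_precomp: "has \<Gamma> f (Pi Y C) \<Longrightarrow> peq (A # \<Gamma>) (subst (wk e \<cdot> Var 0 .: (\<lambda>n. Var (Suc n))) C)
      (wk (precomp (Pi Y C) A e \<cdot> f) \<cdot> Var 0) (wk f \<cdot> (wk e \<cdot> Var 0))"
proof -
  let ?F = "Pi Y C"
  have F: "isT \<Gamma> ?F" by (rule isT_Pi[OF C])
  have A: "isT \<Gamma> A" using e by (auto dest: has_isT isT_PiD isT_ctx_head)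
  have A1: "isT (?F # \<Gamma>) (wk A)" by (rule isT_wk[OF A F refl])
  have e2: "has (wk A # ?F # \<Gamma>) (wk2 e \<cdot> Var 0) (wk2 Y)"
    by (rule has_App[OF has_subst_Pi[OF e wf_subst_k(2)[OF isT_ctx(1)[OF A1]]] has_v0[OF A1]]) (simp_all add: subst_nf)
  have v1: "has (wk A # ?F # \<Gamma>) (Var (Suc 0)) (Pi (wk2 Y) (subst (up (\<lambda>n. Var (Suc (Suc n)))) C))"
    by (rule has_v1[OF A1]) simp
  have "has (wk A # ?F # \<Gamma>) (Var (Suc 0) \<cdot> (wk2 e \<cdot> Var 0)) (subst (wk2 e \<cdot> Var 0 .: (\<lambda>n. Var (Suc (Suc n)))) C)"
    by (rule has_App[OF v1 e2]) (simp add: subst_nf)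
  from has_Lam[OF this]
  have t: "has (?F # \<Gamma>) (Lam (wk A) (Var (Suc 0) \<cdot> (wk2 e \<cdot> Var 0))) (wk G)"
    by (simp add: G_def subst_nf)
  have pc: "precomp ?F A e = Lam ?F (Lam (wk A) (Var (Suc 0) \<cdot> (wk2 e \<cdot> Var 0)))"
    by (simp add: precomp_def subst_nf)
  from has_Lam[OF t] show "has \<Gamma> (precomp ?F A e) (?F \<rightharpoonup> G)" by (simp add: pc)
  assume f: "has \<Gamma> f ?F"
  have ea: "has (A # \<Gamma>) (wk e \<cdot> Var 0) (wk Y)"
    by (rule has_App[OF has_wk_Pi[OF e A] has_v0[OF A refl]]) (simp add: subst_nf)
  have b: "has (A # \<Gamma>) (wk f \<cdot> (wk e \<cdot> Var 0)) (subst (wk e \<cdot> Var 0 .: (\<lambda>n. Var (Suc n))) C)"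
    by (rule has_App[OF has_wk_Pi[OF f A] ea]) (simp add: subst_nf)
  have "peq \<Gamma> G (precomp ?F A e \<cdot> f) (Lam A (wk f \<cdot> (wk e \<cdot> Var 0)))"
    unfolding pc by (rule peq_beta[OF t f]) (simp_all add: subst_nf)
  from peq_trans[OF peq_happly[OF this[unfolded G_def]] peq_Lam_wk[OF b]]
  show "peq (A # \<Gamma>) (subst (wk e \<cdot> Var 0 .: (\<lambda>n. Var (Suc n))) C)
      (wk (precomp (Pi Y C) A e \<cdot> f) \<cdot> Var 0) (wk f \<cdot> (wk e \<cdot> Var 0))" .
qed

section \<open>Uniquely eliminating modalities\<close>

text \<open>
  The data are arbitrary terms over an arbitrary context. The notion is therefore stable under
  substitution, and the results below apply under binders.
\<close>

definition modality :: "nat \<Rightarrow> tm list \<Rightarrow> tm \<Rightarrow> tm \<Rightarrow> bool" where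
  "modality i \<Gamma> Om eta \<longleftrightarrow> has \<Gamma> Om (Univ i \<rightharpoonup> Univ i) \<and> has \<Gamma> eta (unit_type i Om) \<and> inhab \<Gamma> (unique_elim i Om eta)"

lemma subst_unique_elim: "subst s (unit_type i Om) = unit_type i (subst s Om)"
  "subst s (unique_elim i Om eta) = unique_elim i (subst s Om) (subst s eta)"
  by (simp_all add: unit_type_def unique_elim_def is_equiv_nf precomp_def Let_def subst_nf)

lemma subst_modal: "subst s (modal Om eta X) = modal (subst s Om) (subst s eta) (subst s X)"
  by (simp add: modal_def subst_notions)

lemma modality_subst: "modality i \<Gamma> Om eta \<Longrightarrow> wf_subst \<Delta> s \<Gamma> \<Longrightarrow> Om' = subst s Om \<Longrightarrow> eta' = subst s eta \<Longrightarrow> modality i \<Delta> Om' eta'"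
  unfolding modality_def
  by (elim conjE, intro conjI)
    (auto elim: has_subst[OF _ _ _ sym] inhab_subst simp: subst_unique_elim)

lemma modality_wk: "modality i \<Gamma> Om eta \<Longrightarrow> isT \<Gamma> A \<Longrightarrow> modality i (A # \<Gamma>) (wk Om) (wk eta)"
  using modality_subst[OF _ wf_subst_k(1)[OF isT_ctx(1)]] by blast

lemma has_Om: "modality i \<Gamma> Om eta \<Longrightarrow> has \<Gamma> A (Univ i) \<Longrightarrow> has \<Gamma> (Om \<cdot> A) (Univ i)"
  by (rule has_App_fn[of _ _ "Univ i"]) (simp_all add: modality_def)

lemma has_eta:
  assumes u: "modality i \<Gamma> Om eta" and A: "has \<Gamma> A (Univ i)" shows "has \<Gamma> (eta \<cdot> A) (A \<rightharpoonup> Om \<cdot> A)"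
proof -
  have "has \<Gamma> eta (Pi (Univ i) (Var 0 \<rightharpoonup> wk Om \<cdot> Var 0))" using u by (simp add: modality_def unit_type_def subst_nf)
  from has_App[OF this A] show ?thesis by (simp add: subst_nf)
qed

lemma has_unit: "modality i \<Gamma> Om eta \<Longrightarrow> has \<Gamma> A (Univ i) \<Longrightarrow> has \<Gamma> a A \<Longrightarrow> has \<Gamma> (eta \<cdot> A \<cdot> a) (Om \<cdot> A)"
  by (rule has_App_fn[OF has_eta])

text \<open>
  The unit at a fresh variable of \<open>A\<close>, and the pullback along the unit of a family over \<open>Om A\<close>.
\<close>

abbreviation unit_var :: "tm \<Rightarrow> tm \<Rightarrow> tm" where "unit_var eta A \<equiv> wk eta \<cdot> wk A \<cdot> Var 0"
abbreviation at_unit :: "tm \<Rightarrow> tm \<Rightarrow> tm \<Rightarrow> tm" where "at_unit eta A B \<equiv> subst (unit_var eta A .: (\<lambda>n. Var (Suc n))) B"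

lemma has_unit_var: "modality i \<Gamma> Om eta \<Longrightarrow> has \<Gamma> A (Univ i) \<Longrightarrow> has (A # \<Gamma>) (unit_var eta A) (wk Om \<cdot> wk A)"
proof -
  assume u: "modality i \<Gamma> Om eta" and A: "has \<Gamma> A (Univ i)"
  have A': "isT \<Gamma> A" by (rule isT_has[OF A])
  show ?thesis by (rule has_unit[OF modality_wk[OF u A'] has_wk[OF A A' refl] has_v0[OF A' refl]]) simp
qed

lemma wf_subst_unit_var: "modality i \<Gamma> Om eta \<Longrightarrow> has \<Gamma> A (Univ i) \<Longrightarrow>
    wf_subst (A # \<Gamma>) (unit_var eta A .: (\<lambda>n. Var (Suc n))) (Om \<cdot> A # \<Gamma>)"
  by (rule wf_subst_Cons[OF wf_subst_k(1)[OF isT_ctx(1)[OF isT_has]] has_unit_var]) auto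

text \<open>
  The axiom speaks of families \<open>P : Om A \<rightarrow> U\<close>. Taking for \<open>P\<close> the abstraction of an open type \<open>B\<close> gives
  a family \<open>C\<close> of types \<open>Om (P z)\<close> that is convertible, not equal, to \<open>Om B\<close>.
\<close>

lemma unique_elim_equiv:
  assumes u: "modality i \<Gamma> Om eta" and A: "has \<Gamma> A (Univ i)" and B: "has (Om \<cdot> A # \<Gamma>) B (Univ i)"
  obtains C where "isT (Om \<cdot> A # \<Gamma>) C"
    "ceq \<Gamma> (Pi (Om \<cdot> A) C) (Pi (Om \<cdot> A) (wk Om \<cdot> B)) (Univ i)"
    "ceq (A # \<Gamma>) (at_unit eta A C) (wk Om \<cdot> at_unit eta A B) (Univ i)"
    "inhab \<Gamma> (is_equiv (Pi (Om \<cdot> A) C) (Pi A (at_unit eta A C)) (precomp (Pi (Om \<cdot> A) C) A (eta \<cdot> A)))"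
proof -
  let ?P = "Lam (Om \<cdot> A) B"
  let ?C = "wk Om \<cdot> (wk ?P \<cdot> Var 0)"
  have A': "isT \<Gamma> A" by (rule isT_has[OF A])
  have O: "has \<Gamma> (Om \<cdot> A) (Univ i)" by (rule has_Om[OF u A])
  have O': "isT \<Gamma> (Om \<cdot> A)" by (rule isT_has[OF O])
  have P: "has \<Gamma> ?P (Om \<cdot> A \<rightharpoonup> Univ i)" using has_Lam[OF B] by simp
  have "has \<Gamma> Om (Univ i \<rightharpoonup> Univ i)" using u by (simp add: modality_def)
  from has_wk[OF this O' refl] have Om1: "has (Om \<cdot> A # \<Gamma>) (wk Om) (Univ i \<rightharpoonup> Univ i)" by simp
  have U1: "isT (Om \<cdot> A # \<Gamma>) (Univ i)" by (rule has_isT[OF B])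
  have b: "ceq (Om \<cdot> A # \<Gamma>) (wk ?P \<cdot> Var 0) B (Univ i)"
  proof -
    obtain k where "\<Gamma> \<turnstile> Om \<cdot> A \<Ztypecolon> Univ k" using O' by (auto simp: isT_def)
    then have "Om \<cdot> A # \<Gamma> \<turnstile> wk (Om \<cdot> A) \<Ztypecolon> Univ k"
      using has_wk[of \<Gamma> "Om \<cdot> A" "Univ k" "Om \<cdot> A"] O' by (simp add: has_Univ)
    from wf_subst_up[OF wf_subst_k(1)[OF isT_ctx(1)[OF O']] this]
    have w: "wf_subst (wk (Om \<cdot> A) # Om \<cdot> A # \<Gamma>) (up (\<lambda>n. Var (Suc n))) (Om \<cdot> A # \<Gamma>)" .
    show ?thesis
      using ceq_beta[OF has_subst[OF B w refl refl] has_v0[OF O' refl] refl refl] by (simp add: subst_nf)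
  qed
  have c: "ceq (Om \<cdot> A # \<Gamma>) ?C (wk Om \<cdot> B) (Univ i)"
    by (rule ceq_App_fn[OF ceq_refl[OF Om1] b U1])
  have c': "ceq (A # \<Gamma>) (at_unit eta A ?C) (wk Om \<cdot> at_unit eta A B) (Univ i)"
    by (rule ceq_subst[OF c wf_subst_unit_var[OF u A]]) (simp_all add: subst_nf)
  have C: "isT (Om \<cdot> A # \<Gamma>) ?C" using c by (auto simp: ceq_def intro: isT_has)
  have "inhab \<Gamma> (unique_elim i Om eta)" using u by (simp add: modality_def)
  then have "inhab (Univ i # \<Gamma>) (Pi (wk Om \<cdot> Var 0 \<rightharpoonup> Univ i)
       (let F = Pi (wk2 Om \<cdot> Var 1) (Om \<up> 3 \<cdot> (Var 1 \<cdot> Var 0));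
            G = Pi (Var 1) (Om \<up> 3 \<cdot> (Var 1 \<cdot> (eta \<up> 3 \<cdot> Var 2 \<cdot> Var 0)))
        in is_equiv F G (precomp F (Var 1) (wk2 eta \<cdot> Var 1))))"
    unfolding unique_elim_def inhab_Pi[of \<Gamma>] by (simp add: subst_nf)
  from inhab_inst[OF this A refl]
  have "inhab \<Gamma> (Pi (Om \<cdot> A \<rightharpoonup> Univ i)
       (let F = Pi (wk Om \<cdot> wk A) (wk2 Om \<cdot> (Var 1 \<cdot> Var 0));
            G = Pi (wk A) (wk2 Om \<cdot> (Var 1 \<cdot> (wk2 eta \<cdot> wk2 A \<cdot> Var 0)))
        in is_equiv F G (precomp F (wk A) (wk eta \<cdot> wk A))))"
    by (simp add: Let_def subst_notions subst_precomp subst_nf)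
  from inhab_inst[OF this[unfolded inhab_Pi] P refl]
  have "inhab \<Gamma> (is_equiv (Pi (Om \<cdot> A) ?C) (Pi A (at_unit eta A ?C)) (precomp (Pi (Om \<cdot> A) ?C) A (eta \<cdot> A)))"
    by (simp add: Let_def subst_notions subst_precomp subst_nf)
  with that C ceq_Pi[OF O c] c' show ?thesis by blast
qed

lemma unique_elim_ex:
  assumes u: "modality i \<Gamma> Om eta" and A: "has \<Gamma> A (Univ i)" and B: "has (Om \<cdot> A # \<Gamma>) B (Univ i)"
    and g: "has \<Gamma> g (Pi A (wk Om \<cdot> at_unit eta A B))"
  obtains f where "has \<Gamma> f (Pi (Om \<cdot> A) (wk Om \<cdot> B))"
    "peq (A # \<Gamma>) (wk Om \<cdot> at_unit eta A B) (wk f \<cdot> unit_var eta A) (wk g \<cdot> Var 0)"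
proof -
  obtain C where C: "isT (Om \<cdot> A # \<Gamma>) C"
    and F: "ceq \<Gamma> (Pi (Om \<cdot> A) C) (Pi (Om \<cdot> A) (wk Om \<cdot> B)) (Univ i)"
    and c: "ceq (A # \<Gamma>) (at_unit eta A C) (wk Om \<cdot> at_unit eta A B) (Univ i)"
    and e: "inhab \<Gamma> (is_equiv (Pi (Om \<cdot> A) C) (Pi A (at_unit eta A C)) (precomp (Pi (Om \<cdot> A) C) A (eta \<cdot> A)))"
    using unique_elim_equiv[OF u A B] .
  let ?F = "Pi (Om \<cdot> A) C" and ?G = "Pi A (at_unit eta A C)"
  let ?pc = "precomp ?F A (eta \<cdot> A)"
  from e obtain k where k: "has \<Gamma> k (?G \<rightharpoonup> ?F)" "peq (?G # \<Gamma>) (wk ?G) (wk ?pc \<cdot> (wk k \<cdot> Var 0)) (Var 0)"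
    by (rule equivE)
  have g': "has \<Gamma> g ?G" by (rule has_conv[OF g ceq_sym[OF ceq_Pi[OF A c]]])
  have f: "has \<Gamma> (k \<cdot> g) ?F" by (rule has_App_fn[OF k(1) g'])
  have "peq \<Gamma> ?G (?pc \<cdot> (k \<cdot> g)) g" by (rule peq_inst[OF k(2) g']) (simp_all add: subst_nf)
  note 1 = peq_happly[OF this]
  have 2: "peq (A # \<Gamma>) (at_unit eta A C) (wk (?pc \<cdot> (k \<cdot> g)) \<cdot> Var 0) (wk (k \<cdot> g) \<cdot> unit_var eta A)"
    using peq_precomp[OF has_eta[OF u A] C f] by simp
  from peq_conv[OF peq_trans[OF peq_sym[OF 2] 1] c]
  show ?thesis by (rule that[OF has_conv[OF f F]])
qed

lemma unique_elim_unique: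
  assumes u: "modality i \<Gamma> Om eta" and A: "has \<Gamma> A (Univ i)" and B: "has (Om \<cdot> A # \<Gamma>) B (Univ i)"
    and f: "has \<Gamma> f (Pi (Om \<cdot> A) (wk Om \<cdot> B))" and f': "has \<Gamma> f' (Pi (Om \<cdot> A) (wk Om \<cdot> B))"
    and eq: "peq (A # \<Gamma>) (wk Om \<cdot> at_unit eta A B) (wk f \<cdot> unit_var eta A) (wk f' \<cdot> unit_var eta A)"
  shows "peq \<Gamma> (Pi (Om \<cdot> A) (wk Om \<cdot> B)) f f'"
proof -
  obtain C where C: "isT (Om \<cdot> A # \<Gamma>) C"
    and F: "ceq \<Gamma> (Pi (Om \<cdot> A) C) (Pi (Om \<cdot> A) (wk Om \<cdot> B)) (Univ i)"
    and c: "ceq (A # \<Gamma>) (at_unit eta A C) (wk Om \<cdot> at_unit eta A B) (Univ i)"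
    and e: "inhab \<Gamma> (is_equiv (Pi (Om \<cdot> A) C) (Pi A (at_unit eta A C)) (precomp (Pi (Om \<cdot> A) C) A (eta \<cdot> A)))"
    using unique_elim_equiv[OF u A B] .
  let ?F = "Pi (Om \<cdot> A) C" and ?G = "Pi A (at_unit eta A C)"
  let ?pc = "precomp ?F A (eta \<cdot> A)"
  from e obtain h where h: "has \<Gamma> h (?G \<rightharpoonup> ?F)" "peq (?F # \<Gamma>) (wk ?F) (wk h \<cdot> (wk ?pc \<cdot> Var 0)) (Var 0)"
    by (rule equivE)
  have hp: "peq \<Gamma> ?F (h \<cdot> (?pc \<cdot> x)) x" if "has \<Gamma> x ?F" for x
    by (rule peq_inst[OF h(2) that]) (simp_all add: subst_nf)
  have fF: "has \<Gamma> f ?F" "has \<Gamma> f' ?F" by (rule has_conv[OF _ ceq_sym[OF F]], fact)+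
  have pc: "has \<Gamma> ?pc (?F \<rightharpoonup> ?G)" using has_precomp[OF has_eta[OF u A] C] by simp
  have p: "peq (A # \<Gamma>) (at_unit eta A C) (wk (?pc \<cdot> x) \<cdot> Var 0) (wk x \<cdot> unit_var eta A)" if "has \<Gamma> x ?F" for x
    using peq_precomp[OF has_eta[OF u A] C that] by simp
  have "peq \<Gamma> ?G (?pc \<cdot> f) (?pc \<cdot> f')"
    by (rule funext[OF has_App_fn[OF pc fF(1)] has_App_fn[OF pc fF(2)]
          peq_trans[OF p[OF fF(1)] peq_trans[OF peq_conv[OF eq ceq_sym[OF c]] peq_sym[OF p[OF fF(2)]]]]])
  from peq_conv[OF peq_trans[OF peq_sym[OF hp[OF fF(1)]] peq_trans[OF peq_ap[OF h(1) this] hp[OF fF(2)]]] F]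
  show ?thesis .
qed

text \<open>
  That \<open>r\<close> is also a section follows from unique elimination for the constant family \<open>Y\<close>: the maps
  \<open>eta \<circ> r\<close> and \<open>id\<close> from \<open>Om Y\<close> to itself agree on units.
\<close>

lemma modal_of_retraction:
  assumes u: "modality i \<Gamma> Om eta" and Y: "has \<Gamma> Y (Univ i)" and r: "has \<Gamma> r (Om \<cdot> Y \<rightharpoonup> Y)"
    and eq: "peq (Y # \<Gamma>) (wk Y) (wk r \<cdot> unit_var eta Y) (Var 0)"
  shows "inhab \<Gamma> (modal Om eta Y)"
proof -
  let ?O = "Om \<cdot> Y"
  have Y': "isT \<Gamma> Y" by (rule isT_has[OF Y])
  have O: "has \<Gamma> ?O (Univ i)" by (rule has_Om[OF u Y])
  have O': "isT \<Gamma> ?O" by (rule isT_has[OF O])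
  have Y1: "has (?O # \<Gamma>) (wk Y) (Univ i)" by (rule has_wk[OF Y O' refl]) simp
  have Yw: "has (Y # \<Gamma>) (wk Y) (Univ i)" by (rule has_wk[OF Y Y' refl]) simp
  note u1 = modality_wk[OF u O'] and uY = modality_wk[OF u Y']
  have x: "has (?O # \<Gamma>) (Var 0) (wk Om \<cdot> wk Y)" by (rule has_v0[OF O']) simp
  have r1: "has (?O # \<Gamma>) (wk r) (wk Om \<cdot> wk Y \<rightharpoonup> wk Y)" by (rule has_wk[OF r O' refl]) (simp add: subst_nf)
  have t: "has (?O # \<Gamma>) (wk eta \<cdot> wk Y \<cdot> (wk r \<cdot> Var 0)) (wk Om \<cdot> wk Y)"
    by (rule has_unit[OF u1 Y1 has_App_fn[OF r1 x]])
  let ?f = "Lam ?O (wk eta \<cdot> wk Y \<cdot> (wk r \<cdot> Var 0))"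
  have f: "has \<Gamma> ?f (?O \<rightharpoonup> ?O)" using has_Lam[OF t] by simp
  have I: "has \<Gamma> (idfun ?O) (?O \<rightharpoonup> ?O)" by (rule has_idfun[OF O'])
  have \<eta>: "has (Y # \<Gamma>) (unit_var eta Y) (wk Om \<cdot> wk Y)" by (rule has_unit_var[OF u Y])
  have eY: "has (Y # \<Gamma>) (wk eta \<cdot> wk Y) (wk Y \<rightharpoonup> wk Om \<cdot> wk Y)" by (rule has_eta[OF uY Yw])
  have f\<eta>: "peq (Y # \<Gamma>) (wk Om \<cdot> wk Y) (wk ?f \<cdot> unit_var eta Y) (wk eta \<cdot> wk Y \<cdot> (wk r \<cdot> unit_var eta Y))"
    by (rule peq_beta_subst[OF t wf_subst_k(1)[OF isT_ctx(1)[OF Y']] \<eta>]) (simp_all add: subst_nf)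
  have I\<eta>: "peq (Y # \<Gamma>) (wk Om \<cdot> wk Y) (wk (idfun ?O) \<cdot> unit_var eta Y) (unit_var eta Y)"
    using ceq_peq[OF ceq_idfun[OF \<eta>]] by (simp add: subst_notions)
  have "peq \<Gamma> (?O \<rightharpoonup> ?O) ?f (idfun ?O)"
    using unique_elim_unique[OF u Y Y1, of ?f "idfun ?O"] f I
      peq_trans[OF f\<eta> peq_trans[OF peq_ap[OF eY eq] peq_sym[OF I\<eta>]]]
    by (simp add: subst_notions subst_nf)
  note pointwise = peq_happly[OF this]
  have I_x: "peq (?O # \<Gamma>) (wk ?O) (wk (idfun ?O) \<cdot> Var 0) (Var 0)"
    using ceq_peq[OF ceq_idfun[OF x]] by (simp add: subst_notions)
  have f_x: "peq (?O # \<Gamma>) (wk ?O) (wk ?f \<cdot> Var 0) (wk (eta \<cdot> Y) \<cdot> (wk r \<cdot> Var 0))"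
    using peq_Lam_wk[OF t] by simp
  have "peq (?O # \<Gamma>) (wk ?O) (wk (eta \<cdot> Y) \<cdot> (wk r \<cdot> Var 0)) (Var 0)"
    by (rule peq_trans[OF peq_sym[OF f_x] peq_trans[OF pointwise I_x]])
  then show ?thesis unfolding modal_def
    by (rule equivI[OF has_eta[OF u Y] r _ r]) (use eq in simp)
qed

text \<open>
  The identity of \<open>Om X\<close>, seen as a map into \<open>Om\<close> of the constant family \<open>X\<close>, extends along the unit
  of \<open>Om X\<close>; the extension is the required retraction.
\<close>

lemma modal_Om:
  assumes u: "modality i \<Gamma> Om eta" and X: "has \<Gamma> X (Univ i)"
  shows "inhab \<Gamma> (modal Om eta (Om \<cdot> X))"
proof -
  let ?Y = "Om \<cdot> X"
  have Y: "has \<Gamma> ?Y (Univ i)" by (rule has_Om[OF u X])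
  have Y': "isT \<Gamma> ?Y" by (rule isT_has[OF Y])
  have X1: "has (Om \<cdot> ?Y # \<Gamma>) (wk X) (Univ i)"
    by (rule has_wk[OF X isT_has[OF has_Om[OF u Y]] refl]) simp
  have g: "has \<Gamma> (idfun ?Y) (Pi ?Y (wk Om \<cdot> at_unit eta ?Y (wk X)))"
    using has_idfun[OF Y'] by (simp add: subst_subst)
  obtain r where r: "has \<Gamma> r (Pi (Om \<cdot> ?Y) (wk Om \<cdot> wk X))"
    and eq: "peq (?Y # \<Gamma>) (wk Om \<cdot> at_unit eta ?Y (wk X)) (wk r \<cdot> unit_var eta ?Y) (wk (idfun ?Y) \<cdot> Var 0)"
    by (rule unique_elim_ex[OF u Y X1 g])
  have x: "has (?Y # \<Gamma>) (Var 0) (wk ?Y)" by (rule has_v0[OF Y' refl])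
  have "peq (?Y # \<Gamma>) (wk ?Y) (wk r \<cdot> unit_var eta ?Y) (Var 0)"
    by (rule peq_trans[OF _ ceq_peq[OF ceq_idfun[OF x]]]) (use eq in \<open>simp add: subst_notions subst_subst\<close>)
  then show ?thesis
    by (intro modal_of_retraction[OF u Y]) (use r in simp_all)
qed

lemma modalE:
  assumes "inhab \<Gamma> (modal Om eta B)"
  obtains r where "has \<Gamma> r (Om \<cdot> B \<rightharpoonup> B)" "peq (B # \<Gamma>) (wk B) (wk r \<cdot> unit_var eta B) (Var 0)"
  using assms unfolding modal_def by (rule equivE) auto

lemma has_at_unit: "modality i \<Gamma> Om eta \<Longrightarrow> has \<Gamma> A (Univ i) \<Longrightarrow> has (Om \<cdot> A # \<Gamma>) B (Univ i) \<Longrightarrow> has (A # \<Gamma>) (at_unit eta A B) (Univ i)"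
  by (rule has_subst[OF _ wf_subst_unit_var]) auto

text \<open>
  Compose the given section with the units of the fibres, extend the result, and apply the inverses
  of the units. In the code \<open>r\<close> is such an inverse at a variable point of \<open>Om A\<close>, and the other one
  is its pullback to \<open>A\<close>.
\<close>

lemma modal_elim:
  assumes u: "modality i \<Gamma> Om eta" and A: "has \<Gamma> A (Univ i)" and B: "has (Om \<cdot> A # \<Gamma>) B (Univ i)"
    and m: "inhab (Om \<cdot> A # \<Gamma>) (modal (wk Om) (wk eta) B)"
    and g: "has \<Gamma> g (Pi A (at_unit eta A B))"
  obtains f where "has \<Gamma> f (Pi (Om \<cdot> A) B)" "peq (A # \<Gamma>) (at_unit eta A B) (wk f \<cdot> unit_var eta A) (wk g \<cdot> Var 0)"
proof -
  let ?O = "Om \<cdot> A" and ?B = "at_unit eta A B"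
  have A': "isT \<Gamma> A" by (rule isT_has[OF A])
  have O': "isT \<Gamma> ?O" by (rule isT_has[OF has_Om[OF u A]])
  note uA = modality_wk[OF u A'] and w = wf_subst_unit_var[OF u A]
  have B1: "has (A # \<Gamma>) ?B (Univ i)" by (rule has_at_unit[OF u A B])
  have \<eta>: "has (A # \<Gamma>) (unit_var eta A) (wk Om \<cdot> wk A)" by (rule has_unit_var[OF u A])
  obtain r where r: "has (?O # \<Gamma>) r (wk Om \<cdot> B \<rightharpoonup> B)"
    and rr: "peq (B # ?O # \<Gamma>) (wk B) (wk r \<cdot> unit_var (wk eta) B) (Var 0)" by (rule modalE[OF m])
  have gx: "has (A # \<Gamma>) (wk g \<cdot> Var 0) ?B" by (rule has_app0[OF g])
  have g': "has \<Gamma> (Lam A (wk eta \<cdot> ?B \<cdot> (wk g \<cdot> Var 0))) (Pi A (wk Om \<cdot> ?B))"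
    by (rule has_Lam[OF has_unit[OF uA B1 gx]])
  obtain f0 where f0: "has \<Gamma> f0 (Pi ?O (wk Om \<cdot> B))"
    and eq: "peq (A # \<Gamma>) (wk Om \<cdot> ?B) (wk f0 \<cdot> unit_var eta A) (wk (Lam A (wk eta \<cdot> ?B \<cdot> (wk g \<cdot> Var 0))) \<cdot> Var 0)"
    by (rule unique_elim_ex[OF u A B g'])
  have t: "has (?O # \<Gamma>) (r \<cdot> (wk f0 \<cdot> Var 0)) B" by (rule has_App_fn[OF r has_app0[OF f0]])
  let ?r = "subst (unit_var eta A .: (\<lambda>n. Var (Suc n))) r"
  have r1: "has (A # \<Gamma>) ?r (wk Om \<cdot> ?B \<rightharpoonup> ?B)" by (rule has_subst[OF r w refl]) (simp add: subst_nf)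
  have 1: "peq (A # \<Gamma>) ?B (wk (Lam ?O (r \<cdot> (wk f0 \<cdot> Var 0))) \<cdot> unit_var eta A) (?r \<cdot> (wk f0 \<cdot> unit_var eta A))"
    by (rule peq_beta_subst[OF t wf_subst_k(1)[OF isT_ctx(1)[OF A']] \<eta>]) (simp_all add: subst_nf)
  have 2: "peq (A # \<Gamma>) ?B (?r \<cdot> (wk f0 \<cdot> unit_var eta A)) (?r \<cdot> (wk eta \<cdot> ?B \<cdot> (wk g \<cdot> Var 0)))"
    by (rule peq_ap[OF r1 peq_trans[OF eq peq_Lam_wk[OF has_unit[OF uA B1 gx]]]])
  have 3: "peq (A # \<Gamma>) ?B (?r \<cdot> (wk eta \<cdot> ?B \<cdot> (wk g \<cdot> Var 0))) (wk g \<cdot> Var 0)"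
    by (rule inhab_subst[OF rr wf_subst_Cons[OF w gx refl]]) (simp add: subst_nf)
  show ?thesis by (rule that[OF has_Lam[OF t] peq_trans[OF 1 peq_trans[OF 2 3]]])
qed

text \<open>
  After composition with the units of the fibres, which are injective, uniqueness is that of unique
  elimination.
\<close>

lemma modal_unique:
  assumes u: "modality i \<Gamma> Om eta" and A: "has \<Gamma> A (Univ i)" and B: "has (Om \<cdot> A # \<Gamma>) B (Univ i)"
    and m: "inhab (Om \<cdot> A # \<Gamma>) (modal (wk Om) (wk eta) B)"
    and f: "has \<Gamma> f (Pi (Om \<cdot> A) B)" and f': "has \<Gamma> f' (Pi (Om \<cdot> A) B)"
    and eq: "peq (A # \<Gamma>) (at_unit eta A B) (wk f \<cdot> unit_var eta A) (wk f' \<cdot> unit_var eta A)"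
  shows "peq \<Gamma> (Pi (Om \<cdot> A) B) f f'"
proof -
  let ?O = "Om \<cdot> A" and ?B = "at_unit eta A B"
  have A': "isT \<Gamma> A" by (rule isT_has[OF A])
  have O': "isT \<Gamma> ?O" by (rule isT_has[OF has_Om[OF u A]])
  note uA = modality_wk[OF u A'] and uO = modality_wk[OF u O'] and w = wf_subst_unit_var[OF u A]
  have B1: "has (A # \<Gamma>) ?B (Univ i)" by (rule has_at_unit[OF u A B])
  have \<eta>: "has (A # \<Gamma>) (unit_var eta A) (wk Om \<cdot> wk A)" by (rule has_unit_var[OF u A])
  have \<eta>B: "has (A # \<Gamma>) (wk eta \<cdot> ?B) (?B \<rightharpoonup> wk Om \<cdot> ?B)" by (rule has_eta[OF uA B1])
  obtain r where r: "has (?O # \<Gamma>) r (wk Om \<cdot> B \<rightharpoonup> B)"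
    and rr: "peq (B # ?O # \<Gamma>) (wk B) (wk r \<cdot> unit_var (wk eta) B) (Var 0)" by (rule modalE[OF m])
  let ?e = "\<lambda>f. Lam ?O (wk eta \<cdot> B \<cdot> (wk f \<cdot> Var 0))"
  have t: "has (?O # \<Gamma>) (wk eta \<cdot> B \<cdot> (wk f \<cdot> Var 0)) (wk Om \<cdot> B)" if "has \<Gamma> f (Pi ?O B)" for f
    by (rule has_unit[OF uO B has_app0[OF that]])
  have e\<eta>: "peq (A # \<Gamma>) (wk Om \<cdot> ?B) (wk (?e f) \<cdot> unit_var eta A) (wk eta \<cdot> ?B \<cdot> (wk f \<cdot> unit_var eta A))"
    if "has \<Gamma> f (Pi ?O B)" for f
    by (rule peq_beta_subst[OF t[OF that] wf_subst_k(1)[OF isT_ctx(1)[OF A']] \<eta>]) (simp_all add: subst_nf)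
  have "peq \<Gamma> (Pi ?O (wk Om \<cdot> B)) (?e f) (?e f')"
    by (rule unique_elim_unique[OF u A B has_Lam[OF t[OF f]] has_Lam[OF t[OF f']]
          peq_trans[OF e\<eta>[OF f] peq_trans[OF peq_ap[OF \<eta>B eq] peq_sym[OF e\<eta>[OF f']]]]])
  note p = peq_happly[OF this]
  have "peq (?O # \<Gamma>) (wk Om \<cdot> B) (wk eta \<cdot> B \<cdot> (wk f \<cdot> Var 0)) (wk eta \<cdot> B \<cdot> (wk f' \<cdot> Var 0))"
    by (rule peq_trans[OF peq_sym[OF peq_Lam_wk[OF t[OF f]]] peq_trans[OF p peq_Lam_wk[OF t[OF f']]]])
  note q = peq_ap[OF r this]
  have ret: "peq (?O # \<Gamma>) B (r \<cdot> (wk eta \<cdot> B \<cdot> (wk f \<cdot> Var 0))) (wk f \<cdot> Var 0)" if "has \<Gamma> f (Pi ?O B)" for f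
    by (rule peq_inst[OF rr has_app0[OF that]]) (simp_all add: subst_nf)
  show ?thesis
    by (rule funext[OF f f' peq_trans[OF peq_sym[OF ret[OF f]] peq_trans[OF q ret[OF f']]]])
qed

text \<open>
  The inverse is obtained by extending a variable function \<open>X \<rightarrow> Z\<close>, hence by elimination over the
  context that contains this variable. One composite is the identity by construction of the
  extension, the other one by its uniqueness.
\<close>

lemma precomp_unit_is_equiv:
  assumes u: "modality i \<Gamma> Om eta" and X: "has \<Gamma> X (Univ i)" and Z: "has \<Gamma> Z (Univ i)"
    and m: "inhab \<Gamma> (modal Om eta Z)"
  shows "inhab \<Gamma> (is_equiv (Om \<cdot> X \<rightharpoonup> Z) (X \<rightharpoonup> Z) (precomp (Om \<cdot> X \<rightharpoonup> Z) X (eta \<cdot> X)))"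
proof -
  let ?O = "Om \<cdot> X" and ?pc = "precomp (Om \<cdot> X \<rightharpoonup> Z) X (eta \<cdot> X)"
  let ?F = "?O \<rightharpoonup> Z" and ?G = "X \<rightharpoonup> Z"
  have X': "isT \<Gamma> X" and Z': "isT \<Gamma> Z" by (rule isT_has[OF X], rule isT_has[OF Z])
  have O: "has \<Gamma> ?O (Univ i)" by (rule has_Om[OF u X])
  have O': "isT \<Gamma> ?O" by (rule isT_has[OF O])
  have G: "isT \<Gamma> ?G" by (rule isT_fn[OF X' Z'])
  have F: "isT \<Gamma> ?F" by (rule isT_fn[OF O' Z'])
  have pc: "has \<Gamma> ?pc (?F \<rightharpoonup> ?G)"
    using has_precomp[OF has_eta[OF u X] isT_wk[OF Z' O' refl]] by (simp add: subst_nf)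
  have pc_at: "peq (wk X # Y # \<Gamma>) (wk2 Z) (wk (wk ?pc \<cdot> f) \<cdot> Var 0) (wk f \<cdot> unit_var (wk eta) (wk X))"
    if Y: "isT \<Gamma> Y" and f: "has (Y # \<Gamma>) f (wk ?F)" for Y f
  proof -
    have XY: "has (Y # \<Gamma>) (wk X) (Univ i)" by (rule has_wk[OF X Y refl]) simp
    have "isT (Y # \<Gamma>) (wk Om \<cdot> wk X)" "isT (Y # \<Gamma>) (wk Z)"
      using isT_wk[OF O' Y refl] isT_wk[OF Z' Y refl] by simp_all
    from peq_precomp[OF has_eta[OF modality_wk[OF u Y] XY] isT_wk[OF this(2,1) refl], of f] f
    show ?thesis by (simp add: subst_precomp subst_nf)
  qed
  have uG: "modality i (?G # \<Gamma>) (wk Om) (wk eta)" by (rule modality_wk[OF u G])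
  have XG: "has (?G # \<Gamma>) (wk X) (Univ i)" by (rule has_wk[OF X G refl]) simp
  have OG: "isT (?G # \<Gamma>) (wk ?O)" by (rule isT_wk[OF O' G refl])
  obtain t where t: "has (?G # \<Gamma>) t (wk ?F)"
    and t_at: "peq (wk X # ?G # \<Gamma>) (wk2 Z) (wk t \<cdot> unit_var (wk eta) (wk X)) (Var (Suc 0) \<cdot> Var 0)"
  proof (rule modal_elim[OF uG XG])
    have w: "wf_subst (wk Om \<cdot> wk X # ?G # \<Gamma>) (\<lambda>n. Var (Suc (Suc n))) \<Gamma>"
      using wf_subst_k(2)[OF isT_ctx(1)[OF OG]] by simp
    show "has (wk Om \<cdot> wk X # ?G # \<Gamma>) (wk2 Z) (Univ i)" by (rule has_subst[OF Z w refl]) simp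
    show "inhab (wk Om \<cdot> wk X # ?G # \<Gamma>) (modal (wk (wk Om)) (wk (wk eta)) (wk2 Z))"
      by (rule inhab_subst[OF m w]) (simp add: subst_modal subst_nf)
    show "has (?G # \<Gamma>) (Var 0) (Pi (wk X) (at_unit (wk eta) (wk X) (wk2 Z)))"
      by (rule has_v0[OF G]) (simp add: subst_nf)
  qed (use that in \<open>simp add: subst_nf\<close>)
  let ?g = "Lam ?G t"
  have g: "has \<Gamma> ?g (?G \<rightharpoonup> ?F)" by (rule has_Lam[OF t])
  have g_at: "peq (wk X # Y # \<Gamma>) (wk2 Z) (wk (wk ?g \<cdot> h) \<cdot> unit_var (wk eta) (wk X)) (wk h \<cdot> Var 0)"
    if Y: "isT \<Gamma> Y" and h: "has (Y # \<Gamma>) h (wk ?G)" for Y h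
  proof -
    have XY: "has (Y # \<Gamma>) (wk X) (Univ i)" by (rule has_wk[OF X Y refl]) simp
    have XY': "isT (Y # \<Gamma>) (wk X)" by (rule isT_has[OF XY])
    have wY: "wf_subst (Y # \<Gamma>) (\<lambda>n. Var (Suc n)) \<Gamma>" by (rule wf_subst_k(1)[OF isT_ctx(1)[OF Y]])
    let ?t = "subst (h .: (\<lambda>n. Var (Suc n))) t"
    have "peq (Y # \<Gamma>) (wk ?F) (wk ?g \<cdot> h) ?t"
      by (rule peq_beta_subst[OF t wY h refl refl refl]) (simp add: subst_nf)
    then have "peq (wk X # Y # \<Gamma>) (wk (wk Om) \<cdot> wk (wk X) \<rightharpoonup> wk2 Z) (wk (wk ?g \<cdot> h)) (wk ?t)"
      by (rule inhab_wk[OF _ XY']) (simp add: subst_nf)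
    note 1 = peq_App_fn[OF this has_unit_var[OF modality_wk[OF u Y] XY]]
    have w: "wf_subst (wk X # Y # \<Gamma>) (Var 0 .: wk h .: (\<lambda>n. Var (Suc (Suc n)))) (wk X # ?G # \<Gamma>)"
      by (rule wf_subst_Cons[OF wf_subst_Cons[OF wf_subst_k(2)[OF isT_ctx(1)[OF XY']] has_wk[OF h XY' refl refl]] has_v0[OF XY' refl]])
        (simp_all add: subst_nf)
    have 2: "peq (wk X # Y # \<Gamma>) (wk2 Z) (wk ?t \<cdot> unit_var (wk eta) (wk X)) (wk h \<cdot> Var 0)"
      by (rule inhab_subst[OF t_at w]) (simp add: subst_nf)
    from 1 2 show ?thesis by (rule peq_trans)
  qed
  have pcY: "has (Y # \<Gamma>) (wk ?pc) (wk ?F \<rightharpoonup> wk ?G)" and gY: "has (Y # \<Gamma>) (wk ?g) (wk ?G \<rightharpoonup> wk ?F)"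
    if Y: "isT \<Gamma> Y" for Y
    by (rule has_wk[OF pc Y refl], simp add: subst_nf) (rule has_wk[OF g Y refl], simp add: subst_nf)
  show ?thesis
  proof (rule equivI[OF pc g _ g])
    have h: "has (?G # \<Gamma>) (Var 0) (wk ?G)" by (rule has_v0[OF G refl])
    have gh: "has (?G # \<Gamma>) (wk ?g \<cdot> Var 0) (wk ?F)" by (rule has_App_fn[OF gY[OF G] h])
    have G1: "wk ?G = Pi (wk X) (wk2 Z)" by (simp add: subst_nf)
    show "peq (?G # \<Gamma>) (wk ?G) (wk ?pc \<cdot> (wk ?g \<cdot> Var 0)) (Var 0)"
      unfolding G1
      by (rule funext[OF has_App_fn[OF pcY[OF G] gh, unfolded G1] h[unfolded G1]
            peq_trans[OF pc_at[OF G gh] g_at[OF G h]]])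
    have k: "has (?F # \<Gamma>) (Var 0) (wk ?F)" by (rule has_v0[OF F refl])
    have ck: "has (?F # \<Gamma>) (wk ?pc \<cdot> Var 0) (wk ?G)" by (rule has_App_fn[OF pcY[OF F] k])
    have F1: "wk ?F = Pi (wk Om \<cdot> wk X) (wk2 Z)" by (simp add: subst_nf)
    note gck = has_App_fn[OF gY[OF F] ck]
    have XF: "has (?F # \<Gamma>) (wk X) (Univ i)" by (rule has_wk[OF X F refl]) simp
    have OF: "isT (?F # \<Gamma>) (wk Om \<cdot> wk X)" using isT_wk[OF O' F refl] by simp
    have w: "wf_subst (wk Om \<cdot> wk X # ?F # \<Gamma>) (\<lambda>n. Var (Suc (Suc n))) \<Gamma>"
      by (rule wf_subst_k(2)[OF isT_ctx(1)[OF OF]])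
    have Z2: "has (wk Om \<cdot> wk X # ?F # \<Gamma>) (wk2 Z) (Univ i)" by (rule has_subst[OF Z w refl]) simp
    have m2: "inhab (wk Om \<cdot> wk X # ?F # \<Gamma>) (modal (wk (wk Om)) (wk (wk eta)) (wk2 Z))"
      by (rule inhab_subst[OF m w]) (simp add: subst_modal subst_nf)
    show "peq (?F # \<Gamma>) (wk ?F) (wk ?g \<cdot> (wk ?pc \<cdot> Var 0)) (Var 0)"
      unfolding F1
      by (rule modal_unique[OF modality_wk[OF u F] XF Z2 m2 gck[unfolded F1] k[unfolded F1]])
        (use peq_trans[OF g_at[OF F ck] pc_at[OF F k]] in \<open>simp add: subst_subst\<close>)
  qed
qed

text \<open>
  Besides the maps \<open>f\<close> and \<open>g\<close> of the introduction, the proof needs an element \<open>q\<close> of \<open>B (f (eta s))\<close>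
  with \<open>(f (eta s), q) = s\<close>. Such a \<open>q\<close> is found by transporting, along \<open>f (eta s) = fst s\<close>, the type of
  all \<open>b : B y\<close> with \<open>(y, b) = s\<close>; at \<open>y = fst s\<close> it is inhabited by induction on \<open>s\<close>.
\<close>

lemma sigma_modal:
  assumes u: "modality i \<Gamma> Om eta" and X: "has \<Gamma> X (Univ i)" and B: "has (X # \<Gamma>) B (Univ i)"
    and mX: "inhab \<Gamma> (modal Om eta X)" and mB: "inhab (X # \<Gamma>) (modal (wk Om) (wk eta) B)"
  shows "inhab \<Gamma> (modal Om eta (Sig X B))"
proof -
  let ?S = "Sig X B"
  have X': "isT \<Gamma> X" by (rule isT_has[OF X])
  have S: "has \<Gamma> ?S (Univ i)" by (rule has_Sig_U[OF X B])
  have S': "isT \<Gamma> ?S" by (rule isT_has[OF S])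
  let ?O = "Om \<cdot> ?S"
  have O': "isT \<Gamma> ?O" by (rule isT_has[OF has_Om[OF u S]])
  have wO: "wf_subst (?O # \<Gamma>) (\<lambda>n. Var (Suc n)) \<Gamma>" and wS: "wf_subst (?S # \<Gamma>) (\<lambda>n. Var (Suc n)) \<Gamma>"
    by (rule wf_subst_k(1)[OF isT_ctx(1)[OF O']], rule wf_subst_k(1)[OF isT_ctx(1)[OF S']])
  have s: "has (?S # \<Gamma>) (Var 0) (wk ?S)" by (rule has_v0[OF S' refl])
  then have s': "has (?S # \<Gamma>) (Var 0) (Sig (wk X) (subst (Var 0 .: (\<lambda>n. Var (Suc (Suc n)))) B))"
    by (simp add: subst_nf)
  note s1 = has_Fst[OF s']
  have XO: "has (?O # \<Gamma>) (wk X) (Univ i)" by (rule has_wk[OF X O' refl]) simp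
  have mXO: "inhab (?O # \<Gamma>) (modal (wk Om) (wk eta) (wk X))"
    by (rule inhab_wk[OF mX O']) (simp add: subst_modal)
  have p1: "has \<Gamma> (Lam ?S (Fst (wk X) (Var 0))) (Pi ?S (at_unit eta ?S (wk X)))"
    using has_Lam[OF s1] by (simp add: subst_subst)
  obtain f where f: "has \<Gamma> f (?O \<rightharpoonup> X)"
    and f_eq: "peq (?S # \<Gamma>) (at_unit eta ?S (wk X)) (wk f \<cdot> unit_var eta ?S) (wk (Lam ?S (Fst (wk X) (Var 0))) \<cdot> Var 0)"
    by (rule modal_elim[OF u S XO mXO p1])
  have f_fst: "peq (?S # \<Gamma>) (wk X) (wk f \<cdot> unit_var eta ?S) (Fst (wk X) (Var 0))"
    by (rule peq_trans[OF _ peq_Lam_wk[OF s1]]) (use f_eq in \<open>simp add: subst_subst\<close>)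
  let ?B = "subst (wk f \<cdot> Var 0 .: (\<lambda>n. Var (Suc n))) B"
  have fz: "has (?O # \<Gamma>) (wk f \<cdot> Var 0) (wk X)" by (rule has_app0[OF f])
  have wB: "wf_subst (?O # \<Gamma>) (wk f \<cdot> Var 0 .: (\<lambda>n. Var (Suc n))) (X # \<Gamma>)"
    by (rule wf_subst_Cons[OF wO fz refl])
  have BO: "has (?O # \<Gamma>) ?B (Univ i)" by (rule has_subst[OF B wB refl]) simp
  have mBO: "inhab (?O # \<Gamma>) (modal (wk Om) (wk eta) ?B)"
    by (rule inhab_subst[OF mB wB]) (simp add: subst_modal subst_nf)
  let ?fs = "wk f \<cdot> unit_var eta ?S"
  let ?Bs = "subst (?fs .: (\<lambda>n. Var (Suc n))) B"
  have fs: "has (?S # \<Gamma>) ?fs (wk X)" using f_fst by (rule peqD)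
  have BX: "isT (X # \<Gamma>) B" by (rule isT_has[OF B])
  have wup: "wf_subst (subst s X # \<Delta>) (up s) (X # \<Gamma>)" if w: "wf_subst \<Delta> s \<Gamma>" for \<Delta> s
  proof -
    obtain j where "\<Delta> \<turnstile> subst s X \<Ztypecolon> Univ j" using isT_subst[OF X' w refl] by (auto simp: isT_def)
    from wf_subst_up[OF w this] show ?thesis .
  qed
  have tup: "has \<Delta> (Tup a b) (subst s ?S)"
    if w: "wf_subst \<Delta> s \<Gamma>" and a: "has \<Delta> a (subst s X)" and b: "has \<Delta> b (subst (a .: s) B)" for \<Delta> a b s
    unfolding subst.simps by (rule has_Tup[OF a b _ isT_subst[OF BX wup[OF w] refl]]) (simp add: subst_nf)
  define M where "M = (\<lambda>s p. Sig (subst (up s) B) (Eq (wk (wk (subst s ?S))) (Tup (Var (Suc 0)) (Var 0)) (wk (wk p))))"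
  have M: "isT (subst s X # \<Delta>) (M s p)" if w: "wf_subst \<Delta> s \<Gamma>" and p: "has \<Delta> p (subst s ?S)" for \<Delta> s p
  proof -
    let ?D = "subst s X # \<Delta>"
    have X1: "isT \<Delta> (subst s X)" by (rule isT_subst[OF X' w refl])
    have B1: "isT ?D (subst (up s) B)" by (rule isT_subst[OF BX wup[OF w] refl])
    have w2: "wf_subst (subst (up s) B # ?D) (\<lambda>n. wk2 (s n)) \<Gamma>"
      using wf_subst_comp_wk[OF wf_subst_comp_wk[OF w isT_ctx(1)[OF X1]] isT_ctx(1)[OF B1]] by (simp add: subst_nf)
    have "has (subst (up s) B # ?D) (Tup (Var (Suc 0)) (Var 0)) (subst (\<lambda>n. wk2 (s n)) ?S)"
      by (rule tup[OF w2 has_v1[OF B1] has_v0[OF B1]]) (simp_all add: subst_nf)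
    then have "has (subst (up s) B # ?D) (Tup (Var (Suc 0)) (Var 0)) (wk (wk (subst s ?S)))" by (simp add: subst_nf)
    with has_wk[OF has_wk[OF p X1 refl refl] B1 refl refl]
    show ?thesis unfolding M_def by (intro isT_Sig isT_Eq)
  qed
  let ?M1 = "M (\<lambda>n. Var (Suc n)) (Var 0)" and ?M2 = "M (\<lambda>n. Var (Suc (Suc n))) (Tup (Var (Suc 0)) (Var 0))"
  have wBX: "wf_subst (B # X # \<Gamma>) (\<lambda>n. Var (Suc (Suc n))) \<Gamma>" by (rule wf_subst_k(2)[OF isT_ctx(1)[OF BX]])
  have v1: "has (B # X # \<Gamma>) (Var (Suc 0)) (wk2 X)" by (rule has_v1[OF BX refl])
  have v0: "has (B # X # \<Gamma>) (Var 0) (wk B)" by (rule has_v0[OF BX refl])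
  have vp: "has (B # X # \<Gamma>) (Tup (Var (Suc 0)) (Var 0)) (wk2 ?S)"
    by (rule tup[OF wBX v1]) (use v0 in \<open>simp add: subst_nf\<close>)
  have base: "inhab (B # X # \<Gamma>) (subst (Var (Suc 0) .: Var) ?M2)"
  proof -
    have T: "isT (B # X # \<Gamma>) (subst (Var (Suc 0) .: Var) ?M2)"
      by (rule isT_subst[OF M[OF wBX vp] wf_subst_inst[OF v1] refl])
    have e: "subst (Var (Suc 0) .: Var) ?M2 = Sig (wk B) (Eq (wk (wk2 ?S)) (Tup (Var (Suc (Suc 0))) (Var 0)) (Tup (Var (Suc (Suc 0))) (Var (Suc 0))))"
      by (simp add: M_def subst_nf)
    show ?thesis unfolding e
      by (rule inhab_Sig[OF v0 _ refl isT_SigD[OF T[unfolded e]]]) (use peq_refl[OF vp] in \<open>simp add: subst_nf\<close>)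
  qed
  have "inhab (B # X # \<Gamma>) (subst (Fst (wk2 X) (Tup (Var (Suc 0)) (Var 0)) .: Var) ?M2)"
    by (rule transport[OF peq_sym[OF ceq_peq[OF ceq_Fst[OF v1 v0 _ isT_subst[OF BX wup[OF wBX] refl]]]] M[OF wBX vp] base refl refl])
      (simp add: subst_nf)
  moreover have "isT (?S # \<Gamma>) (subst (Fst (wk X) (Var 0) .: Var) ?M1)"
    by (rule isT_subst[OF M[OF wS s] wf_subst_inst[OF s1] refl])
  ultimately have "inhab (?S # \<Gamma>) (subst (Fst (wk X) (Var 0) .: Var) ?M1)"
    by (intro sig_elim) (simp_all add: M_def subst_nf)
  from transport[OF peq_sym[OF f_fst] M[OF wS s] this refl refl]
  have K: "inhab (?S # \<Gamma>) (Sig ?Bs (Eq (wk (wk ?S)) (Tup (wk ?fs) (Var 0)) (Var (Suc 0))))"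
    by (simp add: M_def subst_nf)
  then obtain k where k: "has (?S # \<Gamma>) k (Sig ?Bs (Eq (wk (wk ?S)) (Tup (wk ?fs) (Var 0)) (Var (Suc 0))))" by (auto simp: inhab_def)
  from sigE[OF k] obtain q where q: "has (?S # \<Gamma>) q ?Bs"
    and q_eq: "peq (?S # \<Gamma>) (wk ?S) (Tup ?fs q) (Var 0)" by (auto simp: subst_nf)
  have "has \<Gamma> (Lam ?S q) (Pi ?S (at_unit eta ?S ?B))" using has_Lam[OF q] by (simp add: subst_nf)
  then obtain g where g: "has \<Gamma> g (Pi ?O ?B)"
    and g_eq: "peq (?S # \<Gamma>) (at_unit eta ?S ?B) (wk g \<cdot> unit_var eta ?S) (wk (Lam ?S q) \<cdot> Var 0)"
    by (rule modal_elim[OF u S BO mBO])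
  have g_q: "peq (?S # \<Gamma>) ?Bs (wk g \<cdot> unit_var eta ?S) q"
    by (rule peq_trans[OF _ peq_Lam_wk[OF q]]) (use g_eq in \<open>simp add: subst_nf\<close>)
  have gz: "has (?O # \<Gamma>) (wk g \<cdot> Var 0) ?B" by (rule has_app0[OF g])
  have t: "has (?O # \<Gamma>) (Tup (wk f \<cdot> Var 0) (wk g \<cdot> Var 0)) (wk ?S)"
    by (rule tup[OF wO fz]) (use gz in simp)
  let ?r = "Lam ?O (Tup (wk f \<cdot> Var 0) (wk g \<cdot> Var 0))"
  have r: "has \<Gamma> ?r (?O \<rightharpoonup> ?S)" by (rule has_Lam[OF t])
  have 1: "peq (?S # \<Gamma>) (wk ?S) (wk ?r \<cdot> unit_var eta ?S) (Tup ?fs (wk g \<cdot> unit_var eta ?S))"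
    by (rule peq_beta_subst[OF t wS has_unit_var[OF u S]]) (simp_all add: subst_nf)
  have Bs': "isT (?S # \<Gamma>) ?Bs" by (rule has_isT[OF q])
  have 2: "peq (?S # \<Gamma>) (wk ?S) (Tup ?fs (wk g \<cdot> unit_var eta ?S)) (Tup ?fs q)"
  proof (rule peq_cong[OF g_q])
    have "has (?Bs # ?S # \<Gamma>) (Tup (wk ?fs) (Var 0)) (subst (\<lambda>n. Var (Suc (Suc n))) ?S)"
      by (rule tup[OF wf_subst_k(2)[OF isT_ctx(1)[OF Bs']] has_wk[OF fs Bs' refl] has_v0[OF Bs']]) (simp_all add: subst_nf)
    then show "has (?Bs # ?S # \<Gamma>) (Tup (wk ?fs) (Var 0)) (wk (wk ?S))" by (simp add: subst_nf)
  qed (simp_all add: subst_nf)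
  show ?thesis
    by (rule modal_of_retraction[OF u S r peq_trans[OF 1 peq_trans[OF 2 q_eq]]])
qed

section \<open>The predicate of modal types\<close>

lemma subst_hprop: "subst s (hprop i) = hprop i"
  by (simp add: hprop_def subst_is_prop up_def)

lemma subst_local_type: "subst s (local_type i Q X) = local_type i (subst s Q) (subst s X)"
  by (simp add: local_type_def subst_nf)

lemma local_type_nf: "local_type i Q X = Fst (Univ i) (Q \<cdot> X)"
  by (simp add: local_type_def)

abbreviation (input) "hpred i \<equiv> Univ i \<rightharpoonup> hprop i"

lemma has_local:
  assumes Q: "has \<Gamma> Q (hpred i)" and X: "has \<Gamma> X (Univ i)" shows "has \<Gamma> (local_type i Q X) (Univ i)"
  unfolding local_type_nf by (rule has_Fst[OF has_App_fn[OF Q X, unfolded hprop_def]])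

lemma has_modal: "modality i \<Gamma> Om eta \<Longrightarrow> has \<Gamma> X (Univ i) \<Longrightarrow> has \<Gamma> (modal Om eta X) (Univ i)"
  unfolding modal_def by (rule has_is_equiv[OF _ has_Om has_eta])

text \<open>
  The last clause is a propositional equality of types, although the predicate constructed below
  satisfies it by computation. The weaker form is stable under substitution and suffices to
  exchange local and modal types.
\<close>

definition modal_predicate :: "nat \<Rightarrow> tm list \<Rightarrow> tm \<Rightarrow> tm \<Rightarrow> tm \<Rightarrow> bool" where
  "modal_predicate i \<Gamma> Om eta Q \<longleftrightarrow> modality i \<Gamma> Om eta \<and> has \<Gamma> Q (hpred i) \<and>
     peq (Univ i # \<Gamma>) (Univ i) (local_type i (wk Q) (Var 0)) (modal (wk Om) (wk eta) (Var 0))"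

lemma modal_predicate_subst:
  assumes "modal_predicate i \<Gamma> Om eta Q" and w: "wf_subst \<Delta> s \<Gamma>"
  shows "modal_predicate i \<Delta> (subst s Om) (subst s eta) (subst s Q)"
proof -
  have u: "modality i \<Gamma> Om eta" and Q: "has \<Gamma> Q (hpred i)"
    and p: "peq (Univ i # \<Gamma>) (Univ i) (local_type i (wk Q) (Var 0)) (modal (wk Om) (wk eta) (Var 0))"
    using assms(1) by (auto simp: modal_predicate_def)
  have "\<turnstile> \<Delta> ctx" using w by (simp add: wf_subst_def)
  then have "\<Delta> \<turnstile> subst s (Univ i) \<Ztypecolon> Univ (Suc i)" by (simp add: ty_univ)
  note w1 = wf_subst_up[OF w this]
  have "peq (Univ i # \<Delta>) (Univ i) (local_type i (wk (subst s Q)) (Var 0))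
      (modal (wk (subst s Om)) (wk (subst s eta)) (Var 0))"
    by (rule inhab_subst[OF p w1[unfolded subst.simps]]) (simp add: subst_local_type subst_modal subst_nf)
  moreover have "has \<Delta> (subst s Q) (hpred i)" by (rule has_subst[OF Q w refl]) (simp add: subst_hprop)
  ultimately show ?thesis using modality_subst[OF u w refl refl] by (simp add: modal_predicate_def)
qed

lemma modal_predicate_wk: "modal_predicate i \<Gamma> Om eta Q \<Longrightarrow> isT \<Gamma> A \<Longrightarrow> modal_predicate i (A # \<Gamma>) (wk Om) (wk eta) (wk Q)"
  by (rule modal_predicate_subst[OF _ wf_subst_k(1)[OF isT_ctx(1)]])

lemma local_peq_modal:
  assumes "modal_predicate i \<Gamma> Om eta Q" and X: "has \<Gamma> X (Univ i)"
  shows "peq \<Gamma> (Univ i) (local_type i Q X) (modal Om eta X)"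
  using assms(1) unfolding modal_predicate_def
  by (elim conjE peq_inst[OF _ X]) (simp_all add: subst_local_type subst_modal subst_nf)

lemma local_iff_modal:
  assumes "modal_predicate i \<Gamma> Om eta Q" and X: "has \<Gamma> X (Univ i)"
  shows "inhab \<Gamma> (local_type i Q X) \<longleftrightarrow> inhab \<Gamma> (modal Om eta X)"
  using local_peq_modal[OF assms] peq_sym inhab_peq by blast

lemma modal_predicate_exists:
  assumes u: "modality i \<Gamma> Om eta"
  obtains Q where "modal_predicate i \<Gamma> Om eta Q"
proof -
  have c: "\<turnstile> \<Gamma> ctx" using u by (auto simp: modality_def intro: has_ctx)
  have U: "isT \<Gamma> (Univ i)" by (rule isT_Univ[OF c])
  note u1 = modality_wk[OF u U]
  have X: "has (Univ i # \<Gamma>) (Var 0) (Univ i)" by (rule has_v0[OF U]) simp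
  let ?M = "modal (wk Om) (wk eta) (Var 0)"
  have M: "has (Univ i # \<Gamma>) ?M (Univ i)" by (rule has_modal[OF u1 X])
  have U1: "isT (Univ i # \<Gamma>) (Univ i)" by (rule has_isT[OF M])
  have P: "isT (Univ i # Univ i # \<Gamma>) (is_prop (Var 0))"
    by (rule isT_is_prop[OF isT_has[OF has_v0[OF U1]]]) simp
  obtain p where p: "has (Univ i # \<Gamma>) p (is_prop ?M)"
    using is_prop_is_equiv[OF X has_Om[OF u1 X] has_eta[OF u1 X]] by (auto simp: inhab_def modal_def)
  have t: "has (Univ i # \<Gamma>) (Tup ?M p) (hprop i)"
    unfolding hprop_def by (rule has_Tup[OF M p _ P]) (simp add: subst_is_prop)
  let ?Q = "Lam (Univ i) (Tup ?M p)"
  have Q: "has \<Gamma> ?Q (hpred i)" using has_Lam[OF t] by (simp add: subst_hprop)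
  have H: "isT (Univ i # \<Gamma>) (hprop i)" by (rule has_isT[OF t])
  have "peq (Univ i # \<Gamma>) (hprop i) (wk ?Q \<cdot> Var 0) (Tup ?M p)" by (rule peq_Lam_wk[OF t])
  then have "peq (Univ i # \<Gamma>) (Univ i) (Fst (Univ i) (wk ?Q \<cdot> Var 0)) (Fst (Univ i) (Tup ?M p))"
  proof (rule peq_cong)
    show "has (hprop i # Univ i # \<Gamma>) (Fst (Univ i) (Var 0)) (wk (Univ i))"
      using has_Fst[OF has_v0[OF H, unfolded subst_hprop, OF refl, unfolded hprop_def]] by (simp add: hprop_def)
  qed (simp_all add: subst_nf)
  moreover have "peq (Univ i # \<Gamma>) (Univ i) (Fst (Univ i) (Tup ?M p)) ?M"
    by (rule ceq_peq[OF ceq_Fst[OF M p _ P]]) (simp add: subst_is_prop)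
  ultimately have "peq (Univ i # \<Gamma>) (Univ i) (local_type i (wk ?Q) (Var 0)) ?M"
    unfolding local_type_nf by (rule peq_trans)
  with u Q have "modal_predicate i \<Gamma> Om eta ?Q" by (simp add: modal_predicate_def)
  then show ?thesis by (rule that)
qed

section \<open>Reflections\<close>

text \<open>
  The type stating that \<open>e : X \<rightarrow> Y\<close> is universal among the maps from \<open>X\<close> to local types.
\<close>

definition universal_unit :: "nat \<Rightarrow> tm \<Rightarrow> tm \<Rightarrow> tm \<Rightarrow> tm \<Rightarrow> tm" where
  "universal_unit i Q X Y e = Pi (Univ i) (local_type i (wk Q) (Var 0) \<rightharpoonup>
     is_equiv (wk Y \<rightharpoonup> Var 0) (wk X \<rightharpoonup> Var 0) (precomp (wk Y \<rightharpoonup> Var 0) (wk X) (wk e)))"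

lemma subst_universal_unit: "subst s (universal_unit i Q X Y e) = universal_unit i (subst s Q) (subst s X) (subst s Y) (subst s e)"
  by (simp add: universal_unit_def subst_local_type subst_notions subst_precomp subst_nf)

definition reflection :: "nat \<Rightarrow> tm \<Rightarrow> tm \<Rightarrow> tm" where
  "reflection i Q X = Sig (Univ i) (Sig (local_type i (wk Q) (Var 0))
     (wk (Sig (wk X \<rightharpoonup> Var 0) (universal_unit i (wk2 Q) (wk2 X) (Var (Suc 0)) (Var 0)))))"

lemma subst_reflection: "subst s (reflection i Q X) = reflection i (subst s Q) (subst s X)"
  by (simp add: reflection_def subst_local_type subst_universal_unit subst_nf)

lemma reflections_nf: "reflections i Q = Pi (Univ i) (reflection i (wk Q) (Var 0))"
  by (simp add: reflections_def reflection_def universal_unit_def subst_local_type subst_notions subst_precomp subst_nf)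

lemma isT_precomp_equiv:
  assumes X: "has \<Gamma> X (Univ i)" and Y: "has \<Gamma> Y (Univ i)" and e: "has \<Gamma> e (X \<rightharpoonup> Y)" and Z: "has \<Gamma> Z (Univ i)"
  shows "isT \<Gamma> (is_equiv (Y \<rightharpoonup> Z) (X \<rightharpoonup> Z) (precomp (Y \<rightharpoonup> Z) X e))"
  using isT_is_equiv[OF has_precomp[OF e isT_wk[OF isT_has[OF Z] isT_has[OF Y] refl]]]
    isT_fn[OF isT_has[OF X] isT_has[OF Z]]
  by (simp add: subst_nf)

lemma isT_universal_unit:
  assumes Q: "has \<Gamma> Q (hpred i)"
    and X: "has \<Gamma> X (Univ i)" and Y: "has \<Gamma> Y (Univ i)" and e: "has \<Gamma> e (X \<rightharpoonup> Y)"
  shows "isT \<Gamma> (universal_unit i Q X Y e)"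
proof -
  have U: "isT \<Gamma> (Univ i)" by (rule has_isT[OF X])
  have Z: "has (Univ i # \<Gamma>) (Var 0) (Univ i)" by (rule has_v0[OF U]) simp
  have w: "has (Univ i # \<Gamma>) (wk Q) (hpred i)" "has (Univ i # \<Gamma>) (wk X) (Univ i)"
    "has (Univ i # \<Gamma>) (wk Y) (Univ i)" "has (Univ i # \<Gamma>) (wk e) (wk X \<rightharpoonup> wk Y)"
    by (rule has_wk[OF Q U refl], simp add: subst_hprop) (rule has_wk[OF X U refl], simp,
        rule has_wk[OF Y U refl], simp, rule has_wk[OF e U refl], simp add: subst_nf)
  show ?thesis unfolding universal_unit_def
    by (rule isT_Pi[OF isT_fn[OF isT_has[OF has_local[OF w(1) Z]] isT_precomp_equiv[OF w(2-4) Z]]])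
qed

text \<open>
  Well-formedness is proved for an arbitrary predicate \<open>Q\<close>, because in the final sum type the
  predicate is a variable.
\<close>

lemma isT_reflection_body:
  assumes Q: "has \<Gamma> Q (hpred i)" and X: "has \<Gamma> X (Univ i)"
  shows "isT (local_type i (wk Q) (Var 0) # Univ i # \<Gamma>)
      (wk (Sig (wk X \<rightharpoonup> Var 0) (universal_unit i (wk2 Q) (wk2 X) (Var (Suc 0)) (Var 0))))"
proof -
  have U: "isT \<Gamma> (Univ i)" by (rule has_isT[OF X])
  have Y: "has (Univ i # \<Gamma>) (Var 0) (Univ i)" by (rule has_v0[OF U]) simp
  have Q1: "has (Univ i # \<Gamma>) (wk Q) (hpred i)" by (rule has_wk[OF Q U refl]) (simp add: subst_hprop)
  have X1: "has (Univ i # \<Gamma>) (wk X) (Univ i)" by (rule has_wk[OF X U refl]) simp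
  have F: "isT (Univ i # \<Gamma>) (wk X \<rightharpoonup> Var 0)" by (rule isT_fn[OF isT_has[OF X1] isT_has[OF Y]])
  note w = wf_subst_k(2)[OF isT_ctx(1)[OF F]]
  have "isT ((wk X \<rightharpoonup> Var 0) # Univ i # \<Gamma>) (universal_unit i (wk2 Q) (wk2 X) (Var (Suc 0)) (Var 0))"
    by (rule isT_universal_unit[OF has_subst[OF Q w refl] has_subst[OF X w refl] has_v1[OF F] has_v0[OF F]])
      (simp_all add: subst_hprop subst_nf)
  from isT_wk[OF isT_Sig[OF this] isT_has[OF has_local[OF Q1 Y]] refl] show ?thesis .
qed

lemma isT_reflections: assumes Q: "has \<Gamma> Q (hpred i)" shows "isT \<Gamma> (reflections i Q)"
proof -
  have U: "isT \<Gamma> (Univ i)" by (rule isT_Univ[OF has_ctx[OF Q]])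
  have X: "has (Univ i # \<Gamma>) (Var 0) (Univ i)" by (rule has_v0[OF U]) simp
  have Q1: "has (Univ i # \<Gamma>) (wk Q) (hpred i)" by (rule has_wk[OF Q U refl]) (simp add: subst_hprop)
  show ?thesis unfolding reflections_nf reflection_def
    by (intro isT_Pi isT_Sig isT_reflection_body Q1 X)
qed

lemma inhab_reflection:
  assumes m: "modal_predicate i \<Gamma> Om eta Q" and X: "has \<Gamma> X (Univ i)"
  shows "inhab \<Gamma> (reflection i Q X)"
proof -
  have u: "modality i \<Gamma> Om eta" and Q: "has \<Gamma> Q (hpred i)" using m by (auto simp: modal_predicate_def)
  have U: "isT \<Gamma> (Univ i)" by (rule has_isT[OF X])
  have O: "has \<Gamma> (Om \<cdot> X) (Univ i)" by (rule has_Om[OF u X])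
  have e: "has \<Gamma> (eta \<cdot> X) (X \<rightharpoonup> Om \<cdot> X)" by (rule has_eta[OF u X])
  have univ: "inhab \<Gamma> (universal_unit i Q X (Om \<cdot> X) (eta \<cdot> X))"
  proof -
    have Z: "has (Univ i # \<Gamma>) (Var 0) (Univ i)" by (rule has_v0[OF U]) simp
    note m1 = modal_predicate_wk[OF m U]
    have Q1: "has (Univ i # \<Gamma>) (wk Q) (hpred i)" using m1 by (simp add: modal_predicate_def)
    let ?L = "local_type i (wk Q) (Var 0)"
    have L: "isT (Univ i # \<Gamma>) ?L" by (rule isT_has[OF has_local[OF Q1 Z]])
    note m2 = modal_predicate_wk[OF m1 L]
    have w: "wf_subst (?L # Univ i # \<Gamma>) (\<lambda>n. Var (Suc (Suc n))) \<Gamma>" by (rule wf_subst_k(2)[OF isT_ctx(1)[OF L]])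
    have X2: "has (?L # Univ i # \<Gamma>) (wk2 X) (Univ i)" by (rule has_subst[OF X w refl]) simp
    have Z2: "has (?L # Univ i # \<Gamma>) (Var (Suc 0)) (Univ i)" by (rule has_v1[OF L]) simp
    have "inhab (?L # Univ i # \<Gamma>) (local_type i (wk (wk Q)) (Var (Suc 0)))"
      by (rule inhabI[OF has_v0[OF L]]) (simp add: subst_local_type)
    then have "inhab (?L # Univ i # \<Gamma>) (modal (wk (wk Om)) (wk (wk eta)) (Var (Suc 0)))"
      by (simp only: local_iff_modal[OF m2 Z2])
    from precomp_unit_is_equiv[OF _ X2 Z2 this] m2
    show ?thesis unfolding universal_unit_def inhab_Pi
      by (simp add: modal_predicate_def subst_notions subst_precomp subst_nf)
  qed
  note B = isT_reflection_body[OF Q X]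
  have b: "isT \<Gamma> (Sig (X \<rightharpoonup> Om \<cdot> X) (universal_unit i (wk Q) (wk X) (wk Om \<cdot> wk X) (Var 0)))"
  proof -
    have F: "isT \<Gamma> (X \<rightharpoonup> Om \<cdot> X)" by (rule has_isT[OF e])
    show ?thesis
      by (rule isT_Sig[OF isT_universal_unit[OF has_wk[OF Q F refl] has_wk[OF X F refl] has_wk[OF O F] has_v0[OF F]]])
        (simp_all add: subst_hprop subst_nf)
  qed
  have r: "inhab \<Gamma> (Sig (X \<rightharpoonup> Om \<cdot> X) (universal_unit i (wk Q) (wk X) (wk Om \<cdot> wk X) (Var 0)))"
    by (rule inhab_Sig[OF e univ _ isT_SigD[OF b]]) (simp add: subst_universal_unit subst_nf)
  have "inhab \<Gamma> (local_type i Q (Om \<cdot> X))"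
    using modal_Om[OF u X] by (simp only: local_iff_modal[OF m O])
  then obtain l where l: "has \<Gamma> l (local_type i Q (Om \<cdot> X))" by (auto simp: inhab_def)
  show ?thesis unfolding reflection_def
    by (rule inhab_Sig[OF O inhab_Sig[OF l r _ isT_wk[OF b has_isT[OF l] refl]] _ isT_Sig[OF B]])
      (simp_all add: subst_local_type subst_universal_unit subst_nf)
qed

lemma inhab_reflections:
  assumes m: "modal_predicate i \<Gamma> Om eta Q" shows "inhab \<Gamma> (reflections i Q)"
proof -
  have U: "isT \<Gamma> (Univ i)" using m by (auto simp: modal_predicate_def intro: isT_Univ has_ctx)
  show ?thesis unfolding reflections_nf inhab_Pi
    by (rule inhab_reflection[OF modal_predicate_wk[OF m U] has_v0[OF U]]) simp
qed

section \<open>Closure under dependent sums\<close>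

text \<open>
  The hypothesis and the conclusion of \<open>sigma_closed\<close> for a type \<open>X\<close> and a family \<open>P\<close> over it.
\<close>

definition fibres_local :: "nat \<Rightarrow> tm \<Rightarrow> tm \<Rightarrow> tm \<Rightarrow> tm" where
  "fibres_local i Q X P = Pi X (local_type i (wk Q) (wk P \<cdot> Var 0))"

definition total_local :: "nat \<Rightarrow> tm \<Rightarrow> tm \<Rightarrow> tm \<Rightarrow> tm" where
  "total_local i Q X P = local_type i Q (Sig X (wk P \<cdot> Var 0))"

lemma subst_fibres_total:
  "subst s (fibres_local i Q X P) = fibres_local i (subst s Q) (subst s X) (subst s P)"
  "subst s (total_local i Q X P) = total_local i (subst s Q) (subst s X) (subst s P)"
  by (simp_all add: fibres_local_def total_local_def subst_local_type subst_nf)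

lemma sigma_closed_nf: "sigma_closed i Q = Pi (Univ i) (local_type i (wk Q) (Var 0) \<rightharpoonup>
    Pi (Var 0 \<rightharpoonup> Univ i) (fibres_local i (wk2 Q) (Var (Suc 0)) (Var 0) \<rightharpoonup> total_local i (wk2 Q) (Var (Suc 0)) (Var 0)))"
  by (simp add: sigma_closed_def fibres_local_def total_local_def subst_local_type subst_nf)

lemma has_family_at:
  assumes X: "has \<Gamma> X (Univ i)" and P: "has \<Gamma> P (X \<rightharpoonup> Univ i)"
  shows "has (X # \<Gamma>) (wk P \<cdot> Var 0) (Univ i)"
  using has_app0[OF P] by simp

lemma isT_fibres_total:
  assumes Q: "has \<Gamma> Q (hpred i)" and X: "has \<Gamma> X (Univ i)" and P: "has \<Gamma> P (X \<rightharpoonup> Univ i)"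
  shows "isT \<Gamma> (fibres_local i Q X P)" and "isT \<Gamma> (total_local i Q X P)"
proof -
  note B = has_family_at[OF X P]
  have "has (X # \<Gamma>) (wk Q) (hpred i)" by (rule has_wk[OF Q isT_has[OF X] refl]) (simp add: subst_hprop)
  from isT_Pi[OF isT_has[OF has_local[OF this B]]] show "isT \<Gamma> (fibres_local i Q X P)"
    by (simp add: fibres_local_def)
  from isT_has[OF has_local[OF Q has_Sig_U[OF X B]]] show "isT \<Gamma> (total_local i Q X P)"
    by (simp add: total_local_def)
qed

lemma isT_sigma_closed_body:
  assumes Q: "has \<Gamma> Q (hpred i)" and X: "has \<Gamma> X (Univ i)"
  shows "isT ((X \<rightharpoonup> Univ i) # \<Gamma>) (fibres_local i (wk Q) (wk X) (Var 0))"
    and "isT ((X \<rightharpoonup> Univ i) # \<Gamma>) (total_local i (wk Q) (wk X) (Var 0))"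
proof -
  have F: "isT \<Gamma> (X \<rightharpoonup> Univ i)" by (rule isT_fn[OF isT_has[OF X] has_isT[OF X]])
  have Q1: "has ((X \<rightharpoonup> Univ i) # \<Gamma>) (wk Q) (hpred i)" by (rule has_wk[OF Q F refl]) (simp add: subst_hprop)
  have X1: "has ((X \<rightharpoonup> Univ i) # \<Gamma>) (wk X) (Univ i)" by (rule has_wk[OF X F refl]) simp
  have P: "has ((X \<rightharpoonup> Univ i) # \<Gamma>) (Var 0) (wk X \<rightharpoonup> Univ i)" by (rule has_v0[OF F]) simp
  show "isT ((X \<rightharpoonup> Univ i) # \<Gamma>) (fibres_local i (wk Q) (wk X) (Var 0))"
    and "isT ((X \<rightharpoonup> Univ i) # \<Gamma>) (total_local i (wk Q) (wk X) (Var 0))"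
    by (rule isT_fibres_total[OF Q1 X1 P])+
qed

lemma isT_sigma_closed: assumes Q: "has \<Gamma> Q (hpred i)" shows "isT \<Gamma> (sigma_closed i Q)"
proof -
  have U: "isT \<Gamma> (Univ i)" by (rule isT_Univ[OF has_ctx[OF Q]])
  have X: "has (Univ i # \<Gamma>) (Var 0) (Univ i)" by (rule has_v0[OF U]) simp
  have Q1: "has (Univ i # \<Gamma>) (wk Q) (hpred i)" by (rule has_wk[OF Q U refl]) (simp add: subst_hprop)
  have "isT (Univ i # \<Gamma>) (Pi (Var 0 \<rightharpoonup> Univ i)
      (fibres_local i (wk2 Q) (Var (Suc 0)) (Var 0) \<rightharpoonup> total_local i (wk2 Q) (Var (Suc 0)) (Var 0)))"
    using isT_Pi[OF isT_fn[OF isT_sigma_closed_body[OF Q1 X]]] by (simp add: subst_nf)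
  from isT_Pi[OF isT_fn[OF isT_has[OF has_local[OF Q1 X]] this]] show ?thesis
    by (simp only: sigma_closed_nf)
qed

lemma inhab_total_local:
  assumes m: "modal_predicate i \<Gamma> Om eta Q" and X: "has \<Gamma> X (Univ i)" and P: "has \<Gamma> P (X \<rightharpoonup> Univ i)"
    and lX: "inhab \<Gamma> (local_type i Q X)" and lP: "inhab \<Gamma> (fibres_local i Q X P)"
  shows "inhab \<Gamma> (total_local i Q X P)"
proof -
  have u: "modality i \<Gamma> Om eta" using m by (simp add: modal_predicate_def)
  note B = has_family_at[OF X P]
  have "inhab (X # \<Gamma>) (modal (wk Om) (wk eta) (wk P \<cdot> Var 0))"
    using lP unfolding fibres_local_def inhab_Pi
    by (simp only: local_iff_modal[OF modal_predicate_wk[OF m isT_has[OF X]] B])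
  from sigma_modal[OF u X B _ this] lX show ?thesis
    by (simp only: total_local_def local_iff_modal[OF m X] local_iff_modal[OF m has_Sig_U[OF X B]])
qed

lemma inhab_sigma_closed:
  assumes m: "modal_predicate i \<Gamma> Om eta Q" shows "inhab \<Gamma> (sigma_closed i Q)"
proof -
  have Q: "has \<Gamma> Q (hpred i)" using m by (simp add: modal_predicate_def)
  have U: "isT \<Gamma> (Univ i)" by (rule isT_Univ[OF has_ctx[OF Q]])
  have X: "has (Univ i # \<Gamma>) (Var 0) (Univ i)" by (rule has_v0[OF U]) simp
  have Q1: "has (Univ i # \<Gamma>) (wk Q) (hpred i)" by (rule has_wk[OF Q U refl]) (simp add: subst_hprop)
  let ?L = "local_type i (wk Q) (Var 0)"
  have L: "isT (Univ i # \<Gamma>) ?L" by (rule isT_has[OF has_local[OF Q1 X]])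
  let ?\<Delta> = "?L # Univ i # \<Gamma>"
  have X2: "has ?\<Delta> (Var (Suc 0)) (Univ i)" by (rule has_v1[OF L]) simp
  have Q2: "has ?\<Delta> (wk2 Q) (hpred i)"
    by (rule has_subst[OF Q wf_subst_k(2)[OF isT_ctx(1)[OF L]] refl]) (simp add: subst_hprop)
  have F: "isT ?\<Delta> (Var (Suc 0) \<rightharpoonup> Univ i)" by (rule isT_fn[OF isT_has[OF X2] has_isT[OF X2]])
  let ?\<Delta>' = "fibres_local i (wk (wk2 Q)) (wk (Var (Suc 0))) (Var 0) # (Var (Suc 0) \<rightharpoonup> Univ i) # ?\<Delta>"
  note H = isT_sigma_closed_body(1)[OF Q2 X2]
  let ?k4 = "\<lambda>n. Var (Suc (Suc (Suc (Suc n))))"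
  note m4 = modal_predicate_subst[OF m wf_subst_k(4)[OF isT_ctx(1)[OF H]]]
  have X4: "has ?\<Delta>' (Var (Suc (Suc (Suc 0)))) (Univ i)" by (rule has_v3[OF H]) simp
  have P4: "has ?\<Delta>' (Var (Suc 0)) (Var (Suc (Suc (Suc 0))) \<rightharpoonup> Univ i)" by (rule has_v1[OF H]) simp
  have lX: "inhab ?\<Delta>' (local_type i (subst ?k4 Q) (Var (Suc (Suc (Suc 0)))))"
    by (rule inhabI[OF has_v2[OF H]]) (simp add: subst_local_type subst_nf)
  have lP: "inhab ?\<Delta>' (fibres_local i (subst ?k4 Q) (Var (Suc (Suc (Suc 0)))) (Var (Suc 0)))"
    by (rule inhabI[OF has_v0[OF H]]) (simp add: subst_fibres_total subst_nf)
  from inhab_total_local[OF m4 X4 P4 lX lP] show ?thesis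
    unfolding sigma_closed_nf inhab_Pi by (simp add: subst_fibres_total inhab_Pi subst_nf)
qed

section \<open>The subuniverse determined by a modality\<close>

lemma inhab_equiv_of_peq:
  assumes p: "peq \<Gamma> (Univ i) A B" shows "inhab \<Gamma> (A \<simeq>\<^sub>t B)"
proof -
  have A: "has \<Gamma> A (Univ i)" by (rule peqD(1)[OF p])
  have U: "isT \<Gamma> (Univ i)" by (rule has_isT[OF A])
  have "isT (Univ i # \<Gamma>) (wk A \<simeq>\<^sub>t Var 0)"
    by (rule isT_has[OF has_equiv_type[OF has_wk[OF A U refl] has_v0[OF U]]]) simp_all
  from transport[OF p this inhabI[OF has_id_equiv[OF A]]] show ?thesis by (simp add: subst_notions subst_nf)
qed

lemma same_modal_types_nf:
  "same_modal_types i Om eta Q = Pi (Univ i) (modal (wk Om) (wk eta) (Var 0) \<simeq>\<^sub>t local_type i (wk Q) (Var 0))"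
  by (simp add: same_modal_types_def subst_nf)

lemma inhab_same_modal_types: "modal_predicate i \<Gamma> Om eta Q \<Longrightarrow> inhab \<Gamma> (same_modal_types i Om eta Q)"
  unfolding same_modal_types_nf inhab_Pi modal_predicate_def by (blast intro: inhab_equiv_of_peq peq_sym)

lemma isT_same_modal_types:
  assumes u: "modality i \<Gamma> Om eta" and Q: "has \<Gamma> Q (hpred i)"
  shows "isT \<Gamma> (same_modal_types i Om eta Q)"
proof -
  have U: "isT \<Gamma> (Univ i)" by (rule isT_Univ[OF has_ctx[OF Q]])
  have X: "has (Univ i # \<Gamma>) (Var 0) (Univ i)" by (rule has_v0[OF U]) simp
  have Q1: "has (Univ i # \<Gamma>) (wk Q) (hpred i)" by (rule has_wk[OF Q U refl]) (simp add: subst_hprop)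
  show ?thesis unfolding same_modal_types_nf
    by (rule isT_Pi[OF isT_has[OF has_equiv_type[OF has_modal[OF modality_wk[OF u U] X] has_local[OF Q1 X]]]])
qed

text \<open>
  Folding the triple product lets substitutions pass through it in one step.
\<close>

definition subuniverse_data :: "nat \<Rightarrow> tm \<Rightarrow> tm \<Rightarrow> tm \<Rightarrow> tm" where
  "subuniverse_data i Om eta Q =
     reflections i Q \<times>\<^sub>t sigma_closed i Q \<times>\<^sub>t same_modal_types i Om eta Q"

lemma subst_subuniverse_data:
  "subst s (subuniverse_data i Om eta Q) = subuniverse_data i (subst s Om) (subst s eta) (subst s Q)"
  by (simp add: subuniverse_data_def subst_notions reflections_nf sigma_closed_nf same_modal_types_nf
      subst_reflection subst_fibres_total subst_local_type subst_modal subst_nf)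

lemma isT_prod: "isT \<Gamma> A \<Longrightarrow> isT \<Gamma> B \<Longrightarrow> isT \<Gamma> (A \<times>\<^sub>t B)"
  by (simp add: subst_nf) (rule isT_Sig, rule isT_wk, auto)

lemma inhab_prod: assumes a: "inhab \<Gamma> A" and b: "inhab \<Gamma> B" shows "inhab \<Gamma> (A \<times>\<^sub>t B)"
proof -
  obtain x where x: "has \<Gamma> x A" using a by (auto simp: inhab_def)
  from inhab_Sig[OF x b _ isT_wk[OF inhab_isT[OF b] has_isT[OF x] refl]] show ?thesis by (simp add: subst_nf)
qed

lemma inhab_subuniverse_data:
  assumes u: "modality i \<Gamma> Om eta"
  shows "inhab \<Gamma> (Sig (hpred i) (subuniverse_data i (wk Om) (wk eta) (Var 0)))"
proof -
  obtain Q where m: "modal_predicate i \<Gamma> Om eta Q" by (rule modal_predicate_exists[OF u])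
  have Q: "has \<Gamma> Q (hpred i)" using m by (simp add: modal_predicate_def)
  have F: "isT \<Gamma> (hpred i)" by (rule has_isT[OF Q])
  have q: "has (hpred i # \<Gamma>) (Var 0) (hpred i)" by (rule has_v0[OF F]) (simp add: subst_hprop)
  have T: "isT (hpred i # \<Gamma>) (subuniverse_data i (wk Om) (wk eta) (Var 0))"
    unfolding subuniverse_data_def
    by (intro isT_prod isT_reflections[OF q] isT_sigma_closed[OF q] isT_same_modal_types[OF modality_wk[OF u F] q])
  have "inhab \<Gamma> (subuniverse_data i Om eta Q)"
    unfolding subuniverse_data_def
    by (intro inhab_prod inhab_reflections[OF m] inhab_sigma_closed[OF m] inhab_same_modal_types[OF m])
  from inhab_Sig[OF Q this _ T] show ?thesis by (simp add: subst_subuniverse_data subst_nf)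
qed

section \<open>The closed statement\<close>

text \<open>
  A hypothesis of the theorem can be used as a variable only if its type is well-formed over the
  preceding hypotheses. This is the purpose of the typing lemmas in this section.
\<close>

lemma isT_unit_type:
  assumes O: "has \<Gamma> Om (Univ i \<rightharpoonup> Univ i)" shows "isT \<Gamma> (unit_type i Om)"
proof -
  have U: "isT \<Gamma> (Univ i)" by (rule isT_Univ[OF has_ctx[OF O]])
  have X: "has (Univ i # \<Gamma>) (Var 0) (Univ i)" by (rule has_v0[OF U]) simp
  have O1: "has (Univ i # \<Gamma>) (wk Om) (Univ i \<rightharpoonup> Univ i)" by (rule has_wk[OF O U refl]) simp
  from isT_Pi[OF isT_fn[OF isT_has[OF X] isT_has[OF has_App_fn[OF O1 X]]]]
  show ?thesis by (simp add: unit_type_def subst_nf)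
qed

lemma isT_unique_elim_at:
  assumes O: "has \<Gamma> Om (Univ i \<rightharpoonup> Univ i)" and e: "has \<Gamma> e (A \<rightharpoonup> Om \<cdot> A)"
    and A: "has \<Gamma> A (Univ i)" and P: "has \<Gamma> P (Om \<cdot> A \<rightharpoonup> Univ i)"
  defines "F \<equiv> Pi (Om \<cdot> A) (wk Om \<cdot> (wk P \<cdot> Var 0))"
  shows "isT \<Gamma> (is_equiv F (Pi A (wk Om \<cdot> (wk P \<cdot> (wk e \<cdot> Var 0)))) (precomp F A e))"
proof -
  have OA: "has \<Gamma> (Om \<cdot> A) (Univ i)" by (rule has_App_fn[OF O A])
  have O1: "has (Om \<cdot> A # \<Gamma>) (wk Om) (Univ i \<rightharpoonup> Univ i)" by (rule has_wk[OF O isT_has[OF OA] refl]) simp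
  have C: "isT (Om \<cdot> A # \<Gamma>) (wk Om \<cdot> (wk P \<cdot> Var 0))"
    by (rule isT_has[OF has_App_fn[OF O1 has_family_at[OF OA P]]])
  have A': "isT \<Gamma> A" by (rule isT_has[OF A])
  have "wf_subst (A # \<Gamma>) (wk e \<cdot> Var 0 .: (\<lambda>n. Var (Suc n))) (Om \<cdot> A # \<Gamma>)"
    by (rule wf_subst_Cons[OF wf_subst_k(1)[OF isT_ctx(1)[OF A']] has_app0[OF e] refl])
  from isT_subst[OF C this refl]
  have "isT \<Gamma> (Pi A (wk Om \<cdot> (wk P \<cdot> (wk e \<cdot> Var 0))))" by (intro isT_Pi) (simp add: subst_nf)
  with isT_is_equiv[OF has_precomp[OF e C]] show ?thesis by (simp add: F_def subst_nf)
qed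

lemma unique_elim_nf:
  "unique_elim i Om eta = Pi (Univ i) (Pi (wk Om \<cdot> Var 0 \<rightharpoonup> Univ i)
     (is_equiv (Pi (wk2 Om \<cdot> Var (Suc 0)) (wk (wk2 Om) \<cdot> (wk (Var 0) \<cdot> Var 0)))
        (Pi (Var (Suc 0)) (wk (wk2 Om) \<cdot> (wk (Var 0) \<cdot> (wk (wk2 eta \<cdot> Var (Suc 0)) \<cdot> Var 0))))
        (precomp (Pi (wk2 Om \<cdot> Var (Suc 0)) (wk (wk2 Om) \<cdot> (wk (Var 0) \<cdot> Var 0))) (Var (Suc 0)) (wk2 eta \<cdot> Var (Suc 0)))))"
  by (simp add: unique_elim_def Let_def subst_nf)

lemma isT_unique_elim:
  assumes O: "has \<Gamma> Om (Univ i \<rightharpoonup> Univ i)" and e: "has \<Gamma> eta (unit_type i Om)"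
  shows "isT \<Gamma> (unique_elim i Om eta)"
proof -
  have U: "isT \<Gamma> (Univ i)" by (rule isT_Univ[OF has_ctx[OF O]])
  have X: "has (Univ i # \<Gamma>) (Var 0) (Univ i)" by (rule has_v0[OF U]) simp
  have O1: "has (Univ i # \<Gamma>) (wk Om) (Univ i \<rightharpoonup> Univ i)" by (rule has_wk[OF O U refl]) simp
  have F: "isT (Univ i # \<Gamma>) (wk Om \<cdot> Var 0 \<rightharpoonup> Univ i)"
    by (rule isT_fn[OF isT_has[OF has_App_fn[OF O1 X]] has_isT[OF X]])
  let ?D = "(wk Om \<cdot> Var 0 \<rightharpoonup> Univ i) # Univ i # \<Gamma>"
  have w: "wf_subst ?D (\<lambda>n. Var (Suc (Suc n))) \<Gamma>" by (rule wf_subst_k(2)[OF isT_ctx(1)[OF F]])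
  have O2: "has ?D (wk2 Om) (Univ i \<rightharpoonup> Univ i)" by (rule has_subst[OF O w refl]) simp
  have X2: "has ?D (Var (Suc 0)) (Univ i)" by (rule has_v1[OF F]) simp
  have P2: "has ?D (Var 0) (wk2 Om \<cdot> Var (Suc 0) \<rightharpoonup> Univ i)" by (rule has_v0[OF F]) (simp add: subst_nf)
  have "has ?D (wk2 eta) (Pi (Univ i) (Var 0 \<rightharpoonup> wk (wk2 Om) \<cdot> Var 0))"
    by (rule has_subst[OF e w refl]) (simp add: unit_type_def subst_nf)
  from has_App[OF this X2] have e2: "has ?D (wk2 eta \<cdot> Var (Suc 0)) (Var (Suc 0) \<rightharpoonup> wk2 Om \<cdot> Var (Suc 0))"
    by (simp add: subst_nf)
  show ?thesis unfolding unique_elim_nf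
    by (intro isT_Pi isT_unique_elim_at[OF O2 e2 X2 P2])
qed

theorem mainTheorem10:
  fixes i :: nat
  shows "\<exists>t. [] \<turnstile> t \<Ztypecolon>
    Pi (Univ i \<rightarrow>\<^sub>t Univ i) (Pi (unit_type i (Var 0)) (unique_elim i (Var 1) (Var 0) \<rightarrow>\<^sub>t
      Sig (Univ i \<rightarrow>\<^sub>t hprop i)
        (reflections i (Var 0) \<times>\<^sub>t
         sigma_closed i (Var 0) \<times>\<^sub>t
         same_modal_types i (Var 2) (Var 1) (Var 0))))"
proof -
  let ?F = "Univ i \<rightharpoonup> Univ i"
  have U: "isT [] (Univ i)" by (rule isT_Univ[OF ctx_nil])
  have F: "isT [] ?F" by (rule isT_fn[OF U U])
  have O1: "has [?F] (Var 0) (Univ i \<rightharpoonup> Univ i)" by (rule has_v0[OF F]) simp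
  note T = isT_unit_type[OF O1]
  let ?\<Gamma> = "[unit_type i (Var 0), ?F]"
  have O2: "has ?\<Gamma> (Var 1) (Univ i \<rightharpoonup> Univ i)" using has_v1[OF T] by simp
  have e2: "has ?\<Gamma> (Var 0) (unit_type i (Var 1))" by (rule has_v0[OF T]) (simp add: subst_unique_elim)
  note E = isT_unique_elim[OF O2 e2]
  let ?\<Delta> = "unique_elim i (Var 1) (Var 0) # ?\<Gamma>"
  have "has ?\<Delta> (Var 2) (Univ i \<rightharpoonup> Univ i)" by (rule has_wk[OF O2 E]) (simp_all add: numeral_eq_Suc)
  moreover have "has ?\<Delta> (Var 1) (unit_type i (Var 2))"
    by (rule has_wk[OF e2 E]) (simp_all add: subst_unique_elim numeral_eq_Suc)
  moreover have "inhab ?\<Delta> (unique_elim i (Var 2) (Var 1))"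
    by (rule inhabI[OF has_v0[OF E]]) (simp add: subst_unique_elim numeral_eq_Suc)
  ultimately have "modality i ?\<Delta> (Var 2) (Var 1)" by (simp add: modality_def)
  from inhab_subuniverse_data[OF this]
  have "inhab ?\<Delta> (wk (Sig (hpred i) (subuniverse_data i (Var 2) (Var 1) (Var 0))))"
    by (simp add: subst_subuniverse_data subst_hprop subst_nf)
  then have "inhab [] (Pi ?F (Pi (unit_type i (Var 0)) (unique_elim i (Var 1) (Var 0) \<rightharpoonup>
      Sig (hpred i) (subuniverse_data i (Var 2) (Var 1) (Var 0)))))"
    unfolding inhab_Pi .
  then show ?thesis
    by (simp add: inhab_def has_def subuniverse_data_def subst_hprop fun_type_def shift_def ren_as_subst)
qed

end
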